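(* Let $d\ge2$, let $\Omega\subset\mathbb{R}^d$ be an open set with compact Lipschitz boundary, let $u\mapsto\overline{u}$ be an extension operator $\mathrm{BV}(\Omega)\to\mathrm{BV}(\mathbb{R}^d)$ (in the sense recalled in the context), and let $\alpha\in(1,d)$. For every $K>0$ there is a constant $C>0$ (depending only on $d$, $\alpha$, $\Omega$, the extension operator and $K$) such that $$\|I_\alpha D\overline{u}\|_{L^1(\nu)}\le C\left(|Du|(\Omega)+\|u\|_{L^1(\Omega)}\right)$$ for all $u\in\mathrm{BV}(\Omega)$ and every (nonnegative) Radon measure $\nu$ on $\mathbb{R}^d$ such that $\nu(B(x,r))\le K r^{d-\alpha}$ for all $x\in\mathbb{R}^d$ and $r>0$.
   Context: $\mathrm{BV}(\Omega)$ is the space of integrable functions $u$ on $\Omega$ whose distributional gradient $Du$ is a finite ($\mathbb{R}^d$-valued) Radon measure in $\Omega$, normed by $\|u\|_{L^1(\Omega)}+|Du|(\Omega)$; similarly for $\mathrm{BV}(\mathbb{R}^d)$. $|Du|$ is the total variation measure of $Du$. For a measure $\mu$ on $\mathbb{R}^d$ and $\alpha\in(0,d)$, the Riesz potential is $I_\alpha\mu(x)=\frac{1}{\gamma(\alpha)}\int_{\mathbb{R}^d}\frac{d\mu(y)}{|x-y|^{d-\alpha}}$, where $\gamma(\alpha)$ is a suitable (standard) normalization constant; for vector-valued measures it is taken componentwise. Extension operator (Ambrosio–Fusco–Pallara, Definition 3.20): a linear continuous map $u\mapsto\overline{u}$ from $\mathrm{BV}(\Omega)$ to $\mathrm{BV}(\mathbb{R}^d)$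 with $\overline{u}=u$ a.e. in $\Omega$ such that, for a given open set $A\supset\overline{\Omega}$, (a) $\overline{u}=0$ a.e. in $\mathbb{R}^d\setminus A$; (b) $|D\overline{u}|(\partial\Omega)=0$; (c) for every $p\in[1,\infty]$ the restriction of the map to $W^{1,p}(\Omega)$ is a continuous linear map into $W^{1,p}(\mathbb{R}^d)$. Such operators exist for open sets with compact Lipschitz boundary.
   Formalization: Each component of I_α Dū(x) is the Lebesgue integral where it converges absolutely and is taken to be 0 at points x where it does not; such points can have positive ν-measure (e.g. d=3, α=2, ν = length on a line), where the potential as defined has no value. *)

theory Defs
  imports "HOL-Analysis.Analysis"
begin

text \<open>
  The space \<open>\<real>\<^sup>d\<close> is a type of class \<^class>\<open>euclidean_space\<close> with \<open>d = DIM('a)\<close>. Elements of function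
  spaces over an open set \<open>\<Omega>\<close> are represented by total functions, of which only the values on \<open>\<Omega>\<close>
  (up to a Lebesgue null set) matter.
\<close>

subsection \<open>Vector-valued measures\<close>

text \<open>
  As in Ambrosio--Fusco--Pallara, a vector-valued measure is a countably additive set function.
  Of the argument \<open>M\<close> only the \<open>\<sigma>\<close>-algebra is used.
\<close>

definition total_variation :: "'a measure \<Rightarrow> ('a set \<Rightarrow> 'b::real_normed_vector) \<Rightarrow> 'a measure" where
  "total_variation M m = measure_of (space M) (sets M)
     (\<lambda>B. SUP A\<in>{A :: nat \<Rightarrow> 'a set. range A \<subseteq> sets M \<and> disjoint_family A \<and> (\<Union>i. A i) = B}.
            \<Sum>i. ennreal (norm (m (A i))))"

text \<open>
  The value 0 outside the \<open>\<sigma>\<close>-algebra is a normalization: it makes a vector measure determined by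
  its values on measurable sets.
\<close>

definition finite_vector_measure :: "'a measure \<Rightarrow> ('a set \<Rightarrow> 'b::real_normed_vector) \<Rightarrow> bool" where
  "finite_vector_measure M m \<longleftrightarrow>
     (\<forall>A :: nat \<Rightarrow> 'a set. range A \<subseteq> sets M \<longrightarrow> disjoint_family A \<longrightarrow>
        (\<lambda>i. m (A i)) sums m (\<Union>i. A i)) \<and>
     emeasure (total_variation M m) (space M) < \<infinity> \<and>
     (\<forall>B. B \<notin> sets M \<longrightarrow> m B = 0)"

text \<open>Jordan decomposition of a real measure: \<open>m\<^sup>\<plusminus> = (|m| \<plusminus> m) / 2\<close>.\<close>

definition positive_part :: "'a measure \<Rightarrow> ('a set \<Rightarrow> real) \<Rightarrow> 'a measure" where
  "positive_part M m = measure_of (space M) (sets M)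
     (\<lambda>B. ennreal ((measure (total_variation M m) B + m B) / 2))"

definition negative_part :: "'a measure \<Rightarrow> ('a set \<Rightarrow> real) \<Rightarrow> 'a measure" where
  "negative_part M m = measure_of (space M) (sets M)
     (\<lambda>B. ennreal ((measure (total_variation M m) B - m B) / 2))"

text \<open>Functions that are not \<open>|m|\<close>-summable get the value 0, as for the Bochner integral.\<close>

definition signed_integral :: "'a measure \<Rightarrow> ('a set \<Rightarrow> real) \<Rightarrow> ('a \<Rightarrow> real) \<Rightarrow> real" where
  "signed_integral M m f =
     (if integrable (total_variation M m) f
      then integral\<^sup>L (positive_part M m) f - integral\<^sup>L (negative_part M m) f else 0)"

definition radon_measure :: "'a::euclidean_space measure \<Rightarrow> bool" where
  "radon_measure \<nu> \<longleftrightarrow> sets \<nu> = sets borel \<and> (\<forall>S. compact S \<longrightarrow> emeasure \<nu> S < \<infinity>)"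


subsection \<open>Distributional derivatives\<close>

primrec times_cont_diff :: "nat \<Rightarrow> ('a::euclidean_space \<Rightarrow> real) \<Rightarrow> bool" where
  "times_cont_diff 0 f \<longleftrightarrow> continuous_on UNIV f"
| "times_cont_diff (Suc k) f \<longleftrightarrow> (\<forall>x. f differentiable at x) \<and>
     (\<forall>b\<in>Basis. times_cont_diff k (\<lambda>x. frechet_derivative f (at x) b))"

definition test_function :: "'a::euclidean_space set \<Rightarrow> ('a \<Rightarrow> real) \<Rightarrow> bool" where
  "test_function \<Omega> \<phi> \<longleftrightarrow> (\<forall>k. times_cont_diff k \<phi>) \<and>
     compact (closure {x. \<phi> x \<noteq> 0}) \<and> closure {x. \<phi> x \<noteq> 0} \<subseteq> \<Omega>"

definition has_gradient_measure ::
    "'a::euclidean_space set \<Rightarrow> ('a \<Rightarrow> real) \<Rightarrow> ('a set \<Rightarrow> 'a) \<Rightarrow> bool" where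
  "has_gradient_measure \<Omega> u m \<longleftrightarrow> finite_vector_measure (restrict_space borel \<Omega>) m \<and>
     (\<forall>\<phi>. test_function \<Omega> \<phi> \<longrightarrow> (\<forall>b\<in>Basis.
        (LINT x|lebesgue_on \<Omega>. u x * frechet_derivative \<phi> (at x) b) =
        - signed_integral (restrict_space borel \<Omega>) (\<lambda>B. m B \<bullet> b) \<phi>))"

definition gradient_measure :: "'a::euclidean_space set \<Rightarrow> ('a \<Rightarrow> real) \<Rightarrow> 'a set \<Rightarrow> 'a" where
  "gradient_measure \<Omega> u = (SOME m. has_gradient_measure \<Omega> u m)"

abbreviation variation :: "'a::euclidean_space set \<Rightarrow> ('a \<Rightarrow> real) \<Rightarrow> 'a measure" where
  "variation \<Omega> u \<equiv> total_variation (restrict_space borel \<Omega>) (gradient_measure \<Omega> u)"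

definition has_weak_gradient ::
    "'a::euclidean_space set \<Rightarrow> ('a \<Rightarrow> real) \<Rightarrow> ('a \<Rightarrow> 'a) \<Rightarrow> bool" where
  "has_weak_gradient \<Omega> u g \<longleftrightarrow>
     (\<forall>\<phi>. test_function \<Omega> \<phi> \<longrightarrow> (\<forall>b\<in>Basis.
        (LINT x|lebesgue_on \<Omega>. u x * frechet_derivative \<phi> (at x) b) =
        - (LINT x|lebesgue_on \<Omega>. \<phi> x * (g x \<bullet> b))))"


subsection \<open>Function spaces\<close>

definition BV :: "'a::euclidean_space set \<Rightarrow> ('a \<Rightarrow> real) set" where
  "BV \<Omega> = {u. integrable (lebesgue_on \<Omega>) u \<and> (\<exists>m. has_gradient_measure \<Omega> u m)}"

definition L1_norm :: "'a::euclidean_space set \<Rightarrow> ('a \<Rightarrow> real) \<Rightarrow> real" where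
  "L1_norm \<Omega> u = (LINT x|lebesgue_on \<Omega>. \<bar>u x\<bar>)"

definition BV_norm :: "'a::euclidean_space set \<Rightarrow> ('a \<Rightarrow> real) \<Rightarrow> real" where
  "BV_norm \<Omega> u = L1_norm \<Omega> u + measure (variation \<Omega> u) \<Omega>"

definition Lp_space :: "ennreal \<Rightarrow> 'a measure \<Rightarrow> ('a \<Rightarrow> 'b::euclidean_space) set" where
  "Lp_space p M = {f \<in> borel_measurable M.
     if p = \<infinity> then \<exists>c. AE x in M. norm (f x) \<le> c
     else integrable M (\<lambda>x. norm (f x) powr enn2real p)}"

definition Lp_norm :: "ennreal \<Rightarrow> 'a measure \<Rightarrow> ('a \<Rightarrow> 'b::euclidean_space) \<Rightarrow> real" where
  "Lp_norm p M f =
     (if p = \<infinity> then Inf {c. 0 \<le> c \<and> (AE x in M. norm (f x) \<le> c)}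
      else (LINT x|M. norm (f x) powr enn2real p) powr (1 / enn2real p))"

definition is_Lp_gradient ::
    "ennreal \<Rightarrow> 'a::euclidean_space set \<Rightarrow> ('a \<Rightarrow> real) \<Rightarrow> ('a \<Rightarrow> 'a) \<Rightarrow> bool" where
  "is_Lp_gradient p \<Omega> u g \<longleftrightarrow> g \<in> Lp_space p (lebesgue_on \<Omega>) \<and> has_weak_gradient \<Omega> u g"

definition W1p :: "ennreal \<Rightarrow> 'a::euclidean_space set \<Rightarrow> ('a \<Rightarrow> real) set" where
  "W1p p \<Omega> = {u \<in> Lp_space p (lebesgue_on \<Omega>). \<exists>g. is_Lp_gradient p \<Omega> u g}"

definition W1p_norm :: "ennreal \<Rightarrow> 'a::euclidean_space set \<Rightarrow> ('a \<Rightarrow> real) \<Rightarrow> real" where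
  "W1p_norm p \<Omega> u = Lp_norm p (lebesgue_on \<Omega>) u +
     Lp_norm p (lebesgue_on \<Omega>) (SOME g. is_Lp_gradient p \<Omega> u g)"


subsection \<open>Lipschitz boundaries and extension operators\<close>

text \<open>
  Near each boundary point, \<open>\<Omega>\<close> is the strict epigraph, in some direction \<open>e\<close>, of a Lipschitz
  function \<open>g\<close> on the hyperplane orthogonal to \<open>e\<close>.
\<close>

definition lipschitz_boundary :: "'a::euclidean_space set \<Rightarrow> bool" where
  "lipschitz_boundary \<Omega> \<longleftrightarrow>
     (\<forall>x\<in>frontier \<Omega>. \<exists>U e g L. open U \<and> x \<in> U \<and> norm e = 1 \<and>
        L-lipschitz_on {z. z \<bullet> e = 0} g \<and>
        (\<forall>y\<in>U. y \<in> \<Omega> \<longleftrightarrow> g (y - (y \<bullet> e) *\<^sub>R e) < y \<bullet> e))"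

text \<open>
  The first four clauses say that \<open>E\<close> induces a bounded linear map on a.e. classes. In the last one,
  the restriction of \<open>E\<close> to \<open>W\<^sup>1\<^sup>,\<^sup>p(\<Omega>)\<close> is understood on \<open>BV(\<Omega>) \<inter> W\<^sup>1\<^sup>,\<^sup>p(\<Omega>)\<close>, since \<open>W\<^sup>1\<^sup>,\<^sup>p(\<Omega>)\<close> need not be
  contained in \<open>BV(\<Omega>)\<close> when \<open>\<Omega>\<close> is unbounded.
\<close>

definition extension_operator ::
    "'a::euclidean_space set \<Rightarrow> 'a set \<Rightarrow> (('a \<Rightarrow> real) \<Rightarrow> 'a \<Rightarrow> real) \<Rightarrow> bool" where
  "extension_operator \<Omega> A E \<longleftrightarrow>
     (\<forall>u\<in>BV \<Omega>. \<forall>v\<in>BV \<Omega>. (AE x in lebesgue_on \<Omega>. u x = v x) \<longrightarrow> (AE x in lebesgue. E u x = E v x)) \<and>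
     (\<forall>u\<in>BV \<Omega>. \<forall>v\<in>BV \<Omega>. AE x in lebesgue. E (\<lambda>y. u y + v y) x = E u x + E v x) \<and>
     (\<forall>u\<in>BV \<Omega>. \<forall>c. AE x in lebesgue. E (\<lambda>y. c * u y) x = c * E u x) \<and>
     (\<exists>C. \<forall>u\<in>BV \<Omega>. E u \<in> BV UNIV \<and> BV_norm UNIV (E u) \<le> C * BV_norm \<Omega> u) \<and>
     (\<forall>u\<in>BV \<Omega>. AE x in lebesgue_on \<Omega>. E u x = u x) \<and>
     (\<forall>u\<in>BV \<Omega>. AE x in lebesgue_on (- A). E u x = 0) \<and>
     (\<forall>u\<in>BV \<Omega>. emeasure (variation UNIV (E u)) (frontier \<Omega>) = 0) \<and>
     (\<forall>p\<ge>1. \<exists>C. \<forall>u\<in>BV \<Omega> \<inter> W1p p \<Omega>.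
        E u \<in> W1p p UNIV \<and> W1p_norm p UNIV (E u) \<le> C * W1p_norm p \<Omega> u)"


subsection \<open>Riesz potentials\<close>

definition riesz_const :: "nat \<Rightarrow> real \<Rightarrow> real" where
  "riesz_const d \<alpha> =
     pi powr (real d / 2) * 2 powr \<alpha> * Gamma (\<alpha> / 2) / Gamma ((real d - \<alpha>) / 2)"

text \<open>
  Each component is the Lebesgue integral of the kernel, with value 0 where that integral does not
  converge absolutely. Because \<open>0 powr a = 0\<close>, the kernel vanishes for \<open>y = x\<close> instead of being
  infinite there; this does not matter for measures without atoms, such as gradients of \<open>BV\<close>
  functions in dimension at least 2.
\<close>

definition riesz_potential :: "real \<Rightarrow> ('a::euclidean_space set \<Rightarrow> 'a) \<Rightarrow> 'a \<Rightarrow> 'a" where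
  "riesz_potential \<alpha> m x =
     (\<Sum>b\<in>Basis. (1 / riesz_const DIM('a) \<alpha> *
        signed_integral borel (\<lambda>B. m B \<bullet> b) (\<lambda>y. norm (x - y) powr (\<alpha> - DIM('a)))) *\<^sub>R b)"

end

theory Submission
  imports Defs
begin

text \<open>
  Write \<open>d = DIM('a)\<close> and let \<open>u\<close> be a function of bounded variation on the whole space. The Riesz
  kernel is a superposition of smooth bumps,
  \<open>|z|\<^bsup>\<alpha>-d\<^esup> = c \<integral> r\<^bsup>\<alpha>-d-1\<^esup> \<phi>(z/r) dr\<close>. Integrating each bump by parts moves the derivative from
  \<open>u\<close> to \<open>\<phi>\<close>, which gives the pointwise bound
  \<open>|I\<^sub>\<alpha>Du(x)| \<le> C \<integral> r\<^bsup>\<alpha>-d-2\<^esup> \<integral>\<^bsub>B(x,r)\<^esub> |u| dr\<close>. By Tonelli the integral of the right-hand side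
  against \<open>\<nu>\<close> is \<open>\<integral> |u| w\<close> with \<open>w(y) = \<integral> r\<^bsup>\<alpha>-d-2\<^esup> \<nu>(B(y,r)) dr\<close>, and because \<open>\<alpha> > 1\<close> the growth
  condition on \<open>\<nu>\<close> gives \<open>w(Q) \<le> C s\<^bsup>d-1\<^esup>\<close> for cubes \<open>Q\<close> of side \<open>s\<close>. What remains is the trace
  inequality of Meyers and Ziemer, \<open>\<integral> |u| w \<le> C |Du|\<close>. It follows from the layer cake formula and
  Gustin's boxing inequality: a set of finite measure is covered by disjoint dyadic cubes in which its
  density is at most one half but, above the smallest scale, not small, so that the relative isoperimetric
  inequality bounds its perimeter in each of them from below.

  To avoid the theory of sets of finite perimeter, everything is done at a scale \<open>h\<close>: the \<open>r\<close>-integral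
  starts at \<open>h\<close>, the perimeter of \<open>S\<close> is replaced by \<open>h\<^bsup>-d-1\<^esup>\<close> times the measure of the set of pairs at
  distance at most \<open>d h\<close> that are separated by \<open>S\<close>, and \<open>u\<close> is mollified at scale \<open>h\<close>. The bounds do
  not depend on \<open>h\<close>, so Fatou's lemma allows \<open>h\<close> to tend to 0.
\<close>

subsection \<open>Total variation and the Jordan decomposition\<close>

text \<open>Putting absolute values inside the potential loses the theorem: by Tonelli it would need
  a bound on the Riesz potential of \<nu>, and under the growth condition the layer cake formula
  controls that only by K times the integral of dr/r, which diverges logarithmically at both ends.
  So the cancellation in the gradient must be kept, and integration by parts against a bump of
  radius r keeps it at the price of a factor 1/r. The price shows in the weight w: pointwise,
  truncation at h leaves only w <= K/h. What stays bounded independently of h is its mass on a cube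
  of side s, of order s^(d-1), the growth of a measure of codimension one; this is the class to
  which the trace inequality applies. The bound K/h is still essential. In a cube of the smallest
  side h the set may have tiny density, and then s^(d-1) cannot be compared with its perimeter;
  there K/h times the volume of the set is compared with it instead. Therefore the truncation
  radius, the smallest cube side and the step length of the discrete perimeter are all tied to the
  same h, and its powers cancel in the end.\<close>

definition variation_sum :: "'a measure \<Rightarrow> ('a set \<Rightarrow> 'b::real_normed_vector) \<Rightarrow> 'a set \<Rightarrow> ennreal" where
  "variation_sum M m B =
     (SUP A\<in>{A :: nat \<Rightarrow> 'a set. range A \<subseteq> sets M \<and> disjoint_family A \<and> (\<Union>i. A i) = B}.
        \<Sum>i. ennreal (norm (m (A i))))"

lemma ennreal_norm_sums_le:
  fixes f :: "nat \<Rightarrow> 'b::real_normed_vector"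
  assumes "f sums s"
  shows "ennreal (norm s) \<le> (\<Sum>i. ennreal (norm (f i)))"
proof -
  have 1: "(\<lambda>n. ennreal (norm (\<Sum>i<n. f i))) \<longlonglongrightarrow> ennreal (norm s)"
    using assms unfolding sums_def by (intro tendsto_intros)
  have 2: "ennreal (norm (\<Sum>i<n. f i)) \<le> (\<Sum>i. ennreal (norm (f i)))" for n
  proof -
    have "ennreal (norm (\<Sum>i<n. f i)) \<le> ennreal (\<Sum>i<n. norm (f i))"
      by (intro ennreal_leI norm_sum)
    also have "\<dots> = (\<Sum>i<n. ennreal (norm (f i)))" by (simp add: sum_ennreal)
    also have "\<dots> \<le> (\<Sum>i. ennreal (norm (f i)))" by (rule sum_le_suminf) auto
    finally show ?thesis .
  qed
  show ?thesis by (rule Lim_bounded[OF 1, of 0]) (use 2 in blast)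
qed

lemma suminf_swap_ennreal:
  fixes f :: "nat \<Rightarrow> nat \<Rightarrow> ennreal"
  shows "(\<Sum>i. \<Sum>j. f i j) = (\<Sum>j. \<Sum>i. f i j)"
  using nn_integral_suminf[of f "count_space UNIV"] by (simp add: nn_integral_count_space_nat)

context
  fixes M :: "'a measure" and m :: "'a set \<Rightarrow> 'b::real_normed_vector"
  assumes sums: "\<And>A :: nat \<Rightarrow> 'a set. range A \<subseteq> sets M \<Longrightarrow> disjoint_family A \<Longrightarrow>
    (\<lambda>i. m (A i)) sums m (\<Union>i. A i)"
begin

lemma vector_measure_empty: "m {} = 0"
proof -
  have "(\<lambda>i::nat. m {}) sums m (\<Union>i::nat. {})"
    by (rule sums) (auto simp: disjoint_family_on_def)
  then have "(\<lambda>i::nat. m {}) \<longlonglongrightarrow> 0" by (auto dest: sums_summable summable_LIMSEQ_zero)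
  then show ?thesis by (simp add: LIMSEQ_const_iff)
qed

lemma variation_sum_ge:
  assumes "range A \<subseteq> sets M" "disjoint_family A" "(\<Union>i. A i) = B"
  shows "(\<Sum>i. ennreal (norm (m (A i)))) \<le> variation_sum M m B"
  unfolding variation_sum_def using assms by (intro SUP_upper) auto

lemma norm_le_variation_sum:
  assumes "B \<in> sets M"
  shows "ennreal (norm (m B)) \<le> variation_sum M m B"
proof -
  define A where "A = (\<lambda>i::nat. if i = 0 then B else {})"
  have "(\<Sum>i. ennreal (norm (m (A i)))) = (\<Sum>i\<in>{0}. ennreal (norm (m (A i))))"
    by (rule suminf_finite) (auto simp: A_def vector_measure_empty)
  then have "ennreal (norm (m B)) = (\<Sum>i. ennreal (norm (m (A i))))"
    by (simp add: A_def)
  also have "\<dots> \<le> variation_sum M m B"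
    using assms by (intro variation_sum_ge) (auto simp: A_def disjoint_family_on_def split: if_splits)
  finally show ?thesis .
qed

lemma variation_sum_empty: "variation_sum M m {} = 0"
proof -
  have "variation_sum M m {} \<le> 0"
    unfolding variation_sum_def by (rule SUP_least) (auto simp: vector_measure_empty)
  then show ?thesis by simp
qed

text \<open>Any partition of \<open>B\<close> and any partition of \<open>C\<close> merge into one
  partition of the union, so the two suprema add up below the supremum for the union.\<close>

lemma variation_sum_superadditive:
  assumes "B \<in> sets M" "C \<in> sets M" "B \<inter> C = {}"
  shows "variation_sum M m B + variation_sum M m C \<le> variation_sum M m (B \<union> C)"
proof -
  define P where "P B = {A :: nat \<Rightarrow> 'a set. range A \<subseteq> sets M \<and> disjoint_family A \<and> (\<Union>i. A i) = B}" for B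
  define S where "S A = (\<Sum>i. ennreal (norm (m (A i))))" for A :: "nat \<Rightarrow> 'a set"
  have vs: "variation_sum M m B = (SUP A\<in>P B. S A)" for B
    by (simp add: variation_sum_def P_def S_def)
  have ne: "P B \<noteq> {}" if "B \<in> sets M" for B
  proof -
    have "(\<lambda>i::nat. if i = 0 then B else {}) \<in> P B"
      using that by (auto simp: P_def disjoint_family_on_def split: if_splits)
    then show ?thesis by auto
  qed
  have *: "S A + S A' \<le> variation_sum M m (B \<union> C)" if "A \<in> P B" "A' \<in> P C" for A A'
  proof -
    \<comment> \<open>The pieces are interleaved, \<open>A\<close> at even and \<open>A'\<close> at
      odd indices, because a partition is a sequence here.\<close>
    define D where "D i = (if even i then A (i div 2) else A' (i div 2))" for i :: nat
    have dA: "disjoint_family A" and dA': "disjoint_family A'" and uA: "(\<Union>i. A i) = B" and uA': "(\<Union>i. A' i) = C"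
      using that by (auto simp: P_def)
    have AB: "A i \<subseteq> B" "A' i \<subseteq> C" for i using uA uA' by auto
    have dj: "A i \<inter> A' j = {}" for i j using AB[of i] AB[of j] assms(3) by blast
    have dD: "disjoint_family D"
      unfolding disjoint_family_on_def
    proof (intro ballI impI)
      fix i j :: nat assume "i \<noteq> j"
      show "D i \<inter> D j = {}"
      proof (cases "even i = even j")
        case True
        then have "i div 2 \<noteq> j div 2" using \<open>i \<noteq> j\<close> by presburger
        then show ?thesis using True dA dA' by (auto simp: D_def disjoint_family_on_def)
      next
        case False
        then show ?thesis using dj by (auto simp: D_def)
      qed
    qed
    have uD: "(\<Union>i. D i) = B \<union> C"
    proof -
      have "D (2*i) = A i" "D (2*i+1) = A' i" for i by (auto simp: D_def)
      then have "A i \<subseteq> (\<Union>i. D i)" "A' i \<subseteq> (\<Union>i. D i)" for i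
        by (metis UN_upper UNIV_I)+
      then have "B \<union> C \<subseteq> (\<Union>i. D i)" using uA uA' by blast
      moreover have "(\<Union>i. D i) \<subseteq> B \<union> C" using AB by (auto simp: D_def split: if_splits)
      ultimately show ?thesis by blast
    qed
    have "D i \<in> sets M" for i using that by (auto simp: D_def P_def)
    then have le: "S D \<le> variation_sum M m (B \<union> C)"
      unfolding S_def using dD uD by (intro variation_sum_ge) auto
    have "S A + S A' \<le> S D"
    proof -
      have 1: "(\<lambda>n. (\<Sum>i<n. ennreal (norm (m (A i)))) + (\<Sum>i<n. ennreal (norm (m (A' i))))) \<longlonglongrightarrow> S A + S A'"
        unfolding S_def by (intro tendsto_add summable_LIMSEQ) auto
      have 2: "(\<Sum>i<n. ennreal (norm (m (A i)))) + (\<Sum>i<n. ennreal (norm (m (A' i)))) = (\<Sum>i<2*n. ennreal (norm (m (D i))))" for n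
        by (induction n) (auto simp: D_def algebra_simps)
      have "(\<Sum>i<n. ennreal (norm (m (A i)))) + (\<Sum>i<n. ennreal (norm (m (A' i)))) \<le> S D" (is "?l n \<le> _") for n
        unfolding 2 S_def by (rule sum_le_suminf) auto
      then have "\<forall>n\<ge>0. ?l n \<le> S D" by blast
      with 1 show ?thesis by (rule Lim_bounded)
    qed
    then show ?thesis using le by (rule order_trans)
  qed
  have "variation_sum M m B + variation_sum M m C = (SUP A\<in>P B. S A + variation_sum M m C)"
    unfolding vs[of B] using ne[OF assms(1)] by (subst ennreal_SUP_add_left) auto
  also have "\<dots> \<le> variation_sum M m (B \<union> C)"
  proof (rule SUP_least)
    fix A assume A: "A \<in> P B"
    have "S A + variation_sum M m C = (SUP A'\<in>P C. S A + S A')"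
      unfolding vs[of C] using ne[OF assms(2)] by (subst ennreal_SUP_add_right) auto
    also have "\<dots> \<le> variation_sum M m (B \<union> C)" using * A by (intro SUP_least) auto
    finally show "S A + variation_sum M m C \<le> variation_sum M m (B \<union> C)" .
  qed
  finally show ?thesis .
qed

lemma variation_sum_mono:
  assumes "B \<in> sets M" "C \<in> sets M" "B \<subseteq> C"
  shows "variation_sum M m B \<le> variation_sum M m C"
proof -
  have "variation_sum M m B + variation_sum M m (C - B) \<le> variation_sum M m (B \<union> (C - B))"
    using assms by (intro variation_sum_superadditive) auto
  moreover have "B \<union> (C - B) = C" using assms by auto
  ultimately show ?thesis by (auto intro: order_trans[rotated])
qed

lemma variation_sum_finite_superadditive:
  assumes "range B \<subseteq> sets M" "disjoint_family (B :: nat \<Rightarrow> 'a set)"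
  shows "(\<Sum>i<n. variation_sum M m (B i)) \<le> variation_sum M m (\<Union>i<n. B i)"
proof (induction n)
  case 0 then show ?case by simp
next
  case (Suc n)
  have "(\<Sum>i<Suc n. variation_sum M m (B i)) \<le> variation_sum M m (\<Union>i<n. B i) + variation_sum M m (B n)"
    using Suc by (simp add: add_mono)
  also have "\<dots> \<le> variation_sum M m ((\<Union>i<n. B i) \<union> B n)"
  proof (intro variation_sum_superadditive)
    show "(\<Union>i<n. B i) \<inter> B n = {}"
    proof -
      have "B i \<inter> B n = {}" if "i < n" for i
        using assms(2) that by (simp add: disjoint_family_on_def)
      then show ?thesis by blast
    qed
  qed (use assms(1) in auto)
  also have "(\<Union>i<n. B i) \<union> B n = (\<Union>i<Suc n. B i)" by (auto simp: less_Suc_eq)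
  finally show ?case .
qed

text \<open>One inequality is finite superadditivity passed to the limit. For the other, a partition
  \<open>A\<close> of the union is cut by every \<open>B i\<close>: additivity of \<open>m\<close>
  bounds each norm by the sum over the cuts, and after exchanging the two sums the cuts of a fixed
  \<open>B i\<close> form a partition of it.\<close>

lemma variation_sum_countably_additive: "countably_additive (sets M) (variation_sum M m)"
  unfolding countably_additive_def
proof (intro allI impI)
  fix B :: "nat \<Rightarrow> 'a set"
  assume B: "range B \<subseteq> sets M" "disjoint_family B" "(\<Union>i. B i) \<in> sets M"
  show "(\<Sum>i. variation_sum M m (B i)) = variation_sum M m (\<Union>i. B i)"
  proof (rule antisym)
    show "(\<Sum>i. variation_sum M m (B i)) \<le> variation_sum M m (\<Union>i. B i)"
    proof (rule suminf_le_const)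
      fix n
      have "(\<Sum>i<n. variation_sum M m (B i)) \<le> variation_sum M m (\<Union>i<n. B i)"
        by (rule variation_sum_finite_superadditive[OF B(1,2)])
      also have "\<dots> \<le> variation_sum M m (\<Union>i. B i)"
        using B by (intro variation_sum_mono) auto
      finally show "(\<Sum>i<n. variation_sum M m (B i)) \<le> variation_sum M m (\<Union>i. B i)" .
    qed simp
    show "variation_sum M m (\<Union>i. B i) \<le> (\<Sum>i. variation_sum M m (B i))"
      unfolding variation_sum_def[of M m "\<Union>i. B i"]
    proof (rule SUP_least, clarify)
      fix A :: "nat \<Rightarrow> 'a set" assume A: "range A \<subseteq> sets M" "disjoint_family A" "(\<Union>i. A i) = (\<Union>i. B i)"
      have "ennreal (norm (m (A j))) \<le> (\<Sum>i. ennreal (norm (m (A j \<inter> B i))))" for j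
      proof -
        have "(\<lambda>i. m (A j \<inter> B i)) sums m (\<Union>i. A j \<inter> B i)"
        proof (rule sums)
          show "disjoint_family (\<lambda>i. A j \<inter> B i)"
            by (rule disjoint_family_on_bisimulation[OF B(2)]) blast
        qed (use A(1) B(1) in auto)
        also have "(\<Union>i. A j \<inter> B i) = A j" using A(3) by auto
        finally show ?thesis by (rule ennreal_norm_sums_le)
      qed
      then have "(\<Sum>j. ennreal (norm (m (A j)))) \<le> (\<Sum>j. \<Sum>i. ennreal (norm (m (A j \<inter> B i))))"
        by (intro suminf_le) auto
      also have "\<dots> = (\<Sum>i. \<Sum>j. ennreal (norm (m (A j \<inter> B i))))"
        by (rule suminf_swap_ennreal)
      also have "\<dots> \<le> (\<Sum>i. variation_sum M m (B i))"
      proof (intro suminf_le)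
        fix i
        have "(\<Union>j. A j \<inter> B i) = (\<Union>j. A j) \<inter> B i" by blast
        then have "(\<Union>j. A j \<inter> B i) = B i" unfolding A(3) by blast
        then show "(\<Sum>j. ennreal (norm (m (A j \<inter> B i)))) \<le> variation_sum M m (B i)"
        proof (intro variation_sum_ge)
          show "disjoint_family (\<lambda>j. A j \<inter> B i)"
            by (rule disjoint_family_on_bisimulation[OF A(2)]) blast
        qed (use A(1) B(1) in auto)
      qed auto
      finally show "(\<Sum>i. ennreal (norm (m (A i)))) \<le> (\<Sum>i. variation_sum M m (B i))" .
    qed
  qed
qed

text \<open>\<open>measure_of\<close> takes the prescribed values only for a countably additive set
  function, so this could not be read off the definition.\<close>

lemma emeasure_total_variation:
  assumes "B \<in> sets M"
  shows "emeasure (total_variation M m) B = variation_sum M m B"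
proof -
  have "total_variation M m = measure_of (space M) (sets M) (variation_sum M m)"
    by (simp add: total_variation_def variation_sum_def[abs_def])
  then show ?thesis
    using variation_sum_countably_additive variation_sum_empty assms
    by (intro emeasure_measure_of[of _ "space M" "sets M"])
       (auto simp: positive_def sets.space_closed sets.sigma_sets_eq)
qed

end

lemma sets_total_variation [simp, measurable_cong]: "sets (total_variation M m) = sets M"
  by (simp add: total_variation_def sets_measure_of[OF sets.space_closed] sets.sigma_sets_eq)

lemma space_total_variation [simp]: "space (total_variation M m) = space M"
  by (simp add: total_variation_def space_measure_of[OF sets.space_closed])

lemma sets_positive_part [simp, measurable_cong]: "sets (positive_part M m) = sets M"
  by (simp add: positive_part_def sets_measure_of[OF sets.space_closed] sets.sigma_sets_eq)

lemma sets_negative_part [simp, measurable_cong]: "sets (negative_part M m) = sets M"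
  by (simp add: negative_part_def sets_measure_of[OF sets.space_closed] sets.sigma_sets_eq)

lemma space_positive_part [simp]: "space (positive_part M m) = space M"
  by (simp add: positive_part_def space_measure_of[OF sets.space_closed])

lemma finite_vector_measure_sums:
  assumes "finite_vector_measure M m" "range A \<subseteq> sets M" "disjoint_family A"
  shows "(\<lambda>i. m (A i)) sums m (\<Union>i. A i)"
  using assms by (auto simp: finite_vector_measure_def)

text \<open>Total variation ignores the sign, so every fact on positive parts transfers to negative
  parts through \<open>- m\<close>.\<close>

lemma negative_part_eq: "negative_part M m = positive_part M (\<lambda>B. - m B)"
  by (simp add: negative_part_def positive_part_def total_variation_def)

lemma finite_measure_total_variation:
  "finite_vector_measure M m \<Longrightarrow> finite_measure (total_variation M m)"
  by (rule finite_measureI) (auto simp: finite_vector_measure_def)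

lemma finite_vector_measure_uminus:
  "finite_vector_measure M m \<Longrightarrow> finite_vector_measure M (\<lambda>B. - m B)"
  by (auto simp: finite_vector_measure_def total_variation_def intro: sums_minus)

text \<open>The bound of \<open>m\<close> by its variation makes the numerator nonnegative, so
  \<open>ennreal\<close> truncates nothing and additivity survives the coercion.\<close>

lemma emeasure_positive_part:
  assumes m: "finite_vector_measure M (m :: 'a set \<Rightarrow> real)" and B: "B \<in> sets M"
  shows "emeasure (positive_part M m) B = ennreal ((measure (total_variation M m) B + m B) / 2)"
    and "\<bar>m B\<bar> \<le> measure (total_variation M m) B"
proof -
  interpret T: finite_measure "total_variation M m" by (rule finite_measure_total_variation[OF m])
  note s = finite_vector_measure_sums[OF m]
  have abs: "\<bar>m B\<bar> \<le> measure (total_variation M m) B" if "B \<in> sets M" for B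
  proof -
    have "ennreal \<bar>m B\<bar> \<le> emeasure (total_variation M m) B"
      using norm_le_variation_sum[OF s that] emeasure_total_variation[OF s that] by simp
    then show ?thesis by (simp add: T.emeasure_eq_measure)
  qed
  then show "\<bar>m B\<bar> \<le> measure (total_variation M m) B" using B .
  let ?f = "\<lambda>B. ennreal ((measure (total_variation M m) B + m B) / 2)"
  have nn: "0 \<le> (measure (total_variation M m) B + m B) / 2" if "B \<in> sets M" for B
    using abs[OF that] by auto
  have "countably_additive (sets M) ?f"
    unfolding countably_additive_def
  proof (intro allI impI)
    fix A :: "nat \<Rightarrow> 'a set" assume A: "range A \<subseteq> sets M" "disjoint_family A" "(\<Union>i. A i) \<in> sets M"
    have "(\<lambda>i. (measure (total_variation M m) (A i) + m (A i)) / 2) sums ((measure (total_variation M m) (\<Union>i. A i) + m (\<Union>i. A i)) / 2)"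
      using A by (intro sums_divide sums_add s T.finite_measure_UNION) auto
    then show "(\<Sum>i. ?f (A i)) = ?f (\<Union>i. A i)"
      using A nn by (intro suminf_ennreal_eq) auto
  qed
  moreover have "?f {} = 0" using vector_measure_empty[OF s] by simp
  ultimately show "emeasure (positive_part M m) B = ?f B"
    using B by (intro emeasure_measure_of[OF positive_part_def])
      (auto simp: positive_def sets.space_closed sets.sigma_sets_eq)
qed

lemma finite_measure_positive_part:
  "finite_vector_measure M (m :: 'a set \<Rightarrow> real) \<Longrightarrow> finite_measure (positive_part M m)"
  by (rule finite_measureI) (simp add: emeasure_positive_part(1))

lemma finite_measure_negative_part:
  "finite_vector_measure M (m :: 'a set \<Rightarrow> real) \<Longrightarrow> finite_measure (negative_part M m)"
  unfolding negative_part_eq by (intro finite_measure_positive_part finite_vector_measure_uminus)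

lemma emeasure_positive_part_add_negative_part:
  assumes m: "finite_vector_measure M (m :: 'a set \<Rightarrow> real)" and B: "B \<in> sets M"
  shows "emeasure (positive_part M m) B + emeasure (negative_part M m) B = emeasure (total_variation M m) B"
proof -
  interpret T: finite_measure "total_variation M m" by (rule finite_measure_total_variation[OF m])
  have "total_variation M (\<lambda>B. - m B) = total_variation M m" by (simp add: total_variation_def)
  then show ?thesis
    using emeasure_positive_part[OF m B] emeasure_positive_part[OF finite_vector_measure_uminus[OF m] B]
    by (simp add: negative_part_eq T.emeasure_eq_measure abs_le_iff field_simps flip: ennreal_plus)
qed

lemma integrable_mono_measure:
  fixes f :: "'a \<Rightarrow> real"
  assumes "integrable N f" and sets: "sets M = sets N" and le: "\<And>B. B \<in> sets M \<Longrightarrow> emeasure M B \<le> emeasure N B"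
  shows "integrable M f"
proof -
  have "f \<in> borel_measurable M"
    using assms(1) borel_measurable_integrable measurable_cong_sets[OF sets refl] by blast
  moreover have "(\<integral>\<^sup>+x. norm (f x) \<partial>M) \<le> (\<integral>\<^sup>+x. norm (f x) \<partial>N)"
    using le sets by (intro nn_integral_mono_measure) (auto simp: le_measure)
  ultimately show ?thesis using assms(1) by (auto simp: integrable_iff_bounded)
qed

lemma integrable_positive_negative_part:
  fixes f :: "'a \<Rightarrow> real"
  assumes m: "finite_vector_measure M (m :: 'a set \<Rightarrow> real)" and f: "integrable (total_variation M m) f"
  shows "integrable (positive_part M m) f" "integrable (negative_part M m) f"
  by (rule integrable_mono_measure[OF f];
      simp flip: emeasure_positive_part_add_negative_part[OF m])+

text \<open>Cauchy-Schwarz on each piece of a partition. It lets the scalar Jordan decomposition be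
  applied to the components of a gradient, with masses bounded by the full variation.\<close>

lemma finite_vector_measure_inner:
  assumes m: "finite_vector_measure M (m :: 'a set \<Rightarrow> 'b::real_inner)" and b: "norm b \<le> 1"
  shows "finite_vector_measure M (\<lambda>B. m B \<bullet> b)"
    and "emeasure (total_variation M (\<lambda>B. m B \<bullet> b)) (space M) \<le> emeasure (total_variation M m) (space M)"
proof -
  have s: "(\<lambda>i. m (A i) \<bullet> b) sums (m (\<Union>i. A i) \<bullet> b)" if "range A \<subseteq> sets M" "disjoint_family A" for A :: "nat \<Rightarrow> 'a set"
    by (intro bounded_linear.sums[OF bounded_linear_inner_left] finite_vector_measure_sums[OF m] that)
  have "variation_sum M (\<lambda>B. m B \<bullet> b) (space M) \<le> variation_sum M m (space M)"
    unfolding variation_sum_def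
  proof (rule SUP_mono)
    fix A :: "nat \<Rightarrow> 'a set"
    have "\<bar>m (A i) \<bullet> b\<bar> \<le> norm (m (A i))" for i
      using Cauchy_Schwarz_ineq2[of "m (A i)" b] mult_left_mono[OF b, of "norm (m (A i))"] by simp
    then have "(\<Sum>i. ennreal (norm (m (A i) \<bullet> b))) \<le> (\<Sum>i. ennreal (norm (m (A i))))"
      by (intro suminf_le ennreal_leI) auto
    then show "A \<in> {A. range A \<subseteq> sets M \<and> disjoint_family A \<and> \<Union> (range A) = space M} \<Longrightarrow>
      \<exists>A'\<in>{A. range A \<subseteq> sets M \<and> disjoint_family A \<and> \<Union> (range A) = space M}.
       (\<Sum>i. ennreal (norm (m (A i) \<bullet> b))) \<le> (\<Sum>i. ennreal (norm (m (A' i))))"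
      by blast
  qed
  then show "emeasure (total_variation M (\<lambda>B. m B \<bullet> b)) (space M) \<le> emeasure (total_variation M m) (space M)"
    by (simp add: emeasure_total_variation[OF s] emeasure_total_variation[OF finite_vector_measure_sums[OF m]])
  then show "finite_vector_measure M (\<lambda>B. m B \<bullet> b)"
    using m s by (auto simp: finite_vector_measure_def)
qed

subsection \<open>A smooth bump function\<close>

lemma power_div_fact_le_exp:
  fixes x :: real
  assumes "0 \<le> x"
  shows "x ^ k / fact k \<le> exp x"
proof -
  have s: "(\<lambda>n. x ^ n /\<^sub>R fact n) sums exp x" by (rule exp_converges)
  have "(\<Sum>n\<in>{k}. x ^ n /\<^sub>R fact n) \<le> (\<Sum>n. x ^ n /\<^sub>R fact n)"
    using assms by (intro sum_le_suminf sums_summable[OF s]) auto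
  then show ?thesis using sums_unique[OF s] by (simp add: field_simps)
qed

text \<open>The classical flat function exp(-1/t) divided by a power of \<open>t\<close>; the powers
  are carried along because differentiation produces them.\<close>

definition exp_inv :: "nat \<Rightarrow> real \<Rightarrow> real" where
  "exp_inv n t = (if t > 0 then exp (- 1 / t) / t ^ n else 0)"

lemma exp_inv_nonneg: "0 \<le> exp_inv n t"
  by (simp add: exp_inv_def)

text \<open>A single term of the series of exp(1/t), the one of order \<open>n + k\<close>. The case
  \<open>k = 2\<close> gives differentiability at 0, and \<open>k = 0\<close> the numerical bounds 1
  for \<open>exp_inv 0\<close> and 2 for \<open>exp_inv 2\<close>.\<close>

lemma exp_inv_le: "exp_inv n t \<le> fact (n + k) * \<bar>t\<bar> ^ k"
proof (cases "t > 0")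
  case True
  have "(1 / t) ^ (n + k) / fact (n + k) \<le> exp (1 / t)"
    using True by (intro power_div_fact_le_exp) auto
  then have "1 \<le> exp (1 / t) * (fact (n + k) * t ^ (n + k))"
    using True by (simp add: field_simps power_divide)
  then show ?thesis
    using True by (simp add: exp_inv_def field_simps power_add exp_minus)
qed (simp add: exp_inv_def)

text \<open>Away from 0 this is calculus; at 0 the quadratic bound on \<open>exp_inv n\<close> makes
  the difference quotient tend to 0, which agrees with the formula since every
  \<open>exp_inv\<close> vanishes there.\<close>

lemma exp_inv_has_derivative:
  "(exp_inv n has_real_derivative (exp_inv (n + 2) t - real n * exp_inv (n + 1) t)) (at t)"
proof (cases t "0 :: real" rule: linorder_cases)
  case less
  have "((\<lambda>t. 0) has_real_derivative 0) (at t)" by simp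
  then have "(exp_inv n has_real_derivative 0) (at t)"
    using less by (rule_tac has_field_derivative_transform_within_open[of _ _ _ "{..<0}"]) (auto simp: exp_inv_def)
  then show ?thesis using less by (simp add: exp_inv_def)
next
  case greater
  have "((\<lambda>t. exp (- 1 / t) / t ^ n) has_real_derivative (exp_inv (n + 2) t - real n * exp_inv (n + 1) t)) (at t)"
    using greater
    by (auto intro!: derivative_eq_intros simp: exp_inv_def field_simps power2_eq_square power_add)
       (cases n; simp add: field_simps)
  then show ?thesis
    using greater by (rule_tac has_field_derivative_transform_within_open[of _ _ _ "{0<..}"]) (auto simp: exp_inv_def)
next
  case equal
  have "((\<lambda>y. (exp_inv n y - exp_inv n 0) / (y - 0)) \<longlongrightarrow> 0) (at 0)"
  proof (rule Lim_null_comparison)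
    show "\<forall>\<^sub>F y in at 0. norm ((exp_inv n y - exp_inv n 0) / (y - 0)) \<le> fact (n + 2) * \<bar>y\<bar>"
    proof (rule eventually_at_filter[THEN iffD2], intro always_eventually allI impI)
      fix y :: real assume "y \<noteq> 0"
      then show "norm ((exp_inv n y - exp_inv n 0) / (y - 0)) \<le> fact (n + 2) * \<bar>y\<bar>"
        using exp_inv_le[of n y 2] exp_inv_nonneg[of n y]
        by (simp add: exp_inv_def[of n 0] divide_le_eq power2_eq_square mult.assoc)
    qed
    show "((\<lambda>y::real. fact (n + 2) * \<bar>y\<bar>) \<longlongrightarrow> 0) (at 0)"
      by (auto intro!: tendsto_eq_intros)
  qed
  then show ?thesis using equal
    by (simp add: has_field_derivative_iff exp_inv_def[of _ 0])
qed

lemma continuous_on_exp_inv: "continuous_on S (exp_inv n)"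
  by (auto intro!: continuous_at_imp_continuous_on DERIV_isCont[OF exp_inv_has_derivative])

lemma borel_measurable_exp_inv [measurable]: "exp_inv n \<in> borel_measurable borel"
  by (intro borel_measurable_continuous_onI continuous_on_exp_inv)

text \<open>Closed under differentiation, hence made of smooth functions.\<close>

inductive bump_algebra :: "real \<Rightarrow> ('a::euclidean_space \<Rightarrow> real) \<Rightarrow> bool" for r where
  const: "bump_algebra r (\<lambda>x. c)"
| inner: "bump_algebra r (\<lambda>x. x \<bullet> v)"
| exp_inv: "bump_algebra r (\<lambda>x. exp_inv n (1 - (a - x) \<bullet> (a - x) / r\<^sup>2))"
| add: "bump_algebra r f \<Longrightarrow> bump_algebra r g \<Longrightarrow> bump_algebra r (\<lambda>x. f x + g x)"
| mult: "bump_algebra r f \<Longrightarrow> bump_algebra r g \<Longrightarrow> bump_algebra r (\<lambda>x. f x * g x)"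

lemma exp_inv_radial_has_derivative:
  "((\<lambda>x. exp_inv n (1 - (a - x) \<bullet> (a - x) / r\<^sup>2)) has_derivative
    (\<lambda>v. (exp_inv (n + 2) (1 - (a - x) \<bullet> (a - x) / r\<^sup>2)
       - real n * exp_inv (n + 1) (1 - (a - x) \<bullet> (a - x) / r\<^sup>2)) * (2 * ((a - x) \<bullet> v) / r\<^sup>2))) (at x)"
proof -
  have "((\<lambda>x. 1 - (a - x) \<bullet> (a - x) / r\<^sup>2) has_derivative (\<lambda>v. 2 * ((a - x) \<bullet> v) / r\<^sup>2)) (at x)"
    unfolding divide_inverse by (auto intro!: derivative_eq_intros simp: inner_commute)
  from has_derivative_compose[OF this exp_inv_has_derivative[THEN has_field_derivative_imp_has_derivative]]
  show ?thesis by simp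
qed

lemma bump_algebra_has_derivative:
  assumes "bump_algebra r (f :: 'a::euclidean_space \<Rightarrow> real)"
  shows "\<exists>f'. (\<forall>x. (f has_derivative (\<lambda>v. f' v x)) (at x)) \<and> (\<forall>v. bump_algebra r (f' v))"
  using assms
proof induction
  case (const c)
  show ?case by (rule exI[of _ "\<lambda>v x. 0"]) (auto intro: bump_algebra.intros)
next
  case (inner v)
  show ?case
    by (rule exI[of _ "\<lambda>w x. w \<bullet> v"])
      (auto intro!: bump_algebra.intros bounded_linear.has_derivative[OF bounded_linear_inner_left] has_derivative_ident)
next
  case (exp_inv n a)
  have "bump_algebra r (\<lambda>x. (exp_inv (n + 2) (1 - (a - x) \<bullet> (a - x) / r\<^sup>2)
       + (- real n) * exp_inv (n + 1) (1 - (a - x) \<bullet> (a - x) / r\<^sup>2)) * ((2 / r\<^sup>2) * (a \<bullet> v + (-1) * (x \<bullet> v))))" for v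
    by (intro bump_algebra.intros)
  then have "bump_algebra r (\<lambda>x. (exp_inv (n + 2) (1 - (a - x) \<bullet> (a - x) / r\<^sup>2)
       - real n * exp_inv (n + 1) (1 - (a - x) \<bullet> (a - x) / r\<^sup>2)) * (2 * ((a - x) \<bullet> v) / r\<^sup>2))" for v
    by (simp add: inner_diff_left)
  then show ?case
    using exp_inv_radial_has_derivative
    by (intro exI[of _ "\<lambda>v x. (exp_inv (n + 2) (1 - (a - x) \<bullet> (a - x) / r\<^sup>2)
       - real n * exp_inv (n + 1) (1 - (a - x) \<bullet> (a - x) / r\<^sup>2)) * (2 * ((a - x) \<bullet> v) / r\<^sup>2)"]) blast
next
  case (add f g)
  then obtain f' g' where
    "\<And>x. (f has_derivative (\<lambda>v. f' v x)) (at x)" "\<And>v. bump_algebra r (f' v)"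
    "\<And>x. (g has_derivative (\<lambda>v. g' v x)) (at x)" "\<And>v. bump_algebra r (g' v)" by blast
  then show ?case
    by (intro exI[of _ "\<lambda>v x. f' v x + g' v x"]) (auto intro!: bump_algebra.intros derivative_intros)
next
  case (mult f g)
  then obtain f' g' where
    "\<And>x. (f has_derivative (\<lambda>v. f' v x)) (at x)" "\<And>v. bump_algebra r (f' v)"
    "\<And>x. (g has_derivative (\<lambda>v. g' v x)) (at x)" "\<And>v. bump_algebra r (g' v)" by blast
  then show ?case using mult.hyps
    by (intro exI[of _ "\<lambda>v x. f x * g' v x + f' v x * g x"]) (auto intro!: bump_algebra.intros derivative_intros)
qed

lemma times_cont_diff_bump_algebra:
  "bump_algebra r (f :: 'a::euclidean_space \<Rightarrow> real) \<Longrightarrow> times_cont_diff k f"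
proof (induction k arbitrary: f)
  case 0
  then obtain f' where "\<And>x. (f has_derivative (\<lambda>v. f' v x)) (at x)"
    using bump_algebra_has_derivative by blast
  then show ?case
    by (auto intro!: continuous_at_imp_continuous_on has_derivative_continuous)
next
  case (Suc k)
  then obtain f' where f': "\<And>x. (f has_derivative (\<lambda>v. f' v x)) (at x)" "\<And>v. bump_algebra r (f' v)"
    using bump_algebra_has_derivative by blast
  have "frechet_derivative f (at x) = (\<lambda>v. f' v x)" for x
    using frechet_derivative_at[OF f'(1)[of x]] by simp
  then show ?case using f' Suc.IH by (auto simp: differentiable_def)
qed

definition bump :: "real \<Rightarrow> 'a::euclidean_space \<Rightarrow> real" where
  "bump r z = exp_inv 0 (1 - z \<bullet> z / r\<^sup>2)"

text \<open>The derivative of \<open>bump r\<close> at \<open>z\<close> in direction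
  \<open>v\<close>. Only \<open>exp_inv 2\<close> occurs because the other term of the derivative of
  \<open>exp_inv n\<close> carries the factor \<open>n = 0\<close>.\<close>

definition bump_deriv :: "real \<Rightarrow> 'a::euclidean_space \<Rightarrow> 'a \<Rightarrow> real" where
  "bump_deriv r v z = - exp_inv 2 (1 - z \<bullet> z / r\<^sup>2) * (2 * (z \<bullet> v) / r\<^sup>2)"

lemma bump_nonneg: "0 \<le> bump r z"
  by (simp add: bump_def exp_inv_nonneg)

lemma bump_le_one: "bump r z \<le> 1"
  using exp_inv_le[of 0 "1 - z \<bullet> z / r\<^sup>2" 0] by (simp add: bump_def)

lemma inner_ge_power2:
  assumes "r > 0" "r \<le> norm (z :: 'a::euclidean_space)" shows "z \<bullet> z \<ge> r\<^sup>2"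
  using assms by (simp add: dot_square_norm)

lemma bump_eq_0: "0 < r \<Longrightarrow> r \<le> norm z \<Longrightarrow> bump r z = 0"
  using inner_ge_power2[of r z] by (simp add: bump_def exp_inv_def)

lemma bump_pos:
  assumes "norm z < r" shows "0 < bump r z"
proof -
  have "z \<bullet> z < r\<^sup>2" using assms by (simp add: dot_square_norm power_strict_mono)
  moreover have "0 < r" using assms norm_ge_zero[of z] by linarith
  ultimately show ?thesis by (simp add: bump_def exp_inv_def)
qed

lemma bump_minus: "bump r (- z) = bump r z"
  by (simp add: bump_def)

lemma bump_deriv_eq_0: "0 < r \<Longrightarrow> r \<le> norm z \<Longrightarrow> bump_deriv r v z = 0"
  using inner_ge_power2[of r z] by (simp add: bump_deriv_def exp_inv_def)

text \<open>The 4 is the bound 2 for \<open>exp_inv 2\<close> times the 2 from differentiating the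
  squared norm. The factor 1/r is the whole cost of moving a derivative onto the bump.\<close>

lemma abs_bump_deriv_le:
  assumes "0 < r" "norm v \<le> 1"
  shows "\<bar>bump_deriv r v z\<bar> \<le> 4 / r * indicator (ball 0 r) z"
proof (cases "norm z < r")
  case True
  have e: "exp_inv 2 (1 - z \<bullet> z / r\<^sup>2) \<le> 2"
    using exp_inv_le[of 2 "1 - z \<bullet> z / r\<^sup>2" 0] by simp
  have "\<bar>z \<bullet> v\<bar> \<le> norm z * norm v" by (rule Cauchy_Schwarz_ineq2)
  also have "\<dots> \<le> r * 1" using True assms by (intro mult_mono) auto
  finally have "exp_inv 2 (1 - z \<bullet> z / r\<^sup>2) * (2 * \<bar>z \<bullet> v\<bar> / r\<^sup>2) \<le> 2 * (2 * r / r\<^sup>2)"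
    using e assms by (intro mult_mono divide_right_mono) (auto simp: exp_inv_nonneg)
  then show ?thesis
    using True assms by (simp add: bump_deriv_def abs_mult exp_inv_nonneg power2_eq_square)
next
  case False
  then show ?thesis using assms bump_deriv_eq_0[of r z v] by simp
qed

lemma bump_has_derivative: "(bump r has_derivative (\<lambda>v. bump_deriv r v z)) (at z)"
  using exp_inv_radial_has_derivative[of 0 0 r z]
  by (simp add: bump_def[abs_def] bump_deriv_def numeral_2_eq_2)

lemma bump_diff_has_derivative:
  "((\<lambda>y. bump r (x - y)) has_derivative (\<lambda>v. - bump_deriv r v (x - y))) (at y)"
proof -
  have "((\<lambda>y. x - y) has_derivative (\<lambda>v. - v)) (at y)"
    by (auto intro!: derivative_eq_intros)
  from has_derivative_compose[OF this bump_has_derivative] show ?thesis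
    by (simp add: bump_deriv_def)
qed

lemma bump_line_has_derivative:
  "((\<lambda>t. bump r (z + t *\<^sub>R v)) has_real_derivative bump_deriv r v (z + t *\<^sub>R v)) (at t)"
proof -
  have "((\<lambda>t. z + t *\<^sub>R v) has_derivative (\<lambda>s. s *\<^sub>R v)) (at t)"
    by (auto intro!: derivative_eq_intros)
  from has_derivative_compose[OF this bump_has_derivative[of r]] show ?thesis
    unfolding has_field_derivative_def
    by (rule has_derivative_eq_rhs) (simp add: bump_deriv_def fun_eq_iff)
qed

text \<open>Makes the definition of the distributional gradient applicable to translated bumps, the
  only test functions that the estimate uses.\<close>

lemma test_function_bump:
  assumes "r > 0"
  shows "test_function UNIV (\<lambda>y. bump r (x - y :: 'a::euclidean_space))"
proof -
  have "bump_algebra r (\<lambda>y. bump r (x - y))"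
    unfolding bump_def by (rule bump_algebra.exp_inv)
  moreover have "{y. bump r (x - y) \<noteq> 0} \<subseteq> cball x r"
    using bump_eq_0[OF assms] by (force simp: dist_norm)
  then have "bounded {y. bump r (x - y) \<noteq> 0}" by (rule bounded_subset[OF bounded_cball])
  ultimately show ?thesis
    by (auto simp: test_function_def times_cont_diff_bump_algebra compact_closure)
qed

text \<open>Reduces an arbitrary direction to the coordinate directions, in which the gradient
  measure is defined.\<close>

lemma bump_deriv_sum_Basis: "bump_deriv r v z = (\<Sum>b\<in>Basis. (v \<bullet> b) * bump_deriv r b z)"
proof -
  have "z \<bullet> v = (\<Sum>b\<in>Basis. (v \<bullet> b) * (z \<bullet> b))"
    by (subst euclidean_inner) (simp add: mult.commute)
  then show ?thesis
    by (simp add: bump_deriv_def sum_distrib_left sum_divide_distrib algebra_simps flip: sum_negf)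
qed

lemma borel_measurable_bump [measurable (raw)]:
  assumes [measurable]: "f \<in> borel_measurable M" "g \<in> borel_measurable M"
  shows "(\<lambda>x. bump (f x) (g x)) \<in> borel_measurable M"
  unfolding bump_def by measurable

lemma borel_measurable_bump_deriv [measurable (raw)]:
  assumes [measurable]: "f \<in> borel_measurable M" "g \<in> borel_measurable M"
  shows "(\<lambda>x. bump_deriv (f x) v (g x)) \<in> borel_measurable M"
  unfolding bump_deriv_def by measurable

lemma isCont_bump_deriv: "isCont (bump_deriv r v) z"
proof -
  have "isCont (exp_inv 2) t" for t by (rule DERIV_isCont[OF exp_inv_has_derivative])
  then have "isCont (\<lambda>z. exp_inv 2 (1 - z \<bullet> z / r\<^sup>2)) z"
    by (intro isCont_o2[of z _ "exp_inv 2"]) (auto simp: divide_inverse intro!: continuous_intros)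
  then show ?thesis
    unfolding bump_deriv_def[abs_def] divide_inverse by (intro continuous_intros)
qed

subsection \<open>Dyadic cubes and the boxing inequality\<close>

lemma nn_integral_lborel_translate:
  fixes c :: "'a::euclidean_space"
  assumes [measurable]: "f \<in> borel_measurable borel"
  shows "(\<integral>\<^sup>+x. f (c + x) \<partial>lborel) = (\<integral>\<^sup>+x. f x \<partial>lborel)"
proof -
  have "(\<integral>\<^sup>+x. f x \<partial>lborel) = (\<integral>\<^sup>+x. f x \<partial>distr lborel borel ((+) c))"
    by (simp only: lborel_distr_plus)
  also have "\<dots> = (\<integral>\<^sup>+x. f (c + x) \<partial>lborel)" by (rule nn_integral_distr) auto
  finally show ?thesis by simp
qed

lemma nn_integral_lborel_scale:
  fixes f :: "'a::euclidean_space \<Rightarrow> ennreal"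
  assumes [measurable]: "f \<in> borel_measurable borel" and "c \<noteq> 0"
  shows "(\<integral>\<^sup>+x. f x \<partial>lborel) = ennreal (\<bar>c\<bar> ^ DIM('a)) * (\<integral>\<^sup>+x. f (c *\<^sub>R x) \<partial>lborel)"
  by (subst lborel_affine[OF assms(2), of 0])
     (simp add: nn_integral_density nn_integral_distr nn_integral_cmult ennreal_power)

lemma pred_mem_cball [measurable (raw)]:
  fixes f g :: "'a \<Rightarrow> 'b::{second_countable_topology, metric_space}"
  assumes [measurable]: "f \<in> borel_measurable M" "g \<in> borel_measurable M"
  shows "Measurable.pred M (\<lambda>x. g x \<in> cball (f x) r)"
  unfolding mem_cball by measurable

section \<open>Separated pairs as a discrete perimeter\<close>

definition separates :: "'a set \<Rightarrow> 'a \<Rightarrow> 'a \<Rightarrow> ennreal" where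
  "separates S y z = (if (y \<in> S) \<noteq> (z \<in> S) then 1 else 0)"

lemma borel_measurable_separates [measurable (raw)]:
  assumes [measurable]: "S \<in> sets borel" "f \<in> borel_measurable M" "g \<in> borel_measurable M"
  shows "(\<lambda>x. separates S (f x) (g x :: 'a::euclidean_space)) \<in> borel_measurable M"
  unfolding separates_def by measurable

text \<open>A segment from \<open>y\<close> to \<open>y + n v\<close> that leaves \<open>S\<close> does so in one of its \<open>n\<close> steps.\<close>

lemma separates_chain:
  fixes v :: "'a::euclidean_space"
  shows "separates S y (y + real n *\<^sub>R v)
    \<le> (\<Sum>j<n. separates S (real j *\<^sub>R v + y) (real j *\<^sub>R v + y + v))"
proof (induction n)
  case 0 then show ?case by (simp add: separates_def)
next
  case (Suc n)
  have "separates S y (y + real (Suc n) *\<^sub>R v) \<le> separates S y (y + real n *\<^sub>R v)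
      + separates S (real n *\<^sub>R v + y) (real n *\<^sub>R v + y + v)"
    by (auto simp: separates_def algebra_simps)
  also have "\<dots> \<le> (\<Sum>j<Suc n. separates S (real j *\<^sub>R v + y) (real j *\<^sub>R v + y + v))"
    using Suc by (simp add: add_right_mono)
  finally show ?case .
qed

text \<open>The left side counts the pairs in \<open>Q\<close> separated by \<open>S\<close>, one
  point inside and one outside. Each pair is joined by a segment of \<open>n\<close> equal steps,
  which stays in \<open>Q\<close> by convexity and crosses \<open>S\<close> in some step, of length
  at most \<open>D\<close>. The constant is \<open>n\<close> to the power d for rescaling the
  difference vector, times \<open>n\<close> for the choice of the step.\<close>

lemma relative_isoperimetric:
  fixes Q S :: "'a::euclidean_space set"
  assumes [measurable]: "Q \<in> sets borel" "S \<in> sets borel" and Q: "convex Q"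
    and D: "\<And>y z. y \<in> Q \<Longrightarrow> z \<in> Q \<Longrightarrow> norm (z - y) \<le> real n * D" and n: "n \<ge> 1"
  shows "emeasure lborel (S \<inter> Q) * emeasure lborel (Q - S)
    \<le> ennreal (real n ^ (DIM('a) + 1)) *
      (\<integral>\<^sup>+y. indicator Q y * (\<integral>\<^sup>+z. indicator (cball y D) z * separates S y z \<partial>lborel) \<partial>lborel)"
proof -
  define q where "q y z = indicator Q y * indicator Q z * separates S y z" for y z
  have "emeasure lborel (S \<inter> Q) * emeasure lborel (Q - S)
      = (\<integral>\<^sup>+y. indicator (S \<inter> Q) y * (\<integral>\<^sup>+z. indicator (Q - S) z \<partial>lborel) \<partial>lborel)"
    by (simp add: nn_integral_multc)
  also have "\<dots> = (\<integral>\<^sup>+y. (\<integral>\<^sup>+z. indicator (S \<inter> Q) y * indicator (Q - S) z \<partial>lborel) \<partial>lborel)"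
    by (simp add: nn_integral_cmult)
  also have "\<dots> \<le> (\<integral>\<^sup>+y. \<integral>\<^sup>+z. q y z \<partial>lborel \<partial>lborel)"
    by (intro nn_integral_mono) (auto simp: q_def separates_def split: split_indicator)
  also have "\<dots> = (\<integral>\<^sup>+y. \<integral>\<^sup>+v. q y (y + v) \<partial>lborel \<partial>lborel)"
    by (intro nn_integral_cong nn_integral_lborel_translate[symmetric]) (unfold q_def, measurable)
  also have "\<dots> = (\<integral>\<^sup>+v. \<integral>\<^sup>+y. q y (y + v) \<partial>lborel \<partial>lborel)"
    by (rule lborel_pair.Fubini') (unfold q_def, measurable)
  \<comment> \<open>The new \<open>v\<close> is one step of the segment, and the old difference
    vector is \<open>n\<close> times it.\<close>
  also have "\<dots> = ennreal (real n ^ DIM('a)) * (\<integral>\<^sup>+v. \<integral>\<^sup>+y. q y (y + real n *\<^sub>R v) \<partial>lborel \<partial>lborel)"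
    using n by (subst nn_integral_lborel_scale[of _ "real n"]) (auto simp: q_def)
  also have "(\<integral>\<^sup>+v. \<integral>\<^sup>+y. q y (y + real n *\<^sub>R v) \<partial>lborel \<partial>lborel)
    \<le> (\<integral>\<^sup>+v. ennreal (real n) * (\<integral>\<^sup>+y. indicator (cball 0 D) v * q y (y + v) \<partial>lborel) \<partial>lborel)"
  proof (rule nn_integral_mono)
    fix v :: 'a
    have "q y (y + real n *\<^sub>R v) \<le> (\<Sum>j<n. indicator (cball 0 D) v * q (real j *\<^sub>R v + y) (real j *\<^sub>R v + y + v))" for y
    proof (cases "y \<in> Q \<and> y + real n *\<^sub>R v \<in> Q")
      case True
      have "real j *\<^sub>R v + y \<in> Q" if "j \<le> n" for j
      proof -
        have "(1 - real j / real n) *\<^sub>R y + (real j / real n) *\<^sub>R (y + real n *\<^sub>R v) \<in> Q"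
          using True that n by (intro convexD[OF Q]) auto
        moreover have "(1 - real j / real n) *\<^sub>R y + (real j / real n) *\<^sub>R (y + real n *\<^sub>R v) = real j *\<^sub>R v + y"
          using n by (simp add: algebra_simps)
        ultimately show ?thesis by simp
      qed
      from this this[of "Suc _"] have "q (real j *\<^sub>R v + y) (real j *\<^sub>R v + y + v)
        = separates S (real j *\<^sub>R v + y) (real j *\<^sub>R v + y + v)" if "j < n" for j
        using that by (simp add: q_def algebra_simps)
      moreover have "norm v \<le> D"
        using D[of y "y + real n *\<^sub>R v"] True n by simp
      ultimately show ?thesis
        using separates_chain[of S y n v] True by (simp add: q_def)
    qed (auto simp: q_def)
    then have "(\<integral>\<^sup>+y. q y (y + real n *\<^sub>R v) \<partial>lborel)
      \<le> (\<integral>\<^sup>+y. (\<Sum>j<n. indicator (cball 0 D) v * q (real j *\<^sub>R v + y) (real j *\<^sub>R v + y + v)) \<partial>lborel)"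
      by (intro nn_integral_mono)
    also have "\<dots> = (\<Sum>j<n. \<integral>\<^sup>+y. indicator (cball 0 D) v * q (real j *\<^sub>R v + y) (real j *\<^sub>R v + y + v) \<partial>lborel)"
      by (intro nn_integral_sum) (unfold q_def, measurable)
    \<comment> \<open>The j-th step starts at a translate of \<open>y\<close>, so by translation
      invariance all \<open>n\<close> summands are equal.\<close>
    also have "\<dots> = (\<Sum>j<n. \<integral>\<^sup>+y. indicator (cball 0 D) v * q y (y + v) \<partial>lborel)"
      by (intro sum.cong refl nn_integral_lborel_translate[where f = "\<lambda>y. indicator (cball 0 D) v * q y (y + v)"]) (unfold q_def, measurable)
    also have "\<dots> = ennreal (real n) * (\<integral>\<^sup>+y. indicator (cball 0 D) v * q y (y + v) \<partial>lborel)"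
      by (simp add: ennreal_of_nat_eq_real_of_nat)
    finally show "(\<integral>\<^sup>+y. q y (y + real n *\<^sub>R v) \<partial>lborel) \<le> ennreal (real n) * (\<integral>\<^sup>+y. indicator (cball 0 D) v * q y (y + v) \<partial>lborel)" .
  qed
  also have "(\<integral>\<^sup>+v. ennreal (real n) * (\<integral>\<^sup>+y. indicator (cball 0 D) v * q y (y + v) \<partial>lborel) \<partial>lborel)
      = ennreal (real n) * (\<integral>\<^sup>+v. \<integral>\<^sup>+y. indicator (cball 0 D) v * q y (y + v) \<partial>lborel \<partial>lborel)"
    by (intro nn_integral_cmult) (unfold q_def, measurable)
  also have "(\<integral>\<^sup>+v. \<integral>\<^sup>+y. indicator (cball 0 D) v * q y (y + v) \<partial>lborel \<partial>lborel)
      = (\<integral>\<^sup>+y. \<integral>\<^sup>+v. indicator (cball 0 D) v * q y (y + v) \<partial>lborel \<partial>lborel)"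
    by (rule lborel_pair.Fubini') (unfold q_def, measurable)
  also have "\<dots> = (\<integral>\<^sup>+y. \<integral>\<^sup>+z. indicator (cball 0 D) (z - y) * q y z \<partial>lborel \<partial>lborel)"
  proof (rule nn_integral_cong)
    fix y :: 'a
    show "(\<integral>\<^sup>+v. indicator (cball 0 D) v * q y (y + v) \<partial>lborel) = (\<integral>\<^sup>+z. indicator (cball 0 D) (z - y) * q y z \<partial>lborel)"
      by (subst nn_integral_lborel_translate[of _ y, symmetric]) (auto simp: q_def)
  qed
  also have "\<dots> \<le> (\<integral>\<^sup>+y. \<integral>\<^sup>+z. indicator Q y * (indicator (cball y D) z * separates S y z) \<partial>lborel \<partial>lborel)"
    by (intro nn_integral_mono) (auto simp: q_def dist_norm norm_minus_commute split: split_indicator)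
  also have "\<dots> = (\<integral>\<^sup>+y. indicator Q y * (\<integral>\<^sup>+z. indicator (cball y D) z * separates S y z \<partial>lborel) \<partial>lborel)"
    by (intro nn_integral_cong nn_integral_cmult) measurable
  finally show ?thesis
    by (auto simp: mult_left_mono mult.assoc[symmetric] mult_right_mono ennreal_mult[symmetric] mult.commute)
qed

section \<open>Dyadic cubes of side 2^k h\<close>

definition dyadic_cube :: "real \<Rightarrow> nat \<Rightarrow> 'a::euclidean_space \<Rightarrow> 'a set" where
  "dyadic_cube h k x = {y. \<forall>b\<in>Basis. \<lfloor>(y \<bullet> b) / (2 ^ k * h)\<rfloor> = \<lfloor>(x \<bullet> b) / (2 ^ k * h)\<rfloor>}"

lemma dyadic_cube_self [simp]: "x \<in> dyadic_cube h k x"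
  by (simp add: dyadic_cube_def)

lemma dyadic_cube_eq: "y \<in> dyadic_cube h k x \<Longrightarrow> dyadic_cube h k y = dyadic_cube h k x"
  by (auto simp: dyadic_cube_def)

text \<open>The floor of t/2 depends only on the floor of t. Cubes are half-open through these
  floors, so those of one level partition the space, and each is named by any of its points.\<close>

lemma dyadic_cube_Suc:
  "dyadic_cube h k x \<subseteq> dyadic_cube h (Suc k) x"
proof -
  have "\<lfloor>t / (2 ^ Suc k * h)\<rfloor> = \<lfloor>t / (2 ^ k * h)\<rfloor> div 2" for t
    using floor_divide_real_eq_div[of 2 "t / (2 ^ k * h)"] by (simp add: mult.commute mult.left_commute)
  then show ?thesis by (auto simp: dyadic_cube_def)
qed

lemma dyadic_cube_mono: "j \<le> k \<Longrightarrow> dyadic_cube h j x \<subseteq> dyadic_cube h k x"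
  by (rule lift_Suc_mono_le[of "\<lambda>k. dyadic_cube h k x"]) (rule dyadic_cube_Suc)

lemma dyadic_cube_measurable [measurable]: "dyadic_cube h k x \<in> sets borel"
  unfolding dyadic_cube_def by measurable

lemma dyadic_cube_alt:
  fixes h :: real
  assumes "h > 0"
  shows "dyadic_cube h k x = {y. \<forall>b\<in>Basis. of_int \<lfloor>(x \<bullet> b) / (2 ^ k * h)\<rfloor> * (2 ^ k * h) \<le> y \<bullet> b \<and>
     y \<bullet> b < of_int \<lfloor>(x \<bullet> b) / (2 ^ k * h)\<rfloor> * (2 ^ k * h) + 2 ^ k * h}"
proof -
  define s where "s = 2 ^ k * h"
  have "s > 0" using assms by (simp add: s_def)
  then have "\<lfloor>t / s\<rfloor> = n \<longleftrightarrow> of_int n * s \<le> t \<and> t < of_int n * s + s" for t n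
    by (simp add: floor_eq_iff pos_le_divide_eq pos_divide_less_eq distrib_right)
  then show ?thesis by (simp add: dyadic_cube_def flip: s_def)
qed

lemma convex_dyadic_cube:
  fixes h :: real
  assumes "h > 0" shows "convex (dyadic_cube h k x)"
proof -
  have "dyadic_cube h k x = (\<Inter>b\<in>Basis. {y. b \<bullet> y \<ge> of_int \<lfloor>(x \<bullet> b) / (2 ^ k * h)\<rfloor> * (2 ^ k * h)}
     \<inter> {y. b \<bullet> y < of_int \<lfloor>(x \<bullet> b) / (2 ^ k * h)\<rfloor> * (2 ^ k * h) + 2 ^ k * h})"
    unfolding dyadic_cube_alt[OF assms] by (auto simp: inner_commute)
  also have "convex \<dots>"
    by (intro convex_INT convex_Int convex_halfspace_ge convex_halfspace_lt)
  finally show ?thesis .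
qed

lemma norm_diff_dyadic_cube_le:
  fixes h :: real
  assumes "h > 0" "y \<in> dyadic_cube h k x" "z \<in> dyadic_cube h k x"
  shows "norm (z - y :: 'a::euclidean_space) \<le> 2 ^ k * (DIM('a) * h)"
proof -
  have "norm (z - y) \<le> (\<Sum>b\<in>Basis. \<bar>(z - y) \<bullet> b\<bar>)" by (rule norm_le_l1)
  also have "\<dots> \<le> (\<Sum>b\<in>(Basis :: 'a set). (2 ^ k * h :: real))"
  proof (rule sum_mono)
    fix b :: 'a assume "b \<in> Basis"
    then show "\<bar>(z - y) \<bullet> b\<bar> \<le> 2 ^ k * h"
      using assms(2,3) unfolding dyadic_cube_alt[OF assms(1)] by (force simp: inner_diff_left)
  qed
  finally show ?thesis by (simp add: algebra_simps)
qed

lemma emeasure_dyadic_cube: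
  fixes h :: real
  assumes "h > 0"
  shows "emeasure lborel (dyadic_cube h k x :: 'a::euclidean_space set) = ennreal ((2 ^ k * h) ^ DIM('a))"
proof -
  define s where "s = 2 ^ k * h"
  define a where "a = (\<Sum>b\<in>Basis. (of_int \<lfloor>(x \<bullet> b) / s\<rfloor> * s) *\<^sub>R b)"
  define c where "c = a + s *\<^sub>R One"
  have s: "s > 0" using assms by (simp add: s_def)
  have ab: "a \<bullet> b = of_int \<lfloor>(x \<bullet> b) / s\<rfloor> * s" "c \<bullet> b = a \<bullet> b + s" if "b \<in> Basis" for b
    using that by (simp_all add: a_def c_def inner_add_left)
  have sub: "box a c \<subseteq> dyadic_cube h k x" "dyadic_cube h k x \<subseteq> cbox a c"
    unfolding dyadic_cube_alt[OF assms] s_def[symmetric]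
    by (auto simp: box_def cbox_def ab)
  have "emeasure lborel (box a c) = ennreal (s ^ DIM('a))" "emeasure lborel (cbox a c) = ennreal (s ^ DIM('a))"
    using s ab(2) by (simp_all add: emeasure_lborel_box_eq emeasure_lborel_cbox_eq inner_diff_left)
  then show ?thesis
    using emeasure_mono[OF sub(1), of lborel] emeasure_mono[OF sub(2), of lborel]
    by (simp add: s_def[symmetric] antisym)
qed

text \<open>A cube is determined by its level and finitely many integers, although it is named by a
  point.\<close>

lemma countable_dyadic_cubes: "countable {dyadic_cube h k x |k x. True}"
proof -
  have "{dyadic_cube h k x |k x. True} \<subseteq>
    (\<Union>k. (\<lambda>n. {y. \<forall>b\<in>Basis. \<lfloor>(y \<bullet> b) / (2 ^ k * h)\<rfloor> = n b}) ` (PiE Basis (\<lambda>_. UNIV :: int set)))"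
  proof (rule subsetI)
    fix Q assume "Q \<in> {dyadic_cube h k x |k x. True}"
    then obtain k x where Q: "Q = dyadic_cube h k x" by blast
    have "dyadic_cube h k x = {y. \<forall>b\<in>Basis. \<lfloor>(y \<bullet> b) / (2 ^ k * h)\<rfloor> = (\<lambda>b\<in>Basis. \<lfloor>(x \<bullet> b) / (2 ^ k * h)\<rfloor>) b}"
      by (simp add: dyadic_cube_def)
    moreover have "(\<lambda>b\<in>Basis. \<lfloor>(x \<bullet> b) / (2 ^ k * h)\<rfloor>) \<in> PiE Basis (\<lambda>_. UNIV :: int set)" by simp
    ultimately show "Q \<in> (\<Union>k. (\<lambda>n. {y. \<forall>b\<in>Basis. \<lfloor>(y \<bullet> b) / (2 ^ k * h)\<rfloor> = n b}) ` (PiE Basis (\<lambda>_. UNIV :: int set)))"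
      unfolding Q by blast
  qed
  then show ?thesis
    by (rule countable_subset) (intro countable_UN countable_image countable_PiE; simp)
qed

section \<open>Boxing and trace inequality for a weight with Morrey bounds\<close>

context
  fixes w :: "'a::euclidean_space \<Rightarrow> ennreal" and h A :: real
  assumes w [measurable]: "w \<in> borel_measurable borel" and h: "h > 0" and A: "A > 0"
    and w_le: "\<And>y. w y \<le> ennreal (A / h)"
    and w_cube: "\<And>k x. (\<integral>\<^sup>+y\<in>dyadic_cube h k x. w y \<partial>lborel) \<le> ennreal (A * (2 ^ k * h) ^ (DIM('a) - 1))"
begin

text \<open>With \<open>n = 2 ^ k\<close> steps of length at most d h, the relative isoperimetric
  inequality bounds the volume of \<open>S\<close> in the cube by the energy of the cube. If the
  density is also bounded below, the cube bound on \<open>w\<close> suffices; in a smallest cube,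
  where it need not be, the pointwise bound on \<open>w\<close> takes its place.\<close>

lemma stopping_cube_bound:
  assumes [measurable]: "S \<in> sets borel"
    and half: "2 * measure lborel (S \<inter> dyadic_cube h k x) \<le> (2 ^ k * h) ^ DIM('a)"
    and dense: "k = 0 \<or> (2 ^ k * h) ^ DIM('a) \<le> 2 ^ (DIM('a) + 1) * measure lborel (S \<inter> dyadic_cube h k x)"
  shows "(\<integral>\<^sup>+y\<in>S \<inter> dyadic_cube h k x. w y \<partial>lborel) \<le> ennreal (A * 2 ^ (DIM('a) + 2) / h ^ (DIM('a) + 1)) *
    (\<integral>\<^sup>+y. indicator (dyadic_cube h k x) y *
       (\<integral>\<^sup>+z. indicator (cball y (DIM('a) * h)) z * separates S y z \<partial>lborel) \<partial>lborel)"
    (is "_ \<le> ennreal ?C * ?g")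
proof (cases "?g = \<infinity>")
  case True
  have "?C > 0" using A h by simp
  then have "ennreal ?C * \<infinity> = \<infinity>" using A h by (simp add: ennreal_mult_eq_top_iff)
  then show ?thesis by (simp only: True) simp
next
  case False
  define Q where "Q = dyadic_cube h k x"
  define d where "d = DIM('a)"
  define s where "s = 2 ^ k * h"
  define a where "a = measure lborel (S \<inter> Q)"
  obtain g where g: "?g = ennreal g" "g \<ge> 0" using False by (cases ?g) auto
  have s: "s > 0" using h by (simp add: s_def)
  have d: "d \<ge> 1" by (simp add: d_def Suc_leI)
  have Q [measurable]: "Q \<in> sets borel" by (simp add: Q_def)
  have eQ: "emeasure lborel Q = ennreal (s ^ d)"
    unfolding Q_def s_def d_def by (rule emeasure_dyadic_cube[OF h])
  then have fin: "emeasure lborel (S \<inter> Q) \<noteq> \<infinity>" "emeasure lborel Q \<noteq> \<infinity>"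
    using emeasure_mono[of "S \<inter> Q" Q lborel] by (auto simp: top_unique)
  have "measure lborel (Q - S) = measure lborel Q - measure lborel (Q \<inter> S)"
    using fin measure_Diff[of lborel Q "Q \<inter> S"] by (simp add: Diff_Int Int_commute)
  then have mD: "measure lborel (Q - S) = s ^ d - a"
    using s by (simp add: measure_def eQ a_def Int_commute)
  have fin2: "emeasure lborel (Q - S) \<noteq> \<infinity>"
    using fin(2) emeasure_mono[of "Q - S" Q lborel] by (auto simp: top_unique)
  have rel: "emeasure lborel (S \<inter> Q) * emeasure lborel (Q - S) \<le> ennreal (real (2 ^ k) ^ (d + 1)) * ?g"
    unfolding Q_def d_def
    by (intro relative_isoperimetric) (auto intro: convex_dyadic_cube h norm_diff_dyadic_cube_le)
  have a: "2 * a \<le> s ^ d" "a \<ge> 0" using half by (simp_all add: a_def Q_def s_def d_def)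
  have "emeasure lborel (S \<inter> Q) * emeasure lborel (Q - S) = ennreal a * ennreal (s ^ d - a)"
    using fin fin2 by (simp add: emeasure_eq_ennreal_measure mD flip: a_def)
  also have "\<dots> = ennreal (a * (s ^ d - a))" using a by (intro ennreal_mult[symmetric]) auto
  finally have "ennreal (a * (s ^ d - a)) \<le> ennreal (real (2 ^ k) ^ (d + 1)) * ?g"
    using rel by simp
  also have "\<dots> = ennreal ((2 ^ k) ^ (d + 1) * g)"
    unfolding g(1) using g(2) by (subst ennreal_mult) auto
  finally have *: "a * (s ^ d - a) \<le> (2 ^ k) ^ (d + 1) * g" using g by simp
  \<comment> \<open>\<open>S\<close> fills at most half of the cube, so the complement has volume at
    least \<open>s ^ d / 2\<close>.\<close>
  have "a * (s ^ d / 2) \<le> a * (s ^ d - a)" using a by (intro mult_left_mono) auto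
  also note *
  also have "(2 ^ k) ^ (d + 1) * g = (s / h) ^ (d + 1) * g" using h by (simp add: s_def)
  finally have iso: "a * s ^ d \<le> 2 * (s / h) ^ (d + 1) * g" by (simp add: mult_ac)
  have goal: "(\<integral>\<^sup>+y\<in>S \<inter> Q. w y \<partial>lborel) \<le> ennreal (?C * g)"
  proof (cases "k = 0")
    case True
    then have "s = h" by (simp add: s_def)
    have "(\<integral>\<^sup>+y\<in>S \<inter> Q. w y \<partial>lborel) \<le> (\<integral>\<^sup>+y. ennreal (A / h) * indicator (S \<inter> Q) y \<partial>lborel)"
      by (intro nn_integral_mono mult_right_mono w_le) auto
    also have "\<dots> = ennreal (A / h) * ennreal a"
      using fin by (simp add: nn_integral_cmult_indicator emeasure_eq_ennreal_measure a_def)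
    also have "\<dots> = ennreal (A / h * a)"
      using A h a(2) by (intro ennreal_mult[symmetric]) auto
    also have "\<dots> \<le> ennreal (?C * g)"
    proof (rule ennreal_leI)
      have "a * h ^ d \<le> 2 * g" using iso h by (simp add: \<open>s = h\<close>)
      then have "A / h * a \<le> A * (2 * g) / h ^ (d + 1)"
        using A h by (simp add: field_simps)
      also have "\<dots> \<le> ?C * g"
      proof -
        \<comment> \<open>Deliberately wasteful: the factor \<open>2 ^ (d + 2)\<close> is dictated
          by the other case, and one constant serves both.\<close>
        have "(2::real) \<le> 2 ^ (d + 2)" using power_increasing[of 1 "d + 2" "2::real"] by simp
        then have "A * 2 * g / h ^ (d + 1) \<le> A * 2 ^ (d + 2) * g / h ^ (d + 1)"
          using A h g by (intro divide_right_mono mult_right_mono mult_left_mono) auto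
        then show ?thesis by (simp add: d_def mult_ac)
      qed
      finally show "A / h * a \<le> ?C * g" .
    qed
    finally show ?thesis .
  next
    case False
    then have dense': "s ^ d \<le> 2 ^ (d + 1) * a" using dense by (simp add: s_def d_def a_def Q_def)
    have "(\<integral>\<^sup>+y\<in>S \<inter> Q. w y \<partial>lborel) \<le> (\<integral>\<^sup>+y\<in>Q. w y \<partial>lborel)"
      by (intro nn_integral_mono) (auto split: split_indicator)
    also have "\<dots> \<le> ennreal (A * s ^ (d - 1))" using w_cube by (simp add: Q_def s_def d_def)
    also have "\<dots> \<le> ennreal (?C * g)"
    proof (rule ennreal_leI)
      have "s ^ d * s ^ d \<le> 2 ^ (d + 1) * (2 * (s / h) ^ (d + 1) * g)"
      proof -
        have "s ^ d * s ^ d \<le> 2 ^ (d + 1) * a * s ^ d" using dense' s by (intro mult_right_mono) auto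
        also have "\<dots> = 2 ^ (d + 1) * (a * s ^ d)" by simp
        also have "\<dots> \<le> 2 ^ (d + 1) * (2 * (s / h) ^ (d + 1) * g)" using iso by (intro mult_left_mono) auto
        finally show ?thesis .
      qed
      \<comment> \<open>Exhibits the factor \<open>s ^ (d + 1)\<close> that comes from the
        isoperimetric constant; what is left after cancelling it is the growth
        \<open>s ^ (d - 1)\<close> of \<open>w\<close>. Here \<open>d \<ge> 1\<close> matters for
        the truncated subtraction.\<close>
      moreover have "s ^ d * s ^ d = s ^ (d + 1) * s ^ (d - 1)"
        using d by (cases d) simp_all
      ultimately have "s ^ (d + 1) * s ^ (d - 1) \<le> s ^ (d + 1) * (2 ^ (d + 2) * g / h ^ (d + 1))"
        by (simp add: power_divide algebra_simps)
      then have "s ^ (d - 1) \<le> 2 ^ (d + 2) * g / h ^ (d + 1)"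
        using s by (simp only: mult_le_cancel_left_pos zero_less_power)
      from mult_left_mono[OF this, of A] A show "A * s ^ (d - 1) \<le> ?C * g"
        by (simp add: d_def)
    qed
    finally show ?thesis .
  qed
  have "ennreal (?C * g) = ennreal ?C * ?g"
    using A h g(2) unfolding g(1) by (intro ennreal_mult) auto
  then show ?thesis using goal unfolding Q_def by simp
qed

text \<open>Every point of \<open>S\<close> lies in a cube to which the previous bound applies. The
  chosen cubes are equal or disjoint, hence countably many, and their energies add up to at most the
  total energy.\<close>

lemma boxing:
  assumes [measurable]: "S \<in> sets borel" and fin: "emeasure lborel S < \<infinity>"
  shows "(\<integral>\<^sup>+y\<in>S. w y \<partial>lborel) \<le> ennreal (A * 2 ^ (DIM('a) + 2) / h ^ (DIM('a) + 1)) *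
    (\<integral>\<^sup>+y. \<integral>\<^sup>+z. indicator (cball y (DIM('a) * h)) z * separates S y z \<partial>lborel \<partial>lborel)"
    (is "_ \<le> ?C * _")
proof -
  define d where "d = DIM('a)"
  have d: "d \<ge> 1" by (simp add: d_def Suc_leI)
  define dens where "dens k y = measure lborel (S \<inter> dyadic_cube h k y)" for k y
  define good where "good k y \<longleftrightarrow> 2 * dens k y \<le> (2 ^ k * h) ^ d \<and>
    (k = 0 \<or> (2 ^ k * h) ^ d \<le> 2 ^ (d + 1) * dens k y)" for k y
  \<comment> \<open>The largest good level, not the first one: maximality is what makes two
    intersecting chosen cubes equal.\<close>
  define level where "level y = Max {k. good k y}" for y
  have dens_le: "dens k y \<le> measure lborel S" for k y
    unfolding dens_def using fin by (intro measure_mono_fmeasurable) (auto simp: fmeasurable_def)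
  have big: "\<exists>k0. \<forall>k\<ge>k0. c < (2 ^ k * h) ^ d" for c
  proof -
    obtain k0 :: nat where k0: "max c 1 / h < 2 ^ k0" using real_arch_pow[of 2 "max c 1 / h"] by auto
    have "c < (2 ^ k * h) ^ d" if "k \<ge> k0" for k
    proof -
      have "max c 1 < 2 ^ k0 * h" using k0 h by (simp add: pos_divide_less_eq)
      also have "\<dots> \<le> 2 ^ k * h" using that h by (intro mult_right_mono power_increasing) auto
      finally have "c < 2 ^ k * h" "1 \<le> 2 ^ k * h" by auto
      then show ?thesis using self_le_power[of "2 ^ k * h" d] d by linarith
    qed
    then show ?thesis by blast
  qed
  have fin_good: "finite {k. good k y}" for y
  proof -
    \<comment> \<open>A set of finite measure has arbitrarily small density in all sufficiently
      large cubes, so the lower density bound must fail eventually.\<close>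
    obtain k0 where k0: "\<forall>k\<ge>k0. 2 ^ (d + 1) * measure lborel S < (2 ^ k * h) ^ d" using big by blast
    have "k < Suc k0" if "good k y" for k
    proof (rule ccontr)
      assume "\<not> k < Suc k0"
      then have "k0 \<le> k" "k \<noteq> 0" by auto
      have "(2 ^ k * h) ^ d \<le> 2 ^ (d + 1) * dens k y" using that \<open>k \<noteq> 0\<close> unfolding good_def by blast
      also have "\<dots> \<le> 2 ^ (d + 1) * measure lborel S"
        using dens_le by (intro mult_left_mono) auto
      also have "\<dots> < (2 ^ k * h) ^ d" using k0 \<open>k0 \<le> k\<close> by blast
      finally show False by simp
    qed
    then have "{k. good k y} \<subseteq> {..<Suc k0}" by blast
    then show ?thesis by (rule finite_subset) simp
  qed
  have ex_good: "\<exists>k. good k y" for y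
  proof -
    obtain k0 where k0: "\<forall>k\<ge>k0. 2 * measure lborel S < (2 ^ k * h) ^ d" using big by blast
    \<comment> \<open>At the first level with density at most one half, the preceding cube has
      density above one half. Doubling the side divides the density by at most \<open>2 ^ d\<close>,
      whence the lower bound with \<open>2 ^ (d + 1)\<close>.\<close>
    define k where "k = (LEAST k. 2 * dens k y \<le> (2 ^ k * h) ^ d)"
    have ex: "2 * dens k0 y \<le> (2 ^ k0 * h) ^ d"
      using k0 dens_le[of k0 y] by (meson less_eq_real_def mult_left_mono order_refl order_trans zero_le_numeral)
    then have 1: "2 * dens k y \<le> (2 ^ k * h) ^ d" unfolding k_def by (rule LeastI)
    have "(2 ^ k * h) ^ d \<le> 2 ^ (d + 1) * dens k y" if k: "k \<noteq> 0"
    proof -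
      obtain j where j: "k = Suc j" using k by (cases k) auto
      then have "\<not> 2 * dens j y \<le> (2 ^ j * h) ^ d" unfolding k_def by (metis lessI not_less_Least)
      then have "2 ^ d * (2 ^ j * h) ^ d \<le> 2 ^ d * (2 * dens j y)" by (intro mult_left_mono) auto
      moreover have "(2 ^ k * h) ^ d = 2 ^ d * (2 ^ j * h) ^ d" by (simp add: j power_mult_distrib)
      moreover have "dens j y \<le> dens k y"
      proof -
        have "emeasure lborel (S \<inter> dyadic_cube h k y) < \<infinity>"
          using fin emeasure_mono[of "S \<inter> dyadic_cube h k y" S lborel] by (auto simp: le_less_trans)
        then show ?thesis
          unfolding dens_def j using dyadic_cube_Suc[of h j y]
          by (intro measure_mono_fmeasurable) (auto simp: fmeasurable_def)
      qed
      ultimately show ?thesis by simp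
    qed
    then have "good k y" using 1 unfolding good_def by fast
    then show ?thesis by (rule exI)
  qed
  have level: "good (level y) y" for y
    using Max_in[OF fin_good, of y] ex_good[of y] by (auto simp: level_def)
  have level_max: "good k y \<Longrightarrow> k \<le> level y" for k y
    unfolding level_def using fin_good by (intro Max_ge) auto
  have good_cong: "good k y = good k y'" if "dyadic_cube h k y = dyadic_cube h k y'" for k y y'
    using that by (simp add: good_def dens_def)
  define T where "T y = dyadic_cube h (level y) y" for y
  \<comment> \<open>At the larger of the two levels \<open>y\<close> and \<open>y'\<close> lie in
    the same cube. That cube is good for \<open>y\<close> too, so maximality forces the levels to
    agree.\<close>
  have T_aux: "T y = T y'" if "z \<in> T y" "z \<in> T y'" "level y \<le> level y'" for y y' z
  proof -
    have "z \<in> dyadic_cube h (level y') y" using that(1,3) dyadic_cube_mono[of "level y" "level y'" h y] by (auto simp: T_def)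
    then have eq: "dyadic_cube h (level y') y = dyadic_cube h (level y') y'"
      using that(2) dyadic_cube_eq unfolding T_def by blast
    then have "good (level y') y" using level[of y'] good_cong by blast
    then have "level y = level y'" using that(3) level_max by (simp add: antisym)
    then show ?thesis using eq by (simp add: T_def)
  qed
  have T_eq: "T y = T y'" if "z \<in> T y" "z \<in> T y'" for y y' z
    using T_aux[OF that] T_aux[OF that(2,1)] by (metis linear)
  define F where "F = T ` S"
  have cF: "countable F"
    by (rule countable_subset[OF _ countable_dyadic_cubes[of h]]) (auto simp: F_def T_def)
  have dF: "disjoint_family_on (\<lambda>Q. Q) F"
    unfolding disjoint_family_on_def F_def using T_eq by blast
  have mF [measurable]: "Q \<in> sets borel" if "Q \<in> F" for Q using that by (auto simp: F_def T_def)
  \<comment> \<open>Only \<open>y\<close> is confined to a cube in the energy, while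
    \<open>z\<close> ranges freely. Hence \<open>G\<close> is the density of a measure, which is
    additive over the disjoint cubes.\<close>
  define G where "G y = (\<integral>\<^sup>+z. indicator (cball y (DIM('a) * h)) z * separates S y z \<partial>lborel)" for y
  have [measurable]: "G \<in> borel_measurable borel"
    unfolding G_def by measurable
  have each: "emeasure (density lborel w) (S \<inter> Q) \<le> ?C * emeasure (density lborel G) Q" if "Q \<in> F" for Q
  proof -
    from that obtain y where y: "Q = dyadic_cube h (level y) y" unfolding F_def T_def by blast
    have "(\<integral>\<^sup>+z\<in>S \<inter> dyadic_cube h (level y) y. w z \<partial>lborel) \<le> ?C * (\<integral>\<^sup>+z. indicator (dyadic_cube h (level y) y) z * G z \<partial>lborel)"
      unfolding G_def using level[of y] by (intro stopping_cube_bound) (auto simp: good_def dens_def d_def)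
    then show ?thesis by (simp add: y emeasure_density mult.commute)
  qed
  have "(\<integral>\<^sup>+y\<in>S. w y \<partial>lborel) = emeasure (density lborel w) S"
    by (simp add: emeasure_density)
  also have "\<dots> \<le> emeasure (density lborel w) (\<Union>Q\<in>F. S \<inter> Q)"
  proof (rule emeasure_mono)
    show "S \<subseteq> (\<Union>Q\<in>F. S \<inter> Q)" by (auto simp: F_def T_def)
    show "(\<Union>Q\<in>F. S \<inter> Q) \<in> sets (density lborel w)"
      using cF mF by (intro sets.countable_UN') auto
  qed
  also have "\<dots> = (\<integral>\<^sup>+Q. emeasure (density lborel w) (S \<inter> Q) \<partial>count_space F)"
    using cF dF mF by (intro emeasure_UN_countable) (auto simp: disjoint_family_on_def)
  also have "\<dots> \<le> (\<integral>\<^sup>+Q. ?C * emeasure (density lborel G) Q \<partial>count_space F)"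
    by (intro nn_integral_mono each) simp
  also have "\<dots> = ?C * (\<integral>\<^sup>+Q. emeasure (density lborel G) Q \<partial>count_space F)"
    by (intro nn_integral_cmult) simp
  also have "(\<integral>\<^sup>+Q. emeasure (density lborel G) Q \<partial>count_space F) = emeasure (density lborel G) (\<Union>Q\<in>F. Q)"
    using cF dF mF by (intro emeasure_UN_countable[symmetric]) auto
  also have "\<dots> \<le> emeasure (density lborel G) UNIV"
    by (intro emeasure_mono) auto
  also have "\<dots> = (\<integral>\<^sup>+y. G y \<partial>lborel)" by (simp add: emeasure_density)
  finally show ?thesis by (simp add: G_def mult_left_mono)
qed

text \<open>Boxing is applied to each superlevel set and integrated over the level t. A pair
  \<open>y\<close>, \<open>z\<close> is separated exactly for the levels between \<open>f y\<close>
  and \<open>f z\<close>, so the energies of the level sets integrate to the differences of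
  \<open>f\<close>.\<close>

lemma trace_inequality:
  assumes f [measurable]: "f \<in> borel_measurable borel" and f0: "\<And>y. 0 \<le> f y"
    and fin: "(\<integral>\<^sup>+y. ennreal (f y) \<partial>lborel) < \<infinity>"
  shows "(\<integral>\<^sup>+y. ennreal (f y) * w y \<partial>lborel) \<le> ennreal (A * 2 ^ (DIM('a) + 2) / h ^ (DIM('a) + 1)) *
    (\<integral>\<^sup>+y. \<integral>\<^sup>+z. indicator (cball y (DIM('a) * h)) z * ennreal \<bar>f y - f z\<bar> \<partial>lborel \<partial>lborel)"
    (is "_ \<le> ?C * _")
proof -
  define S where "S t = {y. t < f y}" for t :: real
  have [measurable]: "S t \<in> sets borel" for t unfolding S_def by measurable
  \<comment> \<open>Written out without \<open>S\<close>, so that joint measurability in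
    \<open>t\<close>, \<open>y\<close> and \<open>z\<close> is available to Tonelli.\<close>
  define c where "c t y z = (if (t < f y) \<noteq> (t < f z) then 1 else 0 :: ennreal)" for t y z
  have c: "separates (S t) y z = c t y z" for t y z by (simp add: c_def separates_def S_def)
  \<comment> \<open>Markov's inequality; boxing requires sets of finite measure, hence positive
    levels only.\<close>
  have S: "emeasure lborel (S t) < \<infinity>" if "t > 0" for t
  proof -
    have "ennreal t * emeasure lborel (S t) = (\<integral>\<^sup>+y. ennreal t * indicator (S t) y \<partial>lborel)"
      by (simp add: nn_integral_cmult_indicator)
    also have "\<dots> \<le> (\<integral>\<^sup>+y. ennreal (f y) \<partial>lborel)"
      by (intro nn_integral_mono) (auto simp: S_def intro!: ennreal_leI split: split_indicator)
    finally have "ennreal t * emeasure lborel (S t) < \<infinity>" using fin by (rule le_less_trans)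
    then show ?thesis using that by (auto simp: ennreal_mult_less_top)
  qed
  have layer: "ennreal (f y) = (\<integral>\<^sup>+t. indicator {0<..} t * indicator {t. t < f y} t \<partial>lborel)" for y
  proof -
    have "(\<integral>\<^sup>+t. indicator {0<..} t * indicator {t. t < f y} t \<partial>lborel) = (\<integral>\<^sup>+t. indicator {0<..<f y} t \<partial>lborel)"
      by (intro nn_integral_cong) (auto split: split_indicator)
    then show ?thesis using f0[of y] by simp
  qed
  have "(\<integral>\<^sup>+y. ennreal (f y) * w y \<partial>lborel)
    = (\<integral>\<^sup>+y. \<integral>\<^sup>+t. indicator {0<..} t * indicator {t. t < f y} t * w y \<partial>lborel \<partial>lborel)"
    unfolding layer by (intro nn_integral_cong nn_integral_multc[symmetric]) measurable
  also have "\<dots> = (\<integral>\<^sup>+t. \<integral>\<^sup>+y. indicator {0<..} t * indicator {t. t < f y} t * w y \<partial>lborel \<partial>lborel)"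
    by (rule lborel_pair.Fubini') measurable
  also have "\<dots> \<le> (\<integral>\<^sup>+t. ?C * (\<integral>\<^sup>+y. \<integral>\<^sup>+z. indicator {0<..} t * (indicator (cball y (DIM('a) * h)) z * c t y z) \<partial>lborel \<partial>lborel) \<partial>lborel)"
  proof (rule nn_integral_mono)
    fix t :: real
    show "(\<integral>\<^sup>+y. indicator {0<..} t * indicator {t. t < f y} t * w y \<partial>lborel)
      \<le> ?C * (\<integral>\<^sup>+y. \<integral>\<^sup>+z. indicator {0<..} t * (indicator (cball y (DIM('a) * h)) z * c t y z) \<partial>lborel \<partial>lborel)"
    proof (cases "t > 0")
      case True
      have "(\<integral>\<^sup>+y. indicator {0<..} t * indicator {t. t < f y} t * w y \<partial>lborel) = (\<integral>\<^sup>+y\<in>S t. w y \<partial>lborel)"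
        using True by (intro nn_integral_cong) (auto simp: S_def split: split_indicator)
      also have "\<dots> \<le> ?C * (\<integral>\<^sup>+y. \<integral>\<^sup>+z. indicator (cball y (DIM('a) * h)) z * separates (S t) y z \<partial>lborel \<partial>lborel)"
        by (rule boxing) (use S True in auto)
      finally show ?thesis using True by (simp add: c)
    qed simp
  qed
  also have "\<dots> = ?C * (\<integral>\<^sup>+t. \<integral>\<^sup>+y. \<integral>\<^sup>+z. indicator {0<..} t * (indicator (cball y (DIM('a) * h)) z * c t y z) \<partial>lborel \<partial>lborel \<partial>lborel)"
    by (intro nn_integral_cmult) (unfold c_def, measurable)
  also have "(\<integral>\<^sup>+t. \<integral>\<^sup>+y. \<integral>\<^sup>+z. indicator {0<..} t * (indicator (cball y (DIM('a) * h)) z * c t y z) \<partial>lborel \<partial>lborel \<partial>lborel)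
    = (\<integral>\<^sup>+y. \<integral>\<^sup>+t. \<integral>\<^sup>+z. indicator {0<..} t * (indicator (cball y (DIM('a) * h)) z * c t y z) \<partial>lborel \<partial>lborel \<partial>lborel)"
    by (rule lborel_pair.Fubini') (unfold c_def, measurable)
  also have "\<dots> = (\<integral>\<^sup>+y. \<integral>\<^sup>+z. \<integral>\<^sup>+t. indicator {0<..} t * (indicator (cball y (DIM('a) * h)) z * c t y z) \<partial>lborel \<partial>lborel \<partial>lborel)"
    by (intro nn_integral_cong lborel_pair.Fubini') (unfold c_def, measurable)
  also have "\<dots> \<le> (\<integral>\<^sup>+y. \<integral>\<^sup>+z. indicator (cball y (DIM('a) * h)) z * ennreal \<bar>f y - f z\<bar> \<partial>lborel \<partial>lborel)"
  proof (intro nn_integral_mono)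
    fix y z
    have "(\<integral>\<^sup>+t. indicator {0<..} t * (indicator (cball y (DIM('a) * h)) z * c t y z) \<partial>lborel)
      \<le> (\<integral>\<^sup>+t. indicator (cball y (DIM('a) * h)) z * indicator {min (f y) (f z)..max (f y) (f z)} t \<partial>lborel)"
      by (intro nn_integral_mono) (auto simp: c_def split: split_indicator)
    also have "\<dots> = indicator (cball y (DIM('a) * h)) z * ennreal \<bar>f y - f z\<bar>"
      by (auto simp: nn_integral_cmult max_def min_def abs_real_def)
    finally show "(\<integral>\<^sup>+t. indicator {0<..} t * (indicator (cball y (DIM('a) * h)) z * c t y z) \<partial>lborel)
      \<le> indicator (cball y (DIM('a) * h)) z * ennreal \<bar>f y - f z\<bar>" .
  qed
  finally show ?thesis by (simp add: mult_left_mono)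
qed

end

subsection \<open>Morrey measures\<close>

lemma nn_integral_powr_greaterThan:
  fixes e a :: real
  assumes "e < -1" "a > 0"
  shows "(\<integral>\<^sup>+r. indicator {a<..} r * ennreal (r powr e) \<partial>lborel) = ennreal (- (a powr (e + 1)) / (e + 1))"
proof -
  have "(\<integral>\<^sup>+r. indicator {a<..} r * ennreal (r powr e) \<partial>lborel) = (\<integral>\<^sup>+r. ennreal (r powr e) * indicator {a..} r \<partial>lborel)"
    by (intro nn_integral_cong_AE AE_I[where N="{a}"]) (auto split: split_indicator)
  also have "\<dots> = ennreal (- (a powr (e + 1)) / (e + 1))"
    using has_integral_powr_to_inf[OF assms]
    by (intro nn_integral_has_integral_lebesgue') auto
  finally show ?thesis .
qed

lemma nn_integral_powr_from_0:
  fixes e a :: real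
  assumes "-1 < e" "a > 0"
  shows "(\<integral>\<^sup>+r. indicator {0<..a} r * ennreal (r powr e) \<partial>lborel) = ennreal (a powr (e + 1) / (e + 1))"
proof -
  have "(\<integral>\<^sup>+r. indicator {0<..a} r * ennreal (r powr e) \<partial>lborel) = (\<integral>\<^sup>+r. ennreal (r powr e) * indicator {0..a} r \<partial>lborel)"
    by (intro nn_integral_cong_AE AE_I[where N="{0}"]) (auto split: split_indicator)
  also have "\<dots> = ennreal (a powr (e + 1) / (e + 1))"
    using has_integral_powr_from_0[OF assms(1), of a] assms
    by (intro nn_integral_has_integral_lebesgue') auto
  finally show ?thesis .
qed

text \<open>The indicator of a ball as a function of centre, radius and point, so that it is jointly
  measurable in all three and symmetric in centre and point.\<close>

definition in_ball :: "'a::metric_space \<Rightarrow> real \<Rightarrow> 'a \<Rightarrow> ennreal" where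
  "in_ball x r y = (if dist x y < r then 1 else 0)"

lemma borel_measurable_in_ball [measurable (raw)]:
  fixes f g :: "'a \<Rightarrow> 'b::{second_countable_topology, metric_space}"
  assumes [measurable]: "f \<in> borel_measurable M" "k \<in> borel_measurable M" "g \<in> borel_measurable M"
  shows "(\<lambda>x. in_ball (f x) (k x) (g x)) \<in> borel_measurable M"
  unfolding in_ball_def by measurable

lemma in_ball_eq_indicator: "in_ball x r y = indicator (ball x r) y"
  by (simp add: in_ball_def)

text \<open>The inner integral is the \<nu>-mass of the ball of radius \<open>r\<close> about
  \<open>y\<close>; as an integral over centres it is visibly measurable in \<open>r\<close> and
  \<open>y\<close>.\<close>

definition weight :: "'a::euclidean_space measure \<Rightarrow> real \<Rightarrow> real \<Rightarrow> 'a \<Rightarrow> ennreal" where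
  "weight \<nu> \<alpha> h y =
     (\<integral>\<^sup>+r. indicator {h<..} r * ennreal (r powr (\<alpha> - DIM('a) - 2)) * (\<integral>\<^sup>+x. in_ball x r y \<partial>\<nu>) \<partial>lborel)"

locale morrey_measure =
  fixes \<nu> :: "'a::euclidean_space measure" and \<alpha> K :: real
  assumes sets_\<nu> [measurable_cong]: "sets \<nu> = sets borel"
    and ball_le: "\<And>x r. r > 0 \<Longrightarrow> emeasure \<nu> (ball x r) \<le> ennreal (K * r powr (DIM('a) - \<alpha>))"
    and \<alpha>: "1 < \<alpha>" "\<alpha> < DIM('a)" and K: "K > 0"
begin

sublocale sigma_finite_measure \<nu>
proof
  show "\<exists>A. countable A \<and> A \<subseteq> sets \<nu> \<and> \<Union> A = space \<nu> \<and> (\<forall>a\<in>A. emeasure \<nu> a \<noteq> \<infinity>)"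
  proof (intro exI conjI ballI)
    let ?A = "range (\<lambda>n::nat. ball (0::'a) (real (Suc n)))"
    show "countable ?A" by simp
    show "?A \<subseteq> sets \<nu>" by (auto simp: sets_\<nu>)
    have "x \<in> \<Union> ?A" for x :: 'a
    proof -
      obtain n where "norm x < real n" using reals_Archimedean2 by blast
      then show ?thesis by (intro UN_I[of n]) auto
    qed
    then show "\<Union> ?A = space \<nu>" using sets_eq_imp_space_eq[OF sets_\<nu>] by auto
    fix a assume "a \<in> ?A"
    then obtain n where "a = ball 0 (real (Suc n))" by blast
    then show "emeasure \<nu> a \<noteq> \<infinity>" using ball_le[of "real (Suc n)" 0] by (auto simp: top_unique)
  qed
qed

text \<open>The growth exponent is positive because \<alpha> < d, so the masses of shrinking balls
  tend to 0. This makes the countably many atoms of a gradient part negligible for \<nu>.\<close>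

lemma emeasure_singleton: "emeasure \<nu> {x} = 0"
proof -
  have "((\<lambda>r. ennreal (K * r powr (DIM('a) - \<alpha>))) \<longlongrightarrow> ennreal (K * 0)) (at_right 0)"
  proof (intro tendsto_ennrealI tendsto_mult tendsto_const)
    show "((\<lambda>r. r powr (DIM('a) - \<alpha>)) \<longlongrightarrow> 0) (at_right 0)"
    proof (rule tendsto_zero_powrI)
      show "\<forall>\<^sub>F r in at_right 0. 0 \<le> (r::real)"
        using eventually_at_right_less[of 0] by eventually_elim simp
    qed (use \<alpha> in \<open>auto intro: tendsto_ident_at\<close>)
  qed
  then have "emeasure \<nu> {x} \<le> ennreal (K * 0)"
  proof (rule tendsto_lowerbound)
    show "\<forall>\<^sub>F r in at_right 0. emeasure \<nu> {x} \<le> ennreal (K * r powr (DIM('a) - \<alpha>))"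
      using eventually_at_right_less[of 0]
    proof eventually_elim
      case (elim r)
      have "emeasure \<nu> {x} \<le> emeasure \<nu> (ball x r)"
        using elim by (intro emeasure_mono) (auto simp: sets_\<nu>)
      then show ?case using ball_le[OF elim, of x] by (rule order_trans)
    qed
  qed simp
  then show ?thesis by simp
qed

lemma nn_integral_in_ball: "(\<integral>\<^sup>+x. in_ball x r y \<partial>\<nu>) = emeasure \<nu> (ball y r)"
proof -
  have "(\<lambda>x. in_ball x r y) = indicator (ball y r)" by (auto simp: fun_eq_iff in_ball_def dist_commute)
  then show ?thesis by (simp add: sets_\<nu>)
qed

lemma weight_measurable [measurable]: "weight \<nu> \<alpha> h \<in> borel_measurable borel"
  unfolding weight_def[abs_def] by measurable

text \<open>The growth condition turns the integrand into \<open>K * r powr (- 2)\<close>, whose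
  integral from \<open>h\<close> on is K/h.\<close>

lemma weight_le:
  assumes "h > 0"
  shows "weight \<nu> \<alpha> h y \<le> ennreal (K / h)"
proof -
  have "weight \<nu> \<alpha> h y \<le> (\<integral>\<^sup>+r. ennreal K * (indicator {h<..} r * ennreal (r powr (- 2))) \<partial>lborel)"
    unfolding weight_def nn_integral_in_ball
  proof (rule nn_integral_mono)
    fix r :: real
    show "indicator {h<..} r * ennreal (r powr (\<alpha> - DIM('a) - 2)) * emeasure \<nu> (ball y r)
      \<le> ennreal K * (indicator {h<..} r * ennreal (r powr (- 2)))"
    proof (cases "r > h")
      case True
      then have r: "r > 0" using assms by simp
      have "ennreal (r powr (\<alpha> - DIM('a) - 2)) * emeasure \<nu> (ball y r)
        \<le> ennreal (r powr (\<alpha> - DIM('a) - 2)) * ennreal (K * r powr (DIM('a) - \<alpha>))"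
        by (intro mult_left_mono ball_le r) auto
      also have "\<dots> = ennreal (r powr (\<alpha> - DIM('a) - 2) * (K * r powr (DIM('a) - \<alpha>)))"
        using K by (intro ennreal_mult[symmetric]) auto
      also have "r powr (\<alpha> - DIM('a) - 2) * (K * r powr (DIM('a) - \<alpha>)) = K * r powr (- 2)"
        by (simp add: mult.left_commute flip: powr_add)
      also have "ennreal (K * r powr (- 2)) = ennreal K * ennreal (r powr (- 2))"
        using K by (intro ennreal_mult) auto
      finally show ?thesis using True by simp
    qed simp
  qed
  also have "\<dots> = ennreal K * ennreal (1 / h)"
    using assms nn_integral_powr_greaterThan[of "-2" h] by (simp add: nn_integral_cmult powr_minus field_simps)
  also have "\<dots> = ennreal (K / h)" using K assms by (subst ennreal_mult[symmetric]) auto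
  finally show ?thesis .
qed

text \<open>The 1 comes from radii above the cube side, the other summand from radii below it: the
  volume of a ball, the growth bound for a ball of radius (d + 1) s about a point of the cube, and
  1/(\<alpha> - 1) from integrating r^(\<alpha> - 2) from 0.\<close>

definition morrey_const :: real where
  "morrey_const = K * (1 + unit_ball_vol DIM('a) * (DIM('a) + 1) powr (DIM('a) - \<alpha>) / (\<alpha> - 1))"

lemma K_le_morrey_const: "K \<le> morrey_const"
proof -
  have "0 \<le> unit_ball_vol DIM('a) * (DIM('a) + 1) powr (DIM('a) - \<alpha>) / (\<alpha> - 1)"
    using \<alpha> by (intro divide_nonneg_pos mult_nonneg_nonneg) auto
  then show ?thesis using K by (simp add: morrey_const_def)
qed

text \<open>The growth condition is good enough for radii above the side \<open>s\<close>. For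
  smaller radii it would leave the divergent integral of r^(-2), so the average over the cube is
  exploited: by Tonelli, integrating the \<nu>-masses of balls centred in the cube gives at most the
  volume of one ball times the \<nu>-mass of a neighbourhood of the cube. The remaining integrand
  r^(\<alpha> - 2) is integrable at 0 because \<alpha> > 1.\<close>

lemma weight_dyadic_cube:
  assumes h: "h > 0"
  shows "(\<integral>\<^sup>+y\<in>dyadic_cube h k x. weight \<nu> \<alpha> h y \<partial>lborel) \<le> ennreal (morrey_const * (2 ^ k * h) ^ (DIM('a) - 1))"
proof -
  define Q where "Q = dyadic_cube h k x"
  define d where "d = DIM('a)"
  define s where "s = 2 ^ k * h"
  have s: "s > 0" using h by (simp add: s_def)
  have d: "d \<ge> 1" by (simp add: d_def Suc_leI)
  have [measurable]: "Q \<in> sets borel" by (simp add: Q_def)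
  have eQ: "emeasure lborel Q = ennreal (s ^ d)"
    unfolding Q_def s_def d_def by (rule emeasure_dyadic_cube[OF h])
  define c where "c = unit_ball_vol d * (K * ((d + 1) * s) powr (d - \<alpha>))"
  have c: "c \<ge> 0" using K by (simp add: c_def)
  define m where "m r = (\<integral>\<^sup>+y. indicator Q y * emeasure \<nu> (ball y r) \<partial>lborel)" for r
  have m_large: "m r \<le> ennreal (K * s ^ d) * ennreal (r powr (d - \<alpha>))" if "r > 0" for r
  proof -
    have "m r \<le> (\<integral>\<^sup>+y. ennreal (K * r powr (d - \<alpha>)) * indicator Q y \<partial>lborel)"
      unfolding m_def using ball_le[OF that]
      by (intro nn_integral_mono) (auto simp: d_def split: split_indicator)
    also have "\<dots> = ennreal (K * r powr (d - \<alpha>)) * ennreal (s ^ d)"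
      by (simp add: nn_integral_cmult_indicator eQ)
    also have "\<dots> = ennreal (K * s ^ d) * ennreal (r powr (d - \<alpha>))"
      using K s by (simp add: mult_ac flip: ennreal_mult)
    finally show ?thesis .
  qed
  have m_small: "m r \<le> ennreal c * ennreal (r ^ d)" if r: "0 < r" "r \<le> s" for r
  proof -
    have "m r = (\<integral>\<^sup>+y. \<integral>\<^sup>+z. indicator Q y * in_ball z r y \<partial>\<nu> \<partial>lborel)"
      unfolding m_def nn_integral_in_ball[symmetric]
      by (intro nn_integral_cong nn_integral_cmult[symmetric]) measurable
    also have "\<dots> = (\<integral>\<^sup>+z. \<integral>\<^sup>+y. indicator Q y * in_ball z r y \<partial>lborel \<partial>\<nu>)"
      by (rule pair_sigma_finite.Fubini'[symmetric]) (unfold_locales, measurable)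
    also have "\<dots> \<le> (\<integral>\<^sup>+z. ennreal (unit_ball_vol d * r ^ d) * indicator (ball x ((d + 1) * s)) z \<partial>\<nu>)"
    proof (rule nn_integral_mono)
      fix z :: 'a
      show "(\<integral>\<^sup>+y. indicator Q y * in_ball z r y \<partial>lborel) \<le> ennreal (unit_ball_vol d * r ^ d) * indicator (ball x ((d + 1) * s)) z"
      proof (cases "dist x z < (d + 1) * s")
        case True
        have "(\<integral>\<^sup>+y. indicator Q y * in_ball z r y \<partial>lborel) \<le> (\<integral>\<^sup>+y. indicator (ball z r) y \<partial>lborel)"
          by (intro nn_integral_mono) (auto simp: in_ball_eq_indicator split: split_indicator)
        also have "\<dots> = ennreal (unit_ball_vol d * r ^ d)" using r by (simp add: emeasure_ball d_def)
        finally show ?thesis using True by simp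
      next
        case False
        have "indicator Q y * in_ball z r y = 0" for y
        proof (cases "y \<in> Q \<and> dist z y < r")
          case True
          then have "norm (y - x) \<le> d * s"
            using norm_diff_dyadic_cube_le[OF h, of x k x y] by (simp add: Q_def d_def s_def mult_ac)
          moreover have "dist x z \<le> dist x y + dist z y" by (metis dist_commute dist_triangle)
          \<comment> \<open>The cube has diameter at most d s and the radius is at most
            \<open>s\<close>, whence the enlargement factor d + 1.\<close>
          ultimately have "dist x z < (d + 1) * s"
            using True r by (simp add: dist_norm norm_minus_commute distrib_right)
          then show ?thesis using False by simp
        qed (auto simp: in_ball_def)
        then have "(\<integral>\<^sup>+y. indicator Q y * in_ball z r y \<partial>lborel) = (\<integral>\<^sup>+(y::'a). 0 \<partial>lborel)"
          by (intro nn_integral_cong)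
        then show ?thesis by simp
      qed
    qed
    also have "\<dots> = ennreal (unit_ball_vol d * r ^ d) * emeasure \<nu> (ball x ((d + 1) * s))"
      by (rule nn_integral_cmult_indicator) (simp add: sets_\<nu>)
    also have "\<dots> \<le> ennreal (unit_ball_vol d * r ^ d) * ennreal (K * ((d + 1) * s) powr (d - \<alpha>))"
      using s ball_le[of "(d + 1) * s" x] by (intro mult_left_mono) (auto simp: d_def)
    also have "\<dots> = ennreal c * ennreal (r ^ d)"
      using r K by (simp add: c_def mult_ac flip: ennreal_mult)
    finally show ?thesis .
  qed
  have "(\<integral>\<^sup>+y\<in>Q. weight \<nu> \<alpha> h y \<partial>lborel)
    = (\<integral>\<^sup>+y. \<integral>\<^sup>+r. indicator Q y * (indicator {h<..} r * ennreal (r powr (\<alpha> - d - 2)) * (\<integral>\<^sup>+x. in_ball x r y \<partial>\<nu>)) \<partial>lborel \<partial>lborel)"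
    unfolding weight_def d_def mult.commute[of _ "indicator Q _"]
    by (intro nn_integral_cong nn_integral_cmult[symmetric]) measurable
  also have "\<dots> = (\<integral>\<^sup>+r. \<integral>\<^sup>+y. indicator Q y * (indicator {h<..} r * ennreal (r powr (\<alpha> - d - 2)) * (\<integral>\<^sup>+x. in_ball x r y \<partial>\<nu>)) \<partial>lborel \<partial>lborel)"
    by (rule lborel_pair.Fubini') measurable
  also have "\<dots> = (\<integral>\<^sup>+r. indicator {h<..} r * ennreal (r powr (\<alpha> - d - 2)) * m r \<partial>lborel)"
  proof (rule nn_integral_cong)
    fix r :: real
    have "(\<integral>\<^sup>+y. indicator Q y * (indicator {h<..} r * ennreal (r powr (\<alpha> - d - 2)) * (\<integral>\<^sup>+x. in_ball x r y \<partial>\<nu>)) \<partial>lborel)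
      = (\<integral>\<^sup>+y. indicator {h<..} r * ennreal (r powr (\<alpha> - d - 2)) * (indicator Q y * (\<integral>\<^sup>+x. in_ball x r y \<partial>\<nu>)) \<partial>lborel)"
      by (simp add: mult_ac)
    also have "\<dots> = indicator {h<..} r * ennreal (r powr (\<alpha> - d - 2)) * m r"
      unfolding m_def nn_integral_in_ball[symmetric] by (rule nn_integral_cmult) measurable
    finally show "(\<integral>\<^sup>+y. indicator Q y * (indicator {h<..} r * ennreal (r powr (\<alpha> - d - 2)) * (\<integral>\<^sup>+x. in_ball x r y \<partial>\<nu>)) \<partial>lborel)
      = indicator {h<..} r * ennreal (r powr (\<alpha> - d - 2)) * m r" .
  qed
  also have "\<dots> \<le> (\<integral>\<^sup>+r. ennreal c * (indicator {0<..s} r * ennreal (r powr (\<alpha> - 2)))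
      + ennreal (K * s ^ d) * (indicator {s<..} r * ennreal (r powr (- 2))) \<partial>lborel)"
  proof (rule nn_integral_mono)
    fix r :: real
    consider "r \<le> h" | "h < r" "r \<le> s" | "h < r" "s < r" by linarith
    then show "indicator {h<..} r * ennreal (r powr (\<alpha> - d - 2)) * m r \<le> ennreal c * (indicator {0<..s} r * ennreal (r powr (\<alpha> - 2)))
      + ennreal (K * s ^ d) * (indicator {s<..} r * ennreal (r powr (- 2)))"
    proof cases
      case 2
      then have r: "r > 0" using h by simp
      have "ennreal (r powr (\<alpha> - d - 2)) * m r \<le> ennreal (r powr (\<alpha> - d - 2)) * (ennreal c * ennreal (r ^ d))"
        using r 2 by (intro mult_left_mono m_small) auto
      also have "\<dots> = ennreal c * ennreal (r powr (\<alpha> - d - 2) * r powr d)"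
        using r by (simp add: mult_ac powr_realpow ennreal_mult)
      also have "r powr (\<alpha> - d - 2) * r powr d = r powr (\<alpha> - 2)"
        by (simp flip: powr_add)
      finally show ?thesis using 2 r by simp
    next
      case 3
      then have r: "r > 0" using h by simp
      have "ennreal (r powr (\<alpha> - d - 2)) * m r \<le> ennreal (r powr (\<alpha> - d - 2)) * (ennreal (K * s ^ d) * ennreal (r powr (d - \<alpha>)))"
        using r by (intro mult_left_mono m_large) auto
      also have "\<dots> = ennreal (K * s ^ d) * ennreal (r powr (\<alpha> - d - 2) * r powr (d - \<alpha>))"
        using r by (simp add: mult_ac ennreal_mult)
      also have "r powr (\<alpha> - d - 2) * r powr (d - \<alpha>) = r powr (- 2)"
        by (simp flip: powr_add)
      finally show ?thesis using 3 r by simp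
    qed simp
  qed
  also have "\<dots> = ennreal c * (\<integral>\<^sup>+r. indicator {0<..s} r * ennreal (r powr (\<alpha> - 2)) \<partial>lborel)
      + ennreal (K * s ^ d) * (\<integral>\<^sup>+r. indicator {s<..} r * ennreal (r powr (- 2)) \<partial>lborel)"
    by (subst nn_integral_add) (auto simp: nn_integral_cmult)
  also have "\<dots> = ennreal c * ennreal (s powr (\<alpha> - 1) / (\<alpha> - 1)) + ennreal (K * s ^ d) * ennreal (1 / s)"
    using \<alpha> s nn_integral_powr_from_0[of "\<alpha> - 2" s] nn_integral_powr_greaterThan[of "-2" s]
    by (simp add: powr_minus field_simps)
  also have "\<dots> = ennreal (c * (s powr (\<alpha> - 1) / (\<alpha> - 1)) + K * s ^ d * (1 / s))"
    using \<alpha> s c K by (simp flip: ennreal_mult ennreal_plus)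
  also have "c * (s powr (\<alpha> - 1) / (\<alpha> - 1)) + K * s ^ d * (1 / s) = morrey_const * s ^ (d - 1)"
  proof -
    have "s powr (d - \<alpha>) * s powr (\<alpha> - 1) = s powr (real (d - 1))"
      using d by (simp add: of_nat_diff flip: powr_add)
    also have "\<dots> = s ^ (d - 1)" using s by (rule powr_realpow)
    finally have "c * (s powr (\<alpha> - 1) / (\<alpha> - 1)) = K * (unit_ball_vol d * (d + 1) powr (d - \<alpha>) / (\<alpha> - 1)) * s ^ (d - 1)"
      using s by (simp add: c_def powr_mult mult_ac)
    moreover have "K * s ^ d * (1 / s) = K * s ^ (d - 1)"
      using s d by (cases d) auto
    ultimately show ?thesis by (simp add: morrey_const_def d_def algebra_simps)
  qed
  finally show ?thesis by (simp add: Q_def s_def d_def)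
qed

end

subsection \<open>Mollification of functions of bounded variation\<close>

lemma Fubini_integral_nn:
  fixes f :: "'a \<Rightarrow> 'b \<Rightarrow> real"
  assumes "sigma_finite_measure M1" "sigma_finite_measure M2"
    and [measurable]: "(\<lambda>(x, y). f x y) \<in> borel_measurable (M1 \<Otimes>\<^sub>M M2)"
    and fin: "(\<integral>\<^sup>+x. \<integral>\<^sup>+y. ennreal \<bar>f x y\<bar> \<partial>M2 \<partial>M1) < \<infinity>"
  shows "(\<integral>x. (\<integral>y. f x y \<partial>M2) \<partial>M1) = (\<integral>y. (\<integral>x. f x y \<partial>M1) \<partial>M2)"
    and "integrable M1 (\<lambda>x. \<integral>y. f x y \<partial>M2)"
    and "integrable M2 (\<lambda>y. \<integral>x. f x y \<partial>M1)"
proof -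
  interpret M1: sigma_finite_measure M1 by fact
  interpret M2: sigma_finite_measure M2 by fact
  interpret pair_sigma_finite M1 M2 ..
  have "(\<integral>\<^sup>+z. ennreal (norm (case z of (x, y) \<Rightarrow> f x y)) \<partial>(M1 \<Otimes>\<^sub>M M2)) = (\<integral>\<^sup>+x. \<integral>\<^sup>+y. ennreal \<bar>f x y\<bar> \<partial>M2 \<partial>M1)"
    by (subst M2.nn_integral_fst[symmetric]) auto
  then have int: "integrable (M1 \<Otimes>\<^sub>M M2) (\<lambda>(x, y). f x y)"
    using fin by (intro integrableI_bounded) auto
  show "(\<integral>x. (\<integral>y. f x y \<partial>M2) \<partial>M1) = (\<integral>y. (\<integral>x. f x y \<partial>M1) \<partial>M2)"
    by (rule Fubini_integral[OF int, symmetric])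
  show "integrable M1 (\<lambda>x. \<integral>y. f x y \<partial>M2)" using integrable_fst[OF int] .
  show "integrable M2 (\<lambda>y. \<integral>x. f x y \<partial>M1)" using integrable_snd[OF int] .
qed

lemma integral_lborel_translate:
  fixes f :: "'a::euclidean_space \<Rightarrow> real"
  assumes [measurable]: "f \<in> borel_measurable borel"
  shows "(\<integral>x. f (c + x) \<partial>lborel) = (\<integral>x. f x \<partial>lborel)"
proof -
  have "(\<integral>x. f x \<partial>lborel) = (\<integral>x. f x \<partial>distr lborel borel ((+) c))"
    by (simp only: lborel_distr_plus)
  also have "\<dots> = (\<integral>x. f (c + x) \<partial>lborel)" by (rule integral_distr) auto
  finally show ?thesis by simp
qed

lemma bump_deriv_le:
  assumes "0 < r" "norm v \<le> 1" shows "\<bar>bump_deriv r v z\<bar> \<le> 4 / r"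
proof -
  have "4 / r * indicator (ball 0 r) z \<le> 4 / r * 1"
    using assms by (intro mult_left_mono) (auto split: split_indicator)
  then show ?thesis using abs_bump_deriv_le[OF assms, of z] by linarith
qed

lemma abs_bump_deriv_le_norm:
  assumes "0 < r" shows "\<bar>bump_deriv r v z\<bar> \<le> 4 / r * norm v"
proof (cases "v = 0")
  case False
  have "\<bar>bump_deriv r (v /\<^sub>R norm v) z\<bar> \<le> 4 / r"
    using False by (intro bump_deriv_le assms) auto
  moreover have "bump_deriv r (v /\<^sub>R norm v) z = bump_deriv r v z / norm v"
    by (simp add: bump_deriv_def field_simps)
  ultimately show ?thesis using False by (simp add: divide_le_eq)
qed (simp add: bump_deriv_def)

lemma integrable_bump:
  assumes "r > 0" shows "integrable lborel (bump r :: 'a::euclidean_space \<Rightarrow> real)"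
proof (rule Bochner_Integration.integrable_bound)
  show "integrable lborel (indicator (cball 0 r) :: 'a \<Rightarrow> real)"
    using emeasure_lborel_cball_finite by (intro integrable_real_indicator) auto
  show "AE z in (lborel :: 'a measure). norm (bump r z) \<le> norm (indicator (cball 0 r) z :: real)"
  proof (rule AE_I2)
    fix z :: 'a
    show "norm (bump r z) \<le> norm (indicator (cball 0 r) z :: real)"
      using bump_eq_0[OF assms, of z] bump_nonneg[of r z] bump_le_one[of r z] by (auto split: split_indicator)
  qed
qed simp

text \<open>The type argument fixes the dimension, which \<open>r\<close> alone does not
  determine.\<close>

definition bump_mass :: "'a::euclidean_space itself \<Rightarrow> real \<Rightarrow> real" where
  "bump_mass _ r = (\<integral>(z::'a). bump r z \<partial>lborel)"

lemma nn_integral_bump: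
  assumes "r > 0"
  shows "(\<integral>\<^sup>+z. ennreal (bump r (z :: 'a::euclidean_space)) \<partial>lborel) = ennreal (bump_mass TYPE('a) r)"
  unfolding bump_mass_def using integrable_bump[OF assms] bump_nonneg
  by (intro nn_integral_eq_integral) auto

lemma bump_mass_pos:
  assumes "r > 0" shows "bump_mass TYPE('a::euclidean_space) r > 0"
proof (rule ccontr)
  assume "\<not> ?thesis"
  then have "(\<integral>\<^sup>+z. ennreal (bump r (z :: 'a)) \<partial>lborel) = 0"
    using nn_integral_bump[OF assms, where 'a = 'a] by (simp add: ennreal_neg)
  then have "AE z in lborel. ennreal (bump r (z :: 'a)) = 0"
    by (subst (asm) nn_integral_0_iff_AE) auto
  then have "AE z in lborel. z \<notin> ball (0::'a) r"
  proof eventually_elim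
    case (elim z)
    then show ?case using bump_pos[of z r] by (auto simp: ennreal_eq_0_iff)
  qed
  then have "ball (0::'a) r \<in> null_sets lborel" by (subst AE_iff_null_sets) auto
  then have "emeasure lborel (ball (0::'a) r) = 0" by auto
  then show False using assms unit_ball_vol_pos[of "DIM('a)"] by (simp add: emeasure_ball)
qed

lemma nn_integral_bump_translate:
  assumes "r > 0"
  shows "(\<integral>\<^sup>+x. ennreal (bump r (x + c - y :: 'a)) \<partial>lborel) = ennreal (bump_mass TYPE('a::euclidean_space) r)" (is "?l = _")
    and "(\<integral>\<^sup>+x. ennreal (bump r (y - x :: 'a)) \<partial>lborel) = ennreal (bump_mass TYPE('a) r)"
proof -
  have "?l = (\<integral>\<^sup>+x. ennreal (bump r ((c - y) + x)) \<partial>lborel)" by (simp add: algebra_simps)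
  also have "\<dots> = (\<integral>\<^sup>+x. ennreal (bump r (x :: 'a)) \<partial>lborel)"
    by (rule nn_integral_lborel_translate) measurable
  finally show "?l = ennreal (bump_mass TYPE('a) r)" using nn_integral_bump[OF assms] by simp
  have "(\<integral>\<^sup>+x. ennreal (bump r (y - x)) \<partial>lborel) = (\<integral>\<^sup>+x. ennreal (bump r (- y + x)) \<partial>lborel)"
    using bump_minus[of r "y - _"] by simp
  also have "\<dots> = (\<integral>\<^sup>+x. ennreal (bump r (x :: 'a)) \<partial>lborel)"
    by (rule nn_integral_lborel_translate) measurable
  finally show "(\<integral>\<^sup>+x. ennreal (bump r (y - x)) \<partial>lborel) = ennreal (bump_mass TYPE('a) r)"
    using nn_integral_bump[OF assms] by simp
qed

lemma integral_bump_translate: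
  "(\<integral>y. bump r (y - z :: 'a) \<partial>lborel) = bump_mass TYPE('a::euclidean_space) r"
  unfolding bump_mass_def using integral_lborel_translate[of "bump r :: 'a \<Rightarrow> real" "- z"] by simp

text \<open>After Tonelli the integral over \<open>x\<close> is innermost and equals the mass of the
  bump, whatever the shift; then \<open>t\<close> contributes 1 and \<open>y\<close> the mass of the
  measure.\<close>

lemma nn_integral_bump_line:
  fixes \<mu> :: "'a::euclidean_space measure"
  assumes "finite_measure \<mu>" and [measurable_cong]: "sets \<mu> = sets borel" and "r > 0"
  shows "(\<integral>\<^sup>+x. \<integral>\<^sup>+t. indicator {0..1} t * (\<integral>\<^sup>+y. ennreal (bump r (x + t *\<^sub>R v - y)) \<partial>\<mu>) \<partial>lborel \<partial>lborel)
    = ennreal (bump_mass TYPE('a) r) * emeasure \<mu> UNIV"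
proof -
  interpret finite_measure \<mu> by fact
  have sp: "space \<mu> = UNIV" using sets_eq_imp_space_eq[OF assms(2)] by simp
  have "(\<integral>\<^sup>+x. \<integral>\<^sup>+t. indicator {0..1} t * (\<integral>\<^sup>+y. ennreal (bump r (x + t *\<^sub>R v - y)) \<partial>\<mu>) \<partial>lborel \<partial>lborel)
    = (\<integral>\<^sup>+t. \<integral>\<^sup>+x. indicator {0..1::real} t * (\<integral>\<^sup>+y. ennreal (bump r (x + t *\<^sub>R v - y)) \<partial>\<mu>) \<partial>lborel \<partial>lborel)"
    by (rule lborel_pair.Fubini') measurable
  also have "\<dots> = (\<integral>\<^sup>+t. indicator {0..1::real} t * (\<integral>\<^sup>+x. \<integral>\<^sup>+y. ennreal (bump r (x + t *\<^sub>R v - y)) \<partial>\<mu> \<partial>lborel) \<partial>lborel)"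
    by (intro nn_integral_cong nn_integral_cmult) measurable
  also have "\<dots> = (\<integral>\<^sup>+t. indicator {0..1::real} t * (\<integral>\<^sup>+y. \<integral>\<^sup>+x. ennreal (bump r (x + t *\<^sub>R v - y)) \<partial>lborel \<partial>\<mu>) \<partial>lborel)"
    by (intro nn_integral_cong arg_cong2[where f = "(*)"] refl pair_sigma_finite.Fubini')
       (unfold_locales, measurable)
  also have "\<dots> = (\<integral>\<^sup>+t. ennreal (bump_mass TYPE('a) r) * emeasure \<mu> UNIV * indicator {0..1::real} t \<partial>lborel)"
    by (simp add: nn_integral_bump_translate[OF assms(3)] sp mult_ac)
  also have "\<dots> = ennreal (bump_mass TYPE('a) r) * emeasure \<mu> UNIV"
    by (subst nn_integral_cmult_indicator) auto
  finally show ?thesis .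
qed

lemma sum_abs_inner_Basis_le: "(\<Sum>b\<in>Basis. \<bar>v \<bullet> b\<bar>) \<le> DIM('a) * norm (v :: 'a::euclidean_space)"
proof -
  have "(\<Sum>b\<in>Basis. \<bar>v \<bullet> b\<bar>) \<le> (\<Sum>b\<in>(Basis :: 'a set). norm v)"
    by (intro sum_mono) (simp add: Basis_le_norm)
  then show ?thesis by simp
qed

text \<open>What the estimate needs of a BV function: a Borel representative, the Jordan parts of
  each gradient component with masses bounded by \<open>V\<close>, and integration by parts against
  bumps. The right side of \<open>gradient\<close> carries no minus sign because differentiating a
  bump of \<open>x - y\<close> in \<open>y\<close> gives a second one.\<close>

locale bv_function =
  fixes u :: "'a::euclidean_space \<Rightarrow> real" and P N :: "'a \<Rightarrow> 'a measure" and V :: real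
  assumes u [measurable]: "u \<in> borel_measurable borel" and int_u: "integrable lborel u"
    and sets_P [measurable_cong]: "\<And>b. sets (P b) = sets borel"
    and sets_N [measurable_cong]: "\<And>b. sets (N b) = sets borel"
    and finite_P: "\<And>b. b \<in> Basis \<Longrightarrow> finite_measure (P b)"
    and finite_N: "\<And>b. b \<in> Basis \<Longrightarrow> finite_measure (N b)"
    and gradient: "\<And>b r x. b \<in> Basis \<Longrightarrow> r > 0 \<Longrightarrow>
      (\<integral>y. u y * bump_deriv r b (x - y) \<partial>lborel) = (\<integral>y. bump r (x - y) \<partial>P b) - (\<integral>y. bump r (x - y) \<partial>N b)"
    and mass: "\<And>b. b \<in> Basis \<Longrightarrow> emeasure (P b) UNIV + emeasure (N b) UNIV \<le> ennreal V"
    and V: "V \<ge> 0"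
begin

lemma integrable_u_mult:
  assumes [measurable]: "g \<in> borel_measurable borel" and "\<And>y. \<bar>g y\<bar> \<le> C"
  shows "integrable lborel (\<lambda>y. u y * g y)"
proof (rule Bochner_Integration.integrable_bound)
  show "integrable lborel (\<lambda>y. C * u y)" using int_u by simp
  show "AE y in lborel. norm (u y * g y) \<le> norm (C * u y)"
  proof (rule AE_I2)
    fix y
    have "\<bar>u y\<bar> * \<bar>g y\<bar> \<le> \<bar>u y\<bar> * \<bar>C\<bar>" using assms(2)[of y] by (intro mult_left_mono) auto
    then show "norm (u y * g y) \<le> norm (C * u y)" by (simp add: abs_mult mult.commute)
  qed
qed measurable

definition bump_convolution :: "real \<Rightarrow> 'a \<Rightarrow> real" where
  "bump_convolution r x = (\<integral>y. u y * bump r (x - y) \<partial>lborel)"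

lemma bump_convolution_measurable [measurable]: "bump_convolution r \<in> borel_measurable borel"
  unfolding bump_convolution_def[abs_def] by measurable

lemma abs_bump_le_one: "\<bar>bump r (x - y :: 'a)\<bar> \<le> 1"
  using bump_nonneg[of r "x - y"] bump_le_one[of r "x - y"] by simp

lemma nn_integral_abs_u: "(\<integral>\<^sup>+y. ennreal \<bar>u y\<bar> \<partial>lborel) < \<infinity>"
  using int_u by (auto simp: integrable_iff_bounded)

lemma nn_integral_bump_convolution:
  assumes "r > 0" shows "(\<integral>\<^sup>+x. ennreal \<bar>bump_convolution r x\<bar> \<partial>lborel) < \<infinity>"
proof -
  have "(\<integral>\<^sup>+x. ennreal \<bar>bump_convolution r x\<bar> \<partial>lborel) \<le> (\<integral>\<^sup>+x. \<integral>\<^sup>+y. ennreal \<bar>u y\<bar> * ennreal (bump r (x - y)) \<partial>lborel \<partial>lborel)"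
  proof (rule nn_integral_mono)
    fix x
    have "ennreal \<bar>bump_convolution r x\<bar> \<le> (\<integral>\<^sup>+y. ennreal (norm (u y * bump r (x - y))) \<partial>lborel)"
      using integral_norm_bound_ennreal[OF integrable_u_mult[of "\<lambda>y. bump r (x - y)" 1]] abs_bump_le_one
      by (simp add: bump_convolution_def)
    then show "ennreal \<bar>bump_convolution r x\<bar> \<le> (\<integral>\<^sup>+y. ennreal \<bar>u y\<bar> * ennreal (bump r (x - y)) \<partial>lborel)"
      by (simp add: abs_mult ennreal_mult bump_nonneg)
  qed
  also have "\<dots> = (\<integral>\<^sup>+y. \<integral>\<^sup>+x. ennreal \<bar>u y\<bar> * ennreal (bump r (x - y)) \<partial>lborel \<partial>lborel)"
    by (rule lborel_pair.Fubini') measurable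
  also have "\<dots> = (\<integral>\<^sup>+y. ennreal \<bar>u y\<bar> * ennreal (bump_mass TYPE('a) r) \<partial>lborel)"
    using nn_integral_bump_translate(1)[where 'a = 'a, OF assms, of 0]
    by (simp add: nn_integral_cmult)
  also have "\<dots> < \<infinity>"
    using nn_integral_abs_u by (simp add: nn_integral_multc ennreal_mult_less_top)
  finally show ?thesis .
qed

text \<open>The increment of the bump is the integral of its derivative along the segment. Fubini
  brings the integral against \<open>u\<close> inside, where integration by parts replaces it by
  averages of the two gradient parts.\<close>

lemma bump_convolution_difference_pointwise:
  assumes r: "r > 0"
  shows "ennreal \<bar>bump_convolution r (x + v) - bump_convolution r x\<bar> \<le> (\<Sum>b\<in>Basis. ennreal \<bar>v \<bullet> b\<bar> *
    (\<integral>\<^sup>+t. indicator {0..1} t * ((\<integral>\<^sup>+y. ennreal (bump r (x + t *\<^sub>R v - y)) \<partial>P b) + (\<integral>\<^sup>+y. ennreal (bump r (x + t *\<^sub>R v - y)) \<partial>N b)) \<partial>lborel))"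
proof -
  define H where "H b t = (\<integral>y. u y * bump_deriv r b (x + t *\<^sub>R v - y) \<partial>lborel)" for b t
  have ftc: "bump r (x + v - y) - bump r (x - y) = (\<integral>t. bump_deriv r v (x + t *\<^sub>R v - y) * indicator {0..1} t \<partial>lborel)" for y
  proof -
    have "(\<integral>t. bump_deriv r v (x - y + t *\<^sub>R v) * indicator {0..1} t \<partial>lborel) = bump r (x - y + 1 *\<^sub>R v) - bump r (x - y + 0 *\<^sub>R v)"
    proof (rule integral_FTC_Icc_real)
      show "isCont (\<lambda>t. bump_deriv r v (x - y + t *\<^sub>R v)) t" for t :: real
        by (intro isCont_o2[OF _ isCont_bump_deriv]) simp
    qed (auto intro!: bump_line_has_derivative)
    then show ?thesis by (simp add: algebra_simps)
  qed
  have "bump_convolution r (x + v) - bump_convolution r x = (\<integral>y. u y * bump r (x + v - y) - u y * bump r (x - y) \<partial>lborel)"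
    unfolding bump_convolution_def using abs_bump_le_one
    by (intro Bochner_Integration.integral_diff[symmetric] integrable_u_mult[where C = 1]) auto
  also have "\<dots> = (\<integral>y. (\<integral>t. u y * (bump_deriv r v (x + t *\<^sub>R v - y) * indicator {0..1} t) \<partial>lborel) \<partial>lborel)"
    by (simp add: ftc flip: right_diff_distrib)
  also have "\<dots> = (\<integral>t. (\<integral>y. u y * (bump_deriv r v (x + t *\<^sub>R v - y) * indicator {0..1} t) \<partial>lborel) \<partial>lborel)"
  proof (rule Fubini_integral_nn(1))
    have "(\<integral>\<^sup>+y. \<integral>\<^sup>+t. ennreal \<bar>u y * (bump_deriv r v (x + t *\<^sub>R v - y) * indicator {0..1} t)\<bar> \<partial>lborel \<partial>lborel)
      \<le> (\<integral>\<^sup>+y. \<integral>\<^sup>+t. ennreal (\<bar>u y\<bar> * (4 / r * norm v)) * indicator {0..1::real} t \<partial>lborel \<partial>lborel)"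
    proof (intro nn_integral_mono)
      fix y t
      have "\<bar>u y\<bar> * \<bar>bump_deriv r v (x + t *\<^sub>R v - y)\<bar> \<le> \<bar>u y\<bar> * (4 / r * norm v)"
        by (intro mult_left_mono abs_bump_deriv_le_norm r) auto
      then have "ennreal \<bar>u y * bump_deriv r v (x + t *\<^sub>R v - y)\<bar> \<le> ennreal (\<bar>u y\<bar> * (4 / r * norm v))"
        unfolding abs_mult by (rule ennreal_leI)
      then show "ennreal \<bar>u y * (bump_deriv r v (x + t *\<^sub>R v - y) * indicator {0..1} t)\<bar>
        \<le> ennreal (\<bar>u y\<bar> * (4 / r * norm v)) * indicator {0..1::real} t"
        by (cases "t \<in> {0..1}") simp_all
    qed
    also have "\<dots> = (\<integral>\<^sup>+y. ennreal (4 / r * norm v) * ennreal \<bar>u y\<bar> \<partial>lborel)"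
      using r by (subst nn_integral_cmult_indicator) (auto simp: ennreal_mult[symmetric] mult_ac)
    also have "\<dots> < \<infinity>"
      using nn_integral_abs_u by (simp add: nn_integral_cmult ennreal_mult_less_top)
    finally show "(\<integral>\<^sup>+y. \<integral>\<^sup>+t. ennreal \<bar>u y * (bump_deriv r v (x + t *\<^sub>R v - y) * indicator {0..1} t)\<bar> \<partial>lborel \<partial>lborel) < \<infinity>" .
  qed (auto simp: lborel.sigma_finite_measure_axioms)
  also have "\<dots> = (\<integral>t. indicator {0..1} t * (\<Sum>b\<in>Basis. (v \<bullet> b) * H b t) \<partial>lborel)"
  proof (rule Bochner_Integration.integral_cong[OF refl])
    fix t :: real
    have "(\<integral>y. u y * (bump_deriv r v (x + t *\<^sub>R v - y) * indicator {0..1} t) \<partial>lborel)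
      = indicator {0..1} t * (\<integral>y. (\<Sum>b\<in>Basis. (v \<bullet> b) * (u y * bump_deriv r b (x + t *\<^sub>R v - y))) \<partial>lborel)"
      by (subst bump_deriv_sum_Basis) (simp add: sum_distrib_left mult_ac flip: Bochner_Integration.integral_mult_right_zero)
    also have "(\<integral>y. (\<Sum>b\<in>Basis. (v \<bullet> b) * (u y * bump_deriv r b (x + t *\<^sub>R v - y))) \<partial>lborel) = (\<Sum>b\<in>Basis. (v \<bullet> b) * H b t)"
      unfolding H_def
      by (subst Bochner_Integration.integral_sum) (auto intro!: integrable_u_mult[where C = "4 / r"] bump_deriv_le[OF r])
    finally show "(\<integral>y. u y * (bump_deriv r v (x + t *\<^sub>R v - y) * indicator {0..1} t) \<partial>lborel)
      = indicator {0..1} t * (\<Sum>b\<in>Basis. (v \<bullet> b) * H b t)" .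
  qed
  \<comment> \<open>Without integrability the Bochner integral is 0 and the bound is trivial; both
    cases are covered.\<close>
  finally have "ennreal \<bar>bump_convolution r (x + v) - bump_convolution r x\<bar> \<le> (\<integral>\<^sup>+t. ennreal (norm (indicator {0..1} t * (\<Sum>b\<in>Basis. (v \<bullet> b) * H b t))) \<partial>lborel)"
    using integral_norm_bound_ennreal[of lborel "\<lambda>t. indicator {0..1} t * (\<Sum>b\<in>Basis. (v \<bullet> b) * H b t)"]
    by (cases "integrable lborel (\<lambda>t. indicator {0..1} t * (\<Sum>b\<in>Basis. (v \<bullet> b) * H b t))")
       (auto simp: not_integrable_integral_eq)
  also have "\<dots> \<le> (\<integral>\<^sup>+t. (\<Sum>b\<in>Basis. ennreal \<bar>v \<bullet> b\<bar> * (indicator {0..1} t *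
      ((\<integral>\<^sup>+y. ennreal (bump r (x + t *\<^sub>R v - y)) \<partial>P b) + (\<integral>\<^sup>+y. ennreal (bump r (x + t *\<^sub>R v - y)) \<partial>N b)))) \<partial>lborel)"
  proof (rule nn_integral_mono)
    fix t :: real
    have H: "ennreal \<bar>H b t\<bar> \<le> (\<integral>\<^sup>+y. ennreal (bump r (x + t *\<^sub>R v - y)) \<partial>P b) + (\<integral>\<^sup>+y. ennreal (bump r (x + t *\<^sub>R v - y)) \<partial>N b)"
      if b: "b \<in> Basis" for b
    proof -
      interpret P: finite_measure "P b" by (rule finite_P[OF b])
      interpret N: finite_measure "N b" by (rule finite_N[OF b])
      have "integrable (P b) (\<lambda>y. bump r (x + t *\<^sub>R v - y))" "integrable (N b) (\<lambda>y. bump r (x + t *\<^sub>R v - y))"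
        using abs_bump_le_one by (auto intro!: P.integrable_const_bound[where B = 1] N.integrable_const_bound[where B = 1])
      then have e: "ennreal (\<integral>y. bump r (x + t *\<^sub>R v - y) \<partial>P b) = (\<integral>\<^sup>+y. ennreal (bump r (x + t *\<^sub>R v - y)) \<partial>P b)"
        "ennreal (\<integral>y. bump r (x + t *\<^sub>R v - y) \<partial>N b) = (\<integral>\<^sup>+y. ennreal (bump r (x + t *\<^sub>R v - y)) \<partial>N b)"
        by (auto intro!: nn_integral_eq_integral[symmetric] simp: bump_nonneg)
      have nn: "0 \<le> (\<integral>y. bump r (x + t *\<^sub>R v - y) \<partial>P b)" "0 \<le> (\<integral>y. bump r (x + t *\<^sub>R v - y) \<partial>N b)"
        by (auto intro!: Bochner_Integration.integral_nonneg simp: bump_nonneg)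
      have "\<bar>H b t\<bar> \<le> (\<integral>y. bump r (x + t *\<^sub>R v - y) \<partial>P b) + (\<integral>y. bump r (x + t *\<^sub>R v - y) \<partial>N b)"
        unfolding H_def gradient[OF b r] using nn by linarith
      then have "ennreal \<bar>H b t\<bar> \<le> ennreal ((\<integral>y. bump r (x + t *\<^sub>R v - y) \<partial>P b) + (\<integral>y. bump r (x + t *\<^sub>R v - y) \<partial>N b))"
        by (rule ennreal_leI)
      then show ?thesis using nn by (simp add: e)
    qed
    have "ennreal (norm (indicator {0..1} t * (\<Sum>b\<in>Basis. (v \<bullet> b) * H b t))) \<le> indicator {0..1} t * ennreal (\<Sum>b\<in>Basis. \<bar>v \<bullet> b\<bar> * \<bar>H b t\<bar>)"
      by (auto simp: abs_mult[symmetric] split: split_indicator intro!: ennreal_leI sum_abs)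
    also have "\<dots> = (\<Sum>b\<in>Basis. ennreal \<bar>v \<bullet> b\<bar> * (indicator {0..1} t * ennreal \<bar>H b t\<bar>))"
      by (simp add: sum_distrib_left mult_ac ennreal_mult flip: sum_ennreal)
    also have "\<dots> \<le> (\<Sum>b\<in>Basis. ennreal \<bar>v \<bullet> b\<bar> * (indicator {0..1} t *
      ((\<integral>\<^sup>+y. ennreal (bump r (x + t *\<^sub>R v - y)) \<partial>P b) + (\<integral>\<^sup>+y. ennreal (bump r (x + t *\<^sub>R v - y)) \<partial>N b))))"
      by (intro sum_mono mult_left_mono H) auto
    finally show "ennreal (norm (indicator {0..1} t * (\<Sum>b\<in>Basis. (v \<bullet> b) * H b t))) \<le> \<dots>" .
  qed
  also have "\<dots> = (\<Sum>b\<in>Basis. ennreal \<bar>v \<bullet> b\<bar> *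
    (\<integral>\<^sup>+t. indicator {0..1} t * ((\<integral>\<^sup>+y. ennreal (bump r (x + t *\<^sub>R v - y)) \<partial>P b) + (\<integral>\<^sup>+y. ennreal (bump r (x + t *\<^sub>R v - y)) \<partial>N b)) \<partial>lborel))"
  proof -
    have [measurable]: "(\<lambda>t. \<integral>\<^sup>+y. ennreal (bump r (x + t *\<^sub>R v - y)) \<partial>P b) \<in> borel_measurable borel"
      "(\<lambda>t. \<integral>\<^sup>+y. ennreal (bump r (x + t *\<^sub>R v - y)) \<partial>N b) \<in> borel_measurable borel" if b: "b \<in> Basis" for b
    proof -
      interpret P: finite_measure "P b" by (rule finite_P[OF b])
      interpret N: finite_measure "N b" by (rule finite_N[OF b])
      show "(\<lambda>t. \<integral>\<^sup>+y. ennreal (bump r (x + t *\<^sub>R v - y)) \<partial>P b) \<in> borel_measurable borel"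
      "(\<lambda>t. \<integral>\<^sup>+y. ennreal (bump r (x + t *\<^sub>R v - y)) \<partial>N b) \<in> borel_measurable borel" by measurable
    qed
    show ?thesis
      by (subst nn_integral_sum) (auto intro!: sum.cong nn_integral_cmult)
  qed
  finally show ?thesis .
qed

text \<open>The discrete form of the bound of the L1 modulus of continuity by the variation. The
  factor DIM('a) comes from treating the components separately.\<close>

lemma bump_convolution_difference:
  assumes r: "r > 0"
  shows "(\<integral>\<^sup>+x. ennreal \<bar>bump_convolution r (x + v) - bump_convolution r x\<bar> \<partial>lborel) \<le> ennreal (bump_mass TYPE('a) r * (DIM('a) * norm v * V))"
proof -
  define T where "T \<mu> = (\<lambda>x. \<integral>\<^sup>+t. indicator {0..1} t * (\<integral>\<^sup>+y. ennreal (bump r (x + t *\<^sub>R v - y)) \<partial>\<mu>) \<partial>lborel)" for \<mu> :: "'a measure"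
  have T_meas: "T \<mu> \<in> borel_measurable borel" if "finite_measure \<mu>" and [measurable_cong]: "sets \<mu> = sets borel" for \<mu>
  proof -
    interpret finite_measure \<mu> by fact
    show ?thesis unfolding T_def by measurable
  qed
  have [measurable]: "T (P b) \<in> borel_measurable borel" "T (N b) \<in> borel_measurable borel" if "b \<in> Basis" for b
    using that by (auto intro!: T_meas finite_P finite_N sets_P sets_N)
  have split: "(\<integral>\<^sup>+t. indicator {0..1} t * ((\<integral>\<^sup>+y. ennreal (bump r (x + t *\<^sub>R v - y)) \<partial>P b) + (\<integral>\<^sup>+y. ennreal (bump r (x + t *\<^sub>R v - y)) \<partial>N b)) \<partial>lborel)
    = T (P b) x + T (N b) x" if b: "b \<in> Basis" for b x
  proof -
    interpret P: finite_measure "P b" by (rule finite_P[OF b])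
    interpret N: finite_measure "N b" by (rule finite_N[OF b])
    show ?thesis unfolding T_def distrib_left by (rule nn_integral_add) measurable
  qed
  have "(\<integral>\<^sup>+x. ennreal \<bar>bump_convolution r (x + v) - bump_convolution r x\<bar> \<partial>lborel) \<le> (\<integral>\<^sup>+x. (\<Sum>b\<in>Basis. ennreal \<bar>v \<bullet> b\<bar> * (T (P b) x + T (N b) x)) \<partial>lborel)"
    using bump_convolution_difference_pointwise[OF r, of _ v] by (intro nn_integral_mono) (simp add: split)
  also have "\<dots> = (\<Sum>b\<in>Basis. \<integral>\<^sup>+x. ennreal \<bar>v \<bullet> b\<bar> * (T (P b) x + T (N b) x) \<partial>lborel)"
    by (rule nn_integral_sum) measurable
  also have "\<dots> = (\<Sum>b\<in>Basis. ennreal \<bar>v \<bullet> b\<bar> * ((\<integral>\<^sup>+x. T (P b) x \<partial>lborel) + (\<integral>\<^sup>+x. T (N b) x \<partial>lborel)))"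
    by (intro sum.cong refl) (simp add: nn_integral_cmult nn_integral_add)
  also have "\<dots> \<le> (\<Sum>b\<in>Basis. ennreal \<bar>v \<bullet> b\<bar> * ennreal (bump_mass TYPE('a) r * V))"
  proof (intro sum_mono mult_left_mono)
    fix b :: 'a assume b: "b \<in> Basis"
    have "(\<integral>\<^sup>+x. T (P b) x \<partial>lborel) + (\<integral>\<^sup>+x. T (N b) x \<partial>lborel)
      = ennreal (bump_mass TYPE('a) r) * (emeasure (P b) UNIV + emeasure (N b) UNIV)"
      unfolding T_def by (simp add: nn_integral_bump_line finite_P finite_N sets_P sets_N b r distrib_left)
    also have "\<dots> \<le> ennreal (bump_mass TYPE('a) r) * ennreal V"
      by (intro mult_left_mono mass b) simp
    also have "\<dots> = ennreal (bump_mass TYPE('a) r * V)"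
      using V bump_mass_pos[OF r, where 'a = 'a] by (simp add: ennreal_mult)
    finally show "(\<integral>\<^sup>+x. T (P b) x \<partial>lborel) + (\<integral>\<^sup>+x. T (N b) x \<partial>lborel) \<le> ennreal (bump_mass TYPE('a) r * V)" .
  qed simp
  also have "\<dots> = ennreal ((\<Sum>b\<in>Basis. \<bar>v \<bullet> b\<bar>) * (bump_mass TYPE('a) r * V))"
    using V bump_mass_pos[OF r, where 'a = 'a]
    by (simp add: ennreal_mult sum_nonneg flip: sum_distrib_right sum_ennreal)
  also have "\<dots> \<le> ennreal (DIM('a) * norm v * (bump_mass TYPE('a) r * V))"
    using V bump_mass_pos[OF r, where 'a = 'a] sum_abs_inner_Basis_le[of v]
    by (intro ennreal_leI mult_right_mono) auto
  finally show ?thesis by (simp add: mult_ac)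
qed

end

lemma ennreal_abs_divide:
  assumes "B > 0" shows "ennreal \<bar>a / B\<bar> = ennreal (1 / B) * ennreal \<bar>a\<bar>"
  using assms by (subst ennreal_mult[symmetric]) auto

context bv_function
begin

definition bump_gradient :: "real \<Rightarrow> 'a \<Rightarrow> 'a \<Rightarrow> real" where
  "bump_gradient r b x = (\<integral>y. u y * bump_deriv r b (x - y) \<partial>lborel)"

lemma bump_gradient_measurable [measurable (raw)]:
  assumes [measurable]: "f \<in> borel_measurable M" "g \<in> borel_measurable M"
  shows "(\<lambda>x. bump_gradient (f x) b (g x)) \<in> borel_measurable M"
  unfolding bump_gradient_def by measurable

definition mollified :: "real \<Rightarrow> 'a \<Rightarrow> real" where
  "mollified \<epsilon> y = bump_convolution \<epsilon> y / bump_mass TYPE('a) \<epsilon>"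

lemma mollified_measurable [measurable]: "mollified \<epsilon> \<in> borel_measurable borel"
  unfolding mollified_def[abs_def] by measurable

lemma nn_integral_mollified:
  assumes "\<epsilon> > 0" shows "(\<integral>\<^sup>+y. ennreal \<bar>mollified \<epsilon> y\<bar> \<partial>lborel) < \<infinity>"
proof -
  have B: "bump_mass TYPE('a) \<epsilon> > 0" by (rule bump_mass_pos[OF assms])
  have "(\<integral>\<^sup>+y. ennreal \<bar>mollified \<epsilon> y\<bar> \<partial>lborel) = (\<integral>\<^sup>+y. ennreal (1 / bump_mass TYPE('a) \<epsilon>) * ennreal \<bar>bump_convolution \<epsilon> y\<bar> \<partial>lborel)"
    unfolding mollified_def ennreal_abs_divide[OF B] ..
  also have "\<dots> < \<infinity>"
    using nn_integral_bump_convolution[OF assms] by (simp add: nn_integral_cmult ennreal_mult_less_top)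
  finally show ?thesis .
qed

lemma mollified_difference:
  assumes "\<epsilon> > 0"
  shows "(\<integral>\<^sup>+y. ennreal \<bar>mollified \<epsilon> (y + v) - mollified \<epsilon> y\<bar> \<partial>lborel) \<le> ennreal (DIM('a) * norm v * V)"
proof -
  have B: "bump_mass TYPE('a) \<epsilon> > 0" by (rule bump_mass_pos[OF assms])
  have "(\<integral>\<^sup>+y. ennreal \<bar>mollified \<epsilon> (y + v) - mollified \<epsilon> y\<bar> \<partial>lborel)
    = (\<integral>\<^sup>+y. ennreal (1 / bump_mass TYPE('a) \<epsilon>) * ennreal \<bar>bump_convolution \<epsilon> (y + v) - bump_convolution \<epsilon> y\<bar> \<partial>lborel)"
    unfolding mollified_def diff_divide_distrib[symmetric] ennreal_abs_divide[OF B] ..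
  also have "\<dots> = ennreal (1 / bump_mass TYPE('a) \<epsilon>) * (\<integral>\<^sup>+y. ennreal \<bar>bump_convolution \<epsilon> (y + v) - bump_convolution \<epsilon> y\<bar> \<partial>lborel)"
    by (rule nn_integral_cmult) measurable
  also have "\<dots> \<le> ennreal (1 / bump_mass TYPE('a) \<epsilon>) * ennreal (bump_mass TYPE('a) \<epsilon> * (DIM('a) * norm v * V))"
    by (intro mult_left_mono bump_convolution_difference assms) simp
  also have "\<dots> = ennreal (DIM('a) * norm v * V)"
    using B V by (simp flip: ennreal_mult)
  finally show ?thesis .
qed

text \<open>By Fubini the mollifier moves from \<open>u\<close> to the continuous kernel
  \<open>bump_deriv\<close>. Its averages converge pointwise and stay below 4/r, so dominated
  convergence applies with an integrable multiple of the absolute value of \<open>u\<close>.\<close>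

lemma mollified_bump_deriv_tendsto:
  assumes \<epsilon>: "\<epsilon> \<longlonglongrightarrow> 0" "\<And>n. \<epsilon> n > 0" and r: "r > 0" and b: "norm b \<le> 1"
  shows "(\<lambda>n. \<integral>y. mollified (\<epsilon> n) y * bump_deriv r b (x - y) \<partial>lborel) \<longlonglongrightarrow> bump_gradient r b x"
proof -
  define B where "B n = bump_mass TYPE('a) (\<epsilon> n)" for n
  have B: "B n > 0" for n unfolding B_def by (rule bump_mass_pos[OF \<epsilon>(2)])
  define I where "I n z = (\<integral>y. bump (\<epsilon> n) (y - z) * bump_deriv r b (x - y) \<partial>lborel) / B n" for n z
  have [measurable]: "I n \<in> borel_measurable borel" for n unfolding I_def by measurable
  have int_bump: "integrable lborel (\<lambda>y. bump (\<epsilon> n) (y - z :: 'a))" for n z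
    using nn_integral_bump_translate(1)[where 'a = 'a and c = 0 and y = z, OF \<epsilon>(2)[of n]]
    by (intro integrableI_bounded) (auto simp: bump_nonneg)
  have int_bump': "integrable lborel (\<lambda>y. bump (\<epsilon> n) (y - z) * bump_deriv r b (x - y))" for n z
  proof (rule Bochner_Integration.integrable_bound)
    show "integrable lborel (\<lambda>y. 4 / r * bump (\<epsilon> n) (y - z))" using int_bump by simp
    show "AE y in lborel. norm (bump (\<epsilon> n) (y - z) * bump_deriv r b (x - y)) \<le> norm (4 / r * bump (\<epsilon> n) (y - z))"
    proof (rule AE_I2)
      fix y
      have "bump (\<epsilon> n) (y - z) * \<bar>bump_deriv r b (x - y)\<bar> \<le> bump (\<epsilon> n) (y - z) * (4 / r)"
        by (intro mult_left_mono bump_deriv_le r b bump_nonneg)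
      then show "norm (bump (\<epsilon> n) (y - z) * bump_deriv r b (x - y)) \<le> norm (4 / r * bump (\<epsilon> n) (y - z))"
        using r by (simp add: abs_mult bump_nonneg mult.commute)
    qed
  qed measurable
  have mass: "(\<integral>y. bump (\<epsilon> n) (y - z :: 'a) \<partial>lborel) = B n" for n z
    unfolding B_def by (rule integral_bump_translate)
  \<comment> \<open>Used twice: with \<open>c = 0\<close> it bounds the averages, and with
    \<open>c\<close> the value of the kernel at the centre it proves their convergence.\<close>
  have dev: "\<bar>I n z - c\<bar> \<le> e" if e: "\<And>y. norm (y - z) < \<epsilon> n \<Longrightarrow> \<bar>bump_deriv r b (x - y) - c\<bar> \<le> e" for n z c e
  proof -
    have "I n z - c = ((\<integral>y. bump (\<epsilon> n) (y - z) * bump_deriv r b (x - y) \<partial>lborel) - (\<integral>y. bump (\<epsilon> n) (y - z) * c \<partial>lborel)) / B n"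
      using B[of n] by (simp add: I_def mass diff_divide_distrib)
    also have "\<dots> = (\<integral>y. bump (\<epsilon> n) (y - z) * (bump_deriv r b (x - y) - c) \<partial>lborel) / B n"
      using int_bump int_bump' by (simp add: right_diff_distrib)
    finally have "\<bar>I n z - c\<bar> = \<bar>\<integral>y. bump (\<epsilon> n) (y - z) * (bump_deriv r b (x - y) - c) \<partial>lborel\<bar> / B n"
      using B[of n] by simp
    also have "\<bar>\<integral>y. bump (\<epsilon> n) (y - z) * (bump_deriv r b (x - y) - c) \<partial>lborel\<bar> \<le> (\<integral>y. bump (\<epsilon> n) (y - z) * e \<partial>lborel)"
    proof (rule integral_abs_bound_integral)
      show "integrable lborel (\<lambda>y. bump (\<epsilon> n) (y - z) * (bump_deriv r b (x - y) - c))"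
        unfolding right_diff_distrib using int_bump int_bump' by simp
      show "integrable lborel (\<lambda>y. bump (\<epsilon> n) (y - z) * e)" using int_bump by simp
      fix y
      show "\<bar>bump (\<epsilon> n) (y - z) * (bump_deriv r b (x - y) - c)\<bar> \<le> bump (\<epsilon> n) (y - z) * e"
      proof (cases "norm (y - z) < \<epsilon> n")
        case True
        then show ?thesis using e by (simp add: abs_mult bump_nonneg mult_left_mono)
      next
        case False
        then show ?thesis using bump_eq_0[OF \<epsilon>(2)[of n], of "y - z"] by simp
      qed
    qed
    also have "(\<integral>y. bump (\<epsilon> n) (y - z) * e \<partial>lborel) / B n = e"
      using B[of n] by (simp add: mass)
    finally show ?thesis using B[of n] by (simp add: divide_right_mono)
  qed
  have I_bound: "\<bar>I n z\<bar> \<le> 4 / r" for n z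
    using dev[of z n 0 "4 / r"] bump_deriv_le[OF r b] by simp
  have I_tendsto: "(\<lambda>n. I n z) \<longlonglongrightarrow> bump_deriv r b (x - z)" for z
  proof (rule LIMSEQ_I)
    fix e :: real assume e: "e > 0"
    have "isCont (bump_deriv r b) (x - z)" by (rule isCont_bump_deriv)
    then obtain \<delta> where \<delta>: "\<delta> > 0" "\<And>w. norm (w - (x - z)) < \<delta> \<Longrightarrow> norm (bump_deriv r b w - bump_deriv r b (x - z)) < e / 2"
      using e unfolding isCont_def LIM_eq by (metis half_gt_zero diff_self norm_zero)
    obtain n0 where n0: "\<And>n. n \<ge> n0 \<Longrightarrow> norm (\<epsilon> n - 0) < \<delta>" using LIMSEQ_D[OF \<epsilon>(1) \<delta>(1)] by blast
    show "\<exists>n0. \<forall>n\<ge>n0. norm (I n z - bump_deriv r b (x - z)) < e"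
    proof (intro exI allI impI)
      fix n assume "n \<ge> n0"
      then have "\<epsilon> n < \<delta>" using n0[of n] by simp
      then have "\<bar>I n z - bump_deriv r b (x - z)\<bar> \<le> e / 2"
      proof (intro dev)
        fix y assume "norm (y - z) < \<epsilon> n"
        then have "norm ((x - y) - (x - z)) < \<delta>" using \<open>\<epsilon> n < \<delta>\<close> by (simp add: norm_minus_commute)
        from \<delta>(2)[OF this] show "\<bar>bump_deriv r b (x - y) - bump_deriv r b (x - z)\<bar> \<le> e / 2" by simp
      qed
      then show "norm (I n z - bump_deriv r b (x - z)) < e" using e by simp
    qed
  qed
  have eq: "(\<integral>y. mollified (\<epsilon> n) y * bump_deriv r b (x - y) \<partial>lborel) = (\<integral>z. u z * I n z \<partial>lborel)" for n
  proof -
    have "(\<integral>y. mollified (\<epsilon> n) y * bump_deriv r b (x - y) \<partial>lborel)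
      = (\<integral>y. (\<integral>z. u z * bump (\<epsilon> n) (y - z) \<partial>lborel) * bump_deriv r b (x - y) \<partial>lborel) / B n"
      by (simp add: mollified_def bump_convolution_def B_def)
    also have "(\<integral>y. (\<integral>z. u z * bump (\<epsilon> n) (y - z) \<partial>lborel) * bump_deriv r b (x - y) \<partial>lborel)
      = (\<integral>y. (\<integral>z. u z * (bump (\<epsilon> n) (y - z) * bump_deriv r b (x - y)) \<partial>lborel) \<partial>lborel)"
      by (simp add: mult.assoc flip: Bochner_Integration.integral_mult_left_zero)
    also have "\<dots> = (\<integral>z. (\<integral>y. u z * (bump (\<epsilon> n) (y - z) * bump_deriv r b (x - y)) \<partial>lborel) \<partial>lborel)"
    proof (rule Fubini_integral_nn(1)[symmetric])
      have "(\<integral>\<^sup>+z. \<integral>\<^sup>+y. ennreal \<bar>u z * (bump (\<epsilon> n) (y - z) * bump_deriv r b (x - y))\<bar> \<partial>lborel \<partial>lborel)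
        \<le> (\<integral>\<^sup>+z. \<integral>\<^sup>+y. ennreal (\<bar>u z\<bar> * (4 / r)) * ennreal (bump (\<epsilon> n) (y - z)) \<partial>lborel \<partial>lborel)"
      proof (intro nn_integral_mono)
        fix z y
        have "\<bar>u z\<bar> * bump (\<epsilon> n) (y - z) * \<bar>bump_deriv r b (x - y)\<bar> \<le> \<bar>u z\<bar> * bump (\<epsilon> n) (y - z) * (4 / r)"
          by (intro mult_left_mono bump_deriv_le r b mult_nonneg_nonneg bump_nonneg) auto
        then have "\<bar>u z * (bump (\<epsilon> n) (y - z) * bump_deriv r b (x - y))\<bar> \<le> \<bar>u z\<bar> * (4 / r) * bump (\<epsilon> n) (y - z)"
          by (simp add: abs_mult bump_nonneg mult_ac)
        then show "ennreal \<bar>u z * (bump (\<epsilon> n) (y - z) * bump_deriv r b (x - y))\<bar>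
          \<le> ennreal (\<bar>u z\<bar> * (4 / r)) * ennreal (bump (\<epsilon> n) (y - z))"
          using r by (simp add: bump_nonneg ennreal_leI flip: ennreal_mult)
      qed
      also have "\<dots> = (\<integral>\<^sup>+z. (ennreal (4 / r) * ennreal (B n)) * ennreal \<bar>u z\<bar> \<partial>lborel)"
      proof (rule nn_integral_cong)
        fix z
        have "(\<integral>\<^sup>+y. ennreal (\<bar>u z\<bar> * (4 / r)) * ennreal (bump (\<epsilon> n) (y - z)) \<partial>lborel) = ennreal (\<bar>u z\<bar> * (4 / r)) * ennreal (B n)"
          using nn_integral_bump_translate(1)[where 'a = 'a and c = 0, OF \<epsilon>(2)[of n]]
          by (subst nn_integral_cmult) (auto simp: B_def)
        also have "\<dots> = (ennreal (4 / r) * ennreal (B n)) * ennreal \<bar>u z\<bar>"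
          using r B[of n] by (simp add: mult_ac flip: ennreal_mult)
        finally show "(\<integral>\<^sup>+y. ennreal (\<bar>u z\<bar> * (4 / r)) * ennreal (bump (\<epsilon> n) (y - z)) \<partial>lborel) = (ennreal (4 / r) * ennreal (B n)) * ennreal \<bar>u z\<bar>" .
      qed
      also have "\<dots> < \<infinity>"
        using nn_integral_abs_u by (simp add: nn_integral_cmult ennreal_mult_less_top)
      finally show "(\<integral>\<^sup>+z. \<integral>\<^sup>+y. ennreal \<bar>u z * (bump (\<epsilon> n) (y - z) * bump_deriv r b (x - y))\<bar> \<partial>lborel \<partial>lborel) < \<infinity>" .
    qed (auto simp: lborel.sigma_finite_measure_axioms)
    also have "\<dots> / B n = (\<integral>z. u z * I n z \<partial>lborel)"
      by (simp add: I_def)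
    finally show ?thesis .
  qed
  have "(\<lambda>n. \<integral>z. u z * I n z \<partial>lborel) \<longlonglongrightarrow> (\<integral>z. u z * bump_deriv r b (x - z) \<partial>lborel)"
  proof (rule integral_dominated_convergence[where w = "\<lambda>z. \<bar>u z\<bar> * (4 / r)"])
    show "integrable lborel (\<lambda>z. \<bar>u z\<bar> * (4 / r))" using int_u by simp
    show "AE z in lborel. (\<lambda>n. u z * I n z) \<longlonglongrightarrow> u z * bump_deriv r b (x - z)"
      by (intro AE_I2 tendsto_mult tendsto_const I_tendsto)
    show "AE z in lborel. norm (u z * I n z) \<le> \<bar>u z\<bar> * (4 / r)" for n
      using I_bound by (intro AE_I2) (simp add: abs_mult mult_left_mono del: times_divide_eq_right)
  qed measurable
  then show ?thesis by (simp add: eq bump_gradient_def)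
qed

end

section \<open>The Riesz kernel as a superposition of bumps\<close>

definition riesz_bump_const :: "real \<Rightarrow> ennreal" where
  "riesz_bump_const p = (\<integral>\<^sup>+s. indicator {0<..} s * ennreal (s powr (p - 1) * exp_inv 0 (1 - 1 / s\<^sup>2)) \<partial>lborel)"

text \<open>The constant is the superposition evaluated at a unit vector. Bumps of radius at most 1
  vanish there, and for larger radii \<open>p < 0\<close> gives convergence.\<close>

lemma riesz_bump_const_finite:
  assumes "p < 0" shows "riesz_bump_const p < \<infinity>"
proof -
  have "riesz_bump_const p \<le> (\<integral>\<^sup>+s. indicator {1<..} s * ennreal (s powr (p - 1)) \<partial>lborel)"
    unfolding riesz_bump_const_def
  proof (rule nn_integral_mono)
    fix s :: real
    show "indicator {0<..} s * ennreal (s powr (p - 1) * exp_inv 0 (1 - 1 / s\<^sup>2)) \<le> indicator {1<..} s * ennreal (s powr (p - 1))"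
    proof (cases "s > 1")
      case True
      have "exp_inv 0 (1 - 1 / s\<^sup>2) \<le> 1" using exp_inv_le[of 0 _ 0] by simp
      then have "s powr (p - 1) * exp_inv 0 (1 - 1 / s\<^sup>2) \<le> s powr (p - 1) * 1" by (intro mult_left_mono) auto
      then show ?thesis using True by (simp add: ennreal_leI)
    next
      case False
      then have "s > 0 \<Longrightarrow> 1 \<le> 1 / s\<^sup>2" by (simp add: field_simps power_le_one)
      then have "s > 0 \<Longrightarrow> exp_inv 0 (1 - 1 / s\<^sup>2) = 0" by (simp add: exp_inv_def)
      then show ?thesis using False by (cases "s > 0") auto
    qed
  qed
  also have "\<dots> < \<infinity>"
    using assms nn_integral_powr_greaterThan[of "p - 1" 1] by simp
  finally show ?thesis .
qed

lemma riesz_bump_const_pos: "riesz_bump_const p > 0"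
proof (rule ccontr)
  assume "\<not> ?thesis"
  then have "AE s in lborel. indicator {0<..} s * ennreal (s powr (p - 1) * exp_inv 0 (1 - 1 / s\<^sup>2)) = 0"
    unfolding riesz_bump_const_def by (subst (asm) not_gr_zero, subst (asm) nn_integral_0_iff_AE) auto
  then have "AE s in lborel. s \<notin> {1<..<2::real}"
  proof eventually_elim
    case (elim s)
    show ?case
    proof
      assume s: "s \<in> {1<..<2}"
      then have "1 / s\<^sup>2 < 1" by (simp add: divide_less_eq one_less_power)
      then have "exp_inv 0 (1 - 1 / s\<^sup>2) > 0" by (simp add: exp_inv_def)
      then show False using elim s by (simp add: ennreal_eq_0_iff mult_le_0_iff)
    qed
  qed
  then have "{1<..<2::real} \<in> null_sets lborel" by (subst AE_iff_null_sets) auto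
  then have "emeasure lborel {1<..<2::real} = 0" by blast
  then show False by simp
qed

text \<open>Substituting r = |z| s reduces to a unit vector and extracts |z| to the power
  \<open>p\<close> by homogeneity.\<close>

lemma norm_powr_eq_nn_integral_bump:
  fixes z :: "'a::euclidean_space"
  assumes "z \<noteq> 0"
  shows "(\<integral>\<^sup>+r. indicator {0<..} r * ennreal (r powr (p - 1) * bump r z) \<partial>lborel) = riesz_bump_const p * ennreal (norm z powr p)"
proof -
  define c where "c = norm z"
  have c: "c > 0" using assms by (simp add: c_def)
  have "(\<integral>\<^sup>+r. indicator {0<..} r * ennreal (r powr (p - 1) * bump r z) \<partial>lborel)
    = ennreal c * (\<integral>\<^sup>+s. indicator {0<..} (0 + c * s) * ennreal ((0 + c * s) powr (p - 1) * bump (0 + c * s) z) \<partial>lborel)"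
    using c by (subst nn_integral_real_affine[where c = c and t = 0]) auto
  also have "(\<integral>\<^sup>+s. indicator {0<..} (0 + c * s) * ennreal ((0 + c * s) powr (p - 1) * bump (0 + c * s) z) \<partial>lborel)
    = (\<integral>\<^sup>+s. ennreal (c powr (p - 1)) * (indicator {0<..} s * ennreal (s powr (p - 1) * exp_inv 0 (1 - 1 / s\<^sup>2))) \<partial>lborel)"
  proof (rule nn_integral_cong)
    fix s :: real
    show "indicator {0<..} (0 + c * s) * ennreal ((0 + c * s) powr (p - 1) * bump (0 + c * s) z)
      = ennreal (c powr (p - 1)) * (indicator {0<..} s * ennreal (s powr (p - 1) * exp_inv 0 (1 - 1 / s\<^sup>2)))"
    proof (cases "s > 0")
      case True
      have "bump (c * s) z = exp_inv 0 (1 - 1 / s\<^sup>2)"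
        using c True by (simp add: bump_def dot_square_norm power_mult_distrib flip: c_def)
      then show ?thesis using True c by (simp add: powr_mult mult.assoc exp_inv_nonneg flip: ennreal_mult)
    next
      case False
      then have "\<not> 0 < c * s" using c by (simp add: zero_less_mult_iff)
      then show ?thesis using False by simp
    qed
  qed
  also have "\<dots> = ennreal (c powr (p - 1)) * riesz_bump_const p"
    unfolding riesz_bump_const_def by (rule nn_integral_cmult) measurable
  also have "ennreal c * (ennreal (c powr (p - 1)) * riesz_bump_const p) = riesz_bump_const p * ennreal (c powr p)"
  proof -
    have "c * c powr (p - 1) = c powr p" using c by (simp add: powr_mult_base)
    then have "ennreal c * ennreal (c powr (p - 1)) = ennreal (c powr p)"
      using c by (simp flip: ennreal_mult)
    then show ?thesis by (metis mult.assoc mult.commute)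
  qed
  finally show ?thesis by (simp add: c_def)
qed

text \<open>Fubini for the superposition, with absolute convergence supplied by integrability of the
  kernel. An atom at \<open>x\<close> must be excluded: for \<open>y = x\<close> the kernel is 0 by
  convention, whereas the superposition of bumps is infinite.\<close>

lemma integral_norm_powr_eq_bump:
  fixes \<mu> :: "'a::euclidean_space measure"
  assumes \<mu>: "finite_measure \<mu>" and sets [measurable_cong]: "sets \<mu> = sets borel" and atom: "emeasure \<mu> {x} = 0"
    and p: "p < 0" and int: "integrable \<mu> (\<lambda>y. norm (x - y) powr p)"
    and c: "riesz_bump_const p = ennreal c" "c > 0"
  shows "c * (\<integral>y. norm (x - y) powr p \<partial>\<mu>) = (\<integral>r. indicator {0<..} r * r powr (p - 1) * (\<integral>y. bump r (x - y) \<partial>\<mu>) \<partial>lborel)"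
    and "integrable lborel (\<lambda>r. indicator {0<..} r * r powr (p - 1) * (\<integral>y. bump r (x - y) \<partial>\<mu>))"
proof -
  interpret finite_measure \<mu> by fact
  define f where "f y r = indicator {0<..} r * (r powr (p - 1) * bump r (x - y))" for y r
  have f0: "f y r \<ge> 0" for y r by (simp add: f_def bump_nonneg)
  have [measurable]: "(\<lambda>(y, r). f y r) \<in> borel_measurable (\<mu> \<Otimes>\<^sub>M lborel)" unfolding f_def by measurable
  have [measurable]: "f y \<in> borel_measurable borel" for y unfolding f_def by measurable
  have "{x} \<in> null_sets \<mu>" using atom by (auto simp: sets)
  then have ne: "AE y in \<mu>. y \<noteq> x" by (rule AE_I'[of "{x}"]) auto
  have nn: "(\<integral>\<^sup>+r. ennreal (f y r) \<partial>lborel) = ennreal (c * norm (x - y) powr p)" if "y \<noteq> x" for y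
  proof -
    have "(\<integral>\<^sup>+r. ennreal (f y r) \<partial>lborel) = (\<integral>\<^sup>+r. indicator {0<..} r * ennreal (r powr (p - 1) * bump r (x - y)) \<partial>lborel)"
      by (intro nn_integral_cong) (auto simp: f_def split: split_indicator)
    then show ?thesis
      using that c by (simp add: norm_powr_eq_nn_integral_bump flip: ennreal_mult)
  qed
  have inner: "(\<integral>r. f y r \<partial>lborel) = c * norm (x - y) powr p" if "y \<noteq> x" for y
    using nn[OF that] c f0 by (subst integral_eq_nn_integral) (auto simp: enn2real_ennreal)
  have fin: "(\<integral>\<^sup>+y. \<integral>\<^sup>+r. ennreal \<bar>f y r\<bar> \<partial>lborel \<partial>\<mu>) < \<infinity>"
  proof -
    have "(\<integral>\<^sup>+y. \<integral>\<^sup>+r. ennreal \<bar>f y r\<bar> \<partial>lborel \<partial>\<mu>) = (\<integral>\<^sup>+y. ennreal (c * norm (x - y) powr p) \<partial>\<mu>)"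
      using ne by (intro nn_integral_cong_AE) (auto simp: f0 nn)
    also have "\<dots> < \<infinity>"
      using int c by (auto simp: integrable_iff_bounded ennreal_mult nn_integral_cmult ennreal_mult_less_top)
    finally show ?thesis .
  qed
  have outer: "(\<integral>y. f y r \<partial>\<mu>) = indicator {0<..} r * r powr (p - 1) * (\<integral>y. bump r (x - y) \<partial>\<mu>)" for r
    by (simp add: f_def mult.assoc)
  note F = Fubini_integral_nn[OF sigma_finite_measure_axioms lborel.sigma_finite_measure_axioms _ fin, simplified outer]
  have "c * (\<integral>y. norm (x - y) powr p \<partial>\<mu>) = (\<integral>y. c * norm (x - y) powr p \<partial>\<mu>)" by simp
  also have "\<dots> = (\<integral>y. (\<integral>r. f y r \<partial>lborel) \<partial>\<mu>)"
    using ne by (intro integral_cong_AE) (auto simp: inner)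
  also have "\<dots> = (\<integral>r. indicator {0<..} r * r powr (p - 1) * (\<integral>y. bump r (x - y) \<partial>\<mu>) \<partial>lborel)"
    by (rule F(1)) measurable
  finally show "c * (\<integral>y. norm (x - y) powr p \<partial>\<mu>) = (\<integral>r. indicator {0<..} r * r powr (p - 1) * (\<integral>y. bump r (x - y) \<partial>\<mu>) \<partial>lborel)" .
  show "integrable lborel (\<lambda>r. indicator {0<..} r * r powr (p - 1) * (\<integral>y. bump r (x - y) \<partial>\<mu>))"
    by (rule F(3)) measurable
qed

subsection \<open>The estimate for gradients\<close>

locale bv_morrey = bv_function u P N V + morrey_measure \<nu> \<alpha> K
  for u :: "'a::euclidean_space \<Rightarrow> real" and P N V and \<nu> :: "'a measure" and \<alpha> K
begin

text \<open>The boxing constant times d (d h) for a mollified increment of length at most d h, times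
  the volume of a ball of radius d h. The powers of h cancel, which is why h can later tend to
  0.\<close>

definition trace_const :: real where
  "trace_const = morrey_const * 2 ^ (DIM('a) + 2) * real DIM('a) ^ (DIM('a) + 2) * unit_ball_vol DIM('a)"

lemma morrey_const_pos: "morrey_const > 0"
  using K K_le_morrey_const by simp

lemma trace_const_nonneg: "trace_const \<ge> 0"
  unfolding trace_const_def using morrey_const_pos by (intro mult_nonneg_nonneg) auto

text \<open>The trace inequality for the absolute value of the mollified function, with
  \<open>weight\<close> as the weight. Writing z = y + v turns its right side into an integral of L1
  increments over |v| <= d h.\<close>

lemma mollified_trace:
  assumes \<epsilon>: "\<epsilon> > 0" and h: "h > 0"
  shows "(\<integral>\<^sup>+y. ennreal \<bar>mollified \<epsilon> y\<bar> * weight \<nu> \<alpha> h y \<partial>lborel) \<le> ennreal (trace_const * V)"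
proof -
  define d where "d = DIM('a)"
  define D where "D = d * h"
  define C where "C = morrey_const * 2 ^ (d + 2) / h ^ (d + 1)"
  have D: "D \<ge> 0" "D > 0" using h by (simp_all add: D_def d_def)
  have C: "C \<ge> 0" using morrey_const_pos h by (simp add: C_def)
  have "(\<integral>\<^sup>+y. ennreal \<bar>mollified \<epsilon> y\<bar> * weight \<nu> \<alpha> h y \<partial>lborel)
    \<le> ennreal C * (\<integral>\<^sup>+y. \<integral>\<^sup>+z. indicator (cball y D) z * ennreal \<bar>\<bar>mollified \<epsilon> y\<bar> - \<bar>mollified \<epsilon> z\<bar>\<bar> \<partial>lborel \<partial>lborel)"
    unfolding C_def D_def d_def
  proof (rule trace_inequality)
    \<comment> \<open>The trace inequality has one constant for the pointwise and the cube bound;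
      \<open>K \<le> morrey_const\<close> lets \<open>morrey_const\<close> serve for both.\<close>
    show "weight \<nu> \<alpha> h y \<le> ennreal (morrey_const / h)" for y
      using weight_le[OF h, of y] K_le_morrey_const h
      by (auto intro!: ennreal_leI divide_right_mono elim!: order_trans)
  qed (use h morrey_const_pos weight_dyadic_cube nn_integral_mollified[OF \<epsilon>] in auto)
  also have "(\<integral>\<^sup>+y. \<integral>\<^sup>+z. indicator (cball y D) z * ennreal \<bar>\<bar>mollified \<epsilon> y\<bar> - \<bar>mollified \<epsilon> z\<bar>\<bar> \<partial>lborel \<partial>lborel)
    \<le> (\<integral>\<^sup>+y. \<integral>\<^sup>+v. indicator (cball 0 D) v * ennreal \<bar>mollified \<epsilon> (y + v) - mollified \<epsilon> y\<bar> \<partial>lborel \<partial>lborel)"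
  proof (rule nn_integral_mono)
    fix y :: 'a
    have "(\<integral>\<^sup>+z. indicator (cball y D) z * ennreal \<bar>\<bar>mollified \<epsilon> y\<bar> - \<bar>mollified \<epsilon> z\<bar>\<bar> \<partial>lborel)
      = (\<integral>\<^sup>+v. indicator (cball y D) (y + v) * ennreal \<bar>\<bar>mollified \<epsilon> y\<bar> - \<bar>mollified \<epsilon> (y + v)\<bar>\<bar> \<partial>lborel)"
      by (rule nn_integral_lborel_translate[symmetric]) measurable
    also have "\<dots> \<le> (\<integral>\<^sup>+v. indicator (cball 0 D) v * ennreal \<bar>mollified \<epsilon> (y + v) - mollified \<epsilon> y\<bar> \<partial>lborel)"
      by (intro nn_integral_mono) (auto simp: dist_norm intro!: ennreal_leI split: split_indicator)
    finally show "(\<integral>\<^sup>+z. indicator (cball y D) z * ennreal \<bar>\<bar>mollified \<epsilon> y\<bar> - \<bar>mollified \<epsilon> z\<bar>\<bar> \<partial>lborel)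
      \<le> (\<integral>\<^sup>+v. indicator (cball 0 D) v * ennreal \<bar>mollified \<epsilon> (y + v) - mollified \<epsilon> y\<bar> \<partial>lborel)" .
  qed
  also have "\<dots> = (\<integral>\<^sup>+v. \<integral>\<^sup>+y. indicator (cball 0 D) v * ennreal \<bar>mollified \<epsilon> (y + v) - mollified \<epsilon> y\<bar> \<partial>lborel \<partial>lborel)"
    by (rule lborel_pair.Fubini') measurable
  also have "\<dots> \<le> (\<integral>\<^sup>+v. ennreal (d * D * V) * indicator (cball 0 D) (v :: 'a) \<partial>lborel)"
  proof (rule nn_integral_mono)
    fix v :: 'a
    show "(\<integral>\<^sup>+y. indicator (cball 0 D) v * ennreal \<bar>mollified \<epsilon> (y + v) - mollified \<epsilon> y\<bar> \<partial>lborel) \<le> ennreal (d * D * V) * indicator (cball 0 D) v"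
    proof (cases "norm v \<le> D")
      case True
      have "(\<integral>\<^sup>+y. ennreal \<bar>mollified \<epsilon> (y + v) - mollified \<epsilon> y\<bar> \<partial>lborel) \<le> ennreal (d * norm v * V)"
        unfolding d_def by (rule mollified_difference[OF \<epsilon>])
      also have "\<dots> \<le> ennreal (d * D * V)"
        using True V by (intro ennreal_leI mult_right_mono mult_left_mono) auto
      finally show ?thesis using True by simp
    qed simp
  qed
  also have "\<dots> = ennreal (d * D * V) * ennreal (unit_ball_vol d * D ^ d)"
    using D by (subst nn_integral_cmult_indicator) (auto simp: emeasure_cball d_def)
  also have "\<dots> = ennreal (d * D * V * (unit_ball_vol d * D ^ d))"
    using D V by (intro ennreal_mult[symmetric]) auto
  finally have "(\<integral>\<^sup>+y. ennreal \<bar>mollified \<epsilon> y\<bar> * weight \<nu> \<alpha> h y \<partial>lborel) \<le> ennreal C * ennreal (d * D * V * (unit_ball_vol d * D ^ d))"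
    by (simp add: mult_left_mono)
  also have "\<dots> = ennreal (C * (d * D * V * (unit_ball_vol d * D ^ d)))"
    using C D V by (intro ennreal_mult[symmetric]) auto
  also have "C * (d * D * V * (unit_ball_vol d * D ^ d)) = trace_const * V"
    using h by (simp add: C_def D_def trace_const_def d_def power_mult_distrib field_simps)
  finally show ?thesis .
qed

text \<open>The derivative of the bump is at most 4/r on the ball of radius \<open>r\<close>, so one
  power of \<open>r\<close> is lost. Tonelli then collects the integrals over \<open>r\<close> and
  \<open>x\<close> into \<open>weight\<close>.\<close>

lemma mollified_potential_bound:
  assumes \<epsilon>: "\<epsilon> > 0" and h: "h > 0" and b: "norm b \<le> 1"
  shows "(\<integral>\<^sup>+x. \<integral>\<^sup>+r. indicator {h<..} r * ennreal (r powr (\<alpha> - DIM('a) - 1) *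
      \<bar>\<integral>y. mollified \<epsilon> y * bump_deriv r b (x - y) \<partial>lborel\<bar>) \<partial>lborel \<partial>\<nu>) \<le> ennreal (4 * trace_const * V)"
proof -
  define a where "a y = ennreal \<bar>mollified \<epsilon> y\<bar>" for y
  define k where "k r = indicator {h<..} r * ennreal (r powr (\<alpha> - DIM('a) - 2))" for r
  have [measurable]: "a \<in> borel_measurable borel" "k \<in> borel_measurable borel"
    unfolding a_def k_def by measurable
  interpret ps: pair_sigma_finite "lborel :: 'a measure" \<nu> ..
  interpret ps': pair_sigma_finite "lborel :: real measure" \<nu> ..
  have "(\<integral>\<^sup>+x. \<integral>\<^sup>+r. indicator {h<..} r * ennreal (r powr (\<alpha> - DIM('a) - 1) *
      \<bar>\<integral>y. mollified \<epsilon> y * bump_deriv r b (x - y) \<partial>lborel\<bar>) \<partial>lborel \<partial>\<nu>)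
    \<le> (\<integral>\<^sup>+x. \<integral>\<^sup>+r. \<integral>\<^sup>+y. 4 * (a y * (k r * in_ball x r y)) \<partial>lborel \<partial>lborel \<partial>\<nu>)"
  proof (intro nn_integral_mono)
    fix x :: 'a and r :: real
    show "indicator {h<..} r * ennreal (r powr (\<alpha> - DIM('a) - 1) * \<bar>\<integral>y. mollified \<epsilon> y * bump_deriv r b (x - y) \<partial>lborel\<bar>)
      \<le> (\<integral>\<^sup>+y. 4 * (a y * (k r * in_ball x r y)) \<partial>lborel)"
    proof (cases "r > h")
      case True
      then have r: "r > 0" using h by simp
      have "ennreal \<bar>\<integral>y. mollified \<epsilon> y * bump_deriv r b (x - y) \<partial>lborel\<bar> \<le> (\<integral>\<^sup>+y. ennreal (norm (mollified \<epsilon> y * bump_deriv r b (x - y))) \<partial>lborel)"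
        using integral_norm_bound_ennreal[of lborel "\<lambda>y. mollified \<epsilon> y * bump_deriv r b (x - y)"]
        by (cases "integrable lborel (\<lambda>y. mollified \<epsilon> y * bump_deriv r b (x - y))") (auto simp: not_integrable_integral_eq)
      also have "\<dots> \<le> (\<integral>\<^sup>+y. ennreal (4 / r) * (a y * in_ball x r y) \<partial>lborel)"
      proof (rule nn_integral_mono)
        fix y
        show "ennreal (norm (mollified \<epsilon> y * bump_deriv r b (x - y))) \<le> ennreal (4 / r) * (a y * in_ball x r y)"
        proof (cases "dist x y < r")
          case True
          have "\<bar>mollified \<epsilon> y\<bar> * \<bar>bump_deriv r b (x - y)\<bar> \<le> \<bar>mollified \<epsilon> y\<bar> * (4 / r)"
            by (intro mult_left_mono bump_deriv_le r b) auto
          then have "ennreal (norm (mollified \<epsilon> y * bump_deriv r b (x - y))) \<le> ennreal ((4 / r) * \<bar>mollified \<epsilon> y\<bar>)"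
            by (intro ennreal_leI) (simp add: abs_mult mult.commute)
          also have "\<dots> = ennreal (4 / r) * (a y * in_ball x r y)"
            unfolding a_def using True r by (subst ennreal_mult) (auto simp: in_ball_def)
          finally show ?thesis .
        next
          case False
          then have "bump_deriv r b (x - y) = 0" using r by (intro bump_deriv_eq_0) (auto simp: dist_norm)
          then show ?thesis by simp
        qed
      qed
      finally have "ennreal (r powr (\<alpha> - DIM('a) - 1)) * ennreal \<bar>\<integral>y. mollified \<epsilon> y * bump_deriv r b (x - y) \<partial>lborel\<bar>
        \<le> ennreal (r powr (\<alpha> - DIM('a) - 1)) * (\<integral>\<^sup>+y. ennreal (4 / r) * (a y * in_ball x r y) \<partial>lborel)"
        by (rule mult_left_mono) simp
      also have "\<dots> = (\<integral>\<^sup>+y. ennreal (r powr (\<alpha> - DIM('a) - 1)) * (ennreal (4 / r) * (a y * in_ball x r y)) \<partial>lborel)"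
        by (rule nn_integral_cmult[symmetric]) measurable
      also have "\<dots> = (\<integral>\<^sup>+y. 4 * (a y * (k r * in_ball x r y)) \<partial>lborel)"
      proof (rule nn_integral_cong)
        fix y
        have "r powr (\<alpha> - DIM('a) - 1) * (4 / r) = 4 * r powr (\<alpha> - DIM('a) - 2)"
          using r powr_mult_base[of r "\<alpha> - DIM('a) - 2"] by (simp add: field_simps)
        then have "ennreal (r powr (\<alpha> - DIM('a) - 1)) * ennreal (4 / r) = 4 * k r"
          using r True by (simp add: k_def ennreal_mult flip: ennreal_mult) (simp add: ennreal_mult)
        then show "ennreal (r powr (\<alpha> - DIM('a) - 1)) * (ennreal (4 / r) * (a y * in_ball x r y)) = 4 * (a y * (k r * in_ball x r y))"
          by (metis mult.assoc mult.commute mult.left_commute)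
      qed
      finally show ?thesis using True by (simp add: ennreal_mult)
    qed simp
  qed
  also have "\<dots> = (\<integral>\<^sup>+x. \<integral>\<^sup>+y. \<integral>\<^sup>+r. 4 * (a y * (k r * in_ball x r y)) \<partial>lborel \<partial>lborel \<partial>\<nu>)"
    by (intro nn_integral_cong lborel_pair.Fubini') measurable
  also have "\<dots> = (\<integral>\<^sup>+y. \<integral>\<^sup>+x. \<integral>\<^sup>+r. 4 * (a y * (k r * in_ball x r y)) \<partial>lborel \<partial>\<nu> \<partial>lborel)"
    by (rule ps.Fubini') measurable
  also have "\<dots> = (\<integral>\<^sup>+y. 4 * (a y * weight \<nu> \<alpha> h y) \<partial>lborel)"
  proof (rule nn_integral_cong)
    fix y
    have "(\<integral>\<^sup>+x. \<integral>\<^sup>+r. 4 * (a y * (k r * in_ball x r y)) \<partial>lborel \<partial>\<nu>) = (\<integral>\<^sup>+r. \<integral>\<^sup>+x. 4 * (a y * (k r * in_ball x r y)) \<partial>\<nu> \<partial>lborel)"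
      by (rule ps'.Fubini') measurable
    also have "\<dots> = (\<integral>\<^sup>+r. 4 * (a y * (k r * (\<integral>\<^sup>+x. in_ball x r y \<partial>\<nu>))) \<partial>lborel)"
      by (intro nn_integral_cong) (simp add: nn_integral_cmult)
    also have "\<dots> = 4 * (a y * weight \<nu> \<alpha> h y)"
      unfolding weight_def k_def by (simp add: nn_integral_cmult)
    finally show "(\<integral>\<^sup>+x. \<integral>\<^sup>+r. 4 * (a y * (k r * in_ball x r y)) \<partial>lborel \<partial>\<nu>) = 4 * (a y * weight \<nu> \<alpha> h y)" .
  qed
  also have "\<dots> = 4 * (\<integral>\<^sup>+y. a y * weight \<nu> \<alpha> h y \<partial>lborel)"
    by (rule nn_integral_cmult) measurable
  also have "\<dots> \<le> 4 * ennreal (trace_const * V)"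
    unfolding a_def by (intro mult_left_mono mollified_trace \<epsilon> h) simp
  also have "\<dots> = ennreal (4 * trace_const * V)"
    using trace_const_nonneg V by (simp add: ennreal_mult mult.assoc)
  finally show ?thesis .
qed

text \<open>Fatou in \<open>r\<close> and then in \<open>x\<close>. The right side contains neither
  of the two small parameters, so the bound survives the limit.\<close>

lemma potential_bound:
  assumes b: "norm b \<le> 1"
  shows "(\<integral>\<^sup>+x. \<integral>\<^sup>+r. indicator {0<..} r * ennreal (r powr (\<alpha> - DIM('a) - 1) * \<bar>bump_gradient r b x\<bar>) \<partial>lborel \<partial>\<nu>)
    \<le> ennreal (4 * trace_const * V)"
proof -
  \<comment> \<open>One sequence serves both as mollification parameter and as lower limit of the
    radii.\<close>
  define h where "h n = 1 / real (Suc n)" for n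
  have h: "h n > 0" for n by (simp add: h_def)
  have h0: "h \<longlonglongrightarrow> 0" unfolding h_def by (rule LIMSEQ_Suc[OF lim_1_over_n])
  define Hn where "Hn n r x = (\<integral>y. mollified (h n) y * bump_deriv r b (x - y) \<partial>lborel)" for n r x
  define F where "F n x r = indicator {h n<..} r * ennreal (r powr (\<alpha> - DIM('a) - 1) * \<bar>Hn n r x\<bar>)" for n x r
  have [measurable]: "(\<lambda>(x, r). F n x r) \<in> borel_measurable (\<nu> \<Otimes>\<^sub>M lborel)" for n
    unfolding F_def Hn_def by measurable
  have [measurable]: "F n x \<in> borel_measurable borel" for n x
    unfolding F_def Hn_def by measurable
  have lim: "indicator {0<..} r * ennreal (r powr (\<alpha> - DIM('a) - 1) * \<bar>bump_gradient r b x\<bar>) \<le> liminf (\<lambda>n. F n x r)" for x r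
  proof (cases "r > 0")
    case True
    have "(\<lambda>n. Hn n r x) \<longlonglongrightarrow> bump_gradient r b x"
      unfolding Hn_def by (rule mollified_bump_deriv_tendsto[OF h0 h True b])
    then have "(\<lambda>n. ennreal (r powr (\<alpha> - DIM('a) - 1) * \<bar>Hn n r x\<bar>)) \<longlonglongrightarrow> ennreal (r powr (\<alpha> - DIM('a) - 1) * \<bar>bump_gradient r b x\<bar>)"
      by (intro tendsto_intros)
    moreover have "\<forall>\<^sub>F n in sequentially. ennreal (r powr (\<alpha> - DIM('a) - 1) * \<bar>Hn n r x\<bar>) = F n x r"
      using order_tendstoD(2)[OF h0 True] by eventually_elim (simp add: F_def)
    ultimately have "(\<lambda>n. F n x r) \<longlonglongrightarrow> ennreal (r powr (\<alpha> - DIM('a) - 1) * \<bar>bump_gradient r b x\<bar>)"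
      by (rule Lim_transform_eventually)
    then show ?thesis using True lim_imp_Liminf[OF sequentially_bot] by fastforce
  qed simp
  have "(\<integral>\<^sup>+x. \<integral>\<^sup>+r. indicator {0<..} r * ennreal (r powr (\<alpha> - DIM('a) - 1) * \<bar>bump_gradient r b x\<bar>) \<partial>lborel \<partial>\<nu>)
    \<le> (\<integral>\<^sup>+x. \<integral>\<^sup>+r. liminf (\<lambda>n. F n x r) \<partial>lborel \<partial>\<nu>)"
    by (intro nn_integral_mono lim)
  also have "\<dots> \<le> (\<integral>\<^sup>+x. liminf (\<lambda>n. \<integral>\<^sup>+r. F n x r \<partial>lborel) \<partial>\<nu>)"
    by (intro nn_integral_mono nn_integral_liminf) measurable
  also have "\<dots> \<le> liminf (\<lambda>n. \<integral>\<^sup>+x. \<integral>\<^sup>+r. F n x r \<partial>lborel \<partial>\<nu>)"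
    by (intro nn_integral_liminf) measurable
  also have "\<dots> \<le> ennreal (4 * trace_const * V)"
    unfolding F_def Hn_def by (intro Liminf_le always_eventually allI mollified_potential_bound h b) simp
  finally show ?thesis .
qed

text \<open>A finite measure has countably many atoms, and \<nu> does not charge points.\<close>

lemma AE_not_atom:
  assumes "finite_measure \<mu>" and sets: "sets \<mu> = sets borel"
  shows "AE x in \<nu>. emeasure \<mu> {x} = 0"
proof -
  interpret \<mu>: finite_measure \<mu> by fact
  have c: "countable {x. measure \<mu> {x} \<noteq> 0}" by (rule \<mu>.countable_support)
  have "(\<Union>x\<in>{x. measure \<mu> {x} \<noteq> 0}. {x}) \<in> null_sets \<nu>"
    using c emeasure_singleton by (intro null_sets_UN') (auto simp: sets_\<nu>)
  then show ?thesis
    by (rule AE_I') (auto simp: \<mu>.emeasure_eq_measure)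
qed

text \<open>The superposition formula holds for both Jordan parts off their atoms. Subtracting
  before taking absolute values keeps the cancellation. Integrability enters as a premise because
  otherwise the potential is 0 by convention, a case treated where the potential is
  unfolded.\<close>

lemma AE_kernel_bound:
  assumes b: "b \<in> Basis" and c: "riesz_bump_const (\<alpha> - DIM('a)) = ennreal c" "c > 0"
  shows "AE x in \<nu>. integrable (P b) (\<lambda>y. norm (x - y) powr (\<alpha> - DIM('a))) \<longrightarrow>
      integrable (N b) (\<lambda>y. norm (x - y) powr (\<alpha> - DIM('a))) \<longrightarrow>
    ennreal \<bar>(\<integral>y. norm (x - y) powr (\<alpha> - DIM('a)) \<partial>P b) - (\<integral>y. norm (x - y) powr (\<alpha> - DIM('a)) \<partial>N b)\<bar>
      \<le> ennreal (1 / c) * (\<integral>\<^sup>+r. indicator {0<..} r * ennreal (r powr (\<alpha> - DIM('a) - 1) * \<bar>bump_gradient r b x\<bar>) \<partial>lborel)"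
  using AE_not_atom[OF finite_P[OF b] sets_P] AE_not_atom[OF finite_N[OF b] sets_N]
proof (eventually_elim, intro impI)
  fix x
  assume atoms: "emeasure (P b) {x} = 0" "emeasure (N b) {x} = 0"
    and int: "integrable (P b) (\<lambda>y. norm (x - y) powr (\<alpha> - DIM('a)))" "integrable (N b) (\<lambda>y. norm (x - y) powr (\<alpha> - DIM('a)))"
  define p where "p = \<alpha> - DIM('a)"
  have p: "p < 0" using \<alpha> by (simp add: p_def)
  note kP = integral_norm_powr_eq_bump[OF finite_P[OF b] sets_P atoms(1) p int(1)[folded p_def] c[folded p_def]]
  note kN = integral_norm_powr_eq_bump[OF finite_N[OF b] sets_N atoms(2) p int(2)[folded p_def] c[folded p_def]]
  let ?kP = "\<integral>y. norm (x - y) powr p \<partial>P b" and ?kN = "\<integral>y. norm (x - y) powr p \<partial>N b"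
  have "c * (?kP - ?kN) = (\<integral>r. indicator {0<..} r * r powr (p - 1) * (\<integral>y. bump r (x - y) \<partial>P b)
      - indicator {0<..} r * r powr (p - 1) * (\<integral>y. bump r (x - y) \<partial>N b) \<partial>lborel)"
    using kP kN by (simp add: right_diff_distrib)
  \<comment> \<open>Integration by parts at each radius: the difference of the two bump averages is
    an integral of \<open>u\<close> against a derivative of the bump.\<close>
  also have "\<dots> = (\<integral>r. indicator {0<..} r * r powr (p - 1) * bump_gradient r b x \<partial>lborel)"
  proof (rule Bochner_Integration.integral_cong[OF refl])
    fix r :: real
    show "indicator {0<..} r * r powr (p - 1) * (\<integral>y. bump r (x - y) \<partial>P b) - indicator {0<..} r * r powr (p - 1) * (\<integral>y. bump r (x - y) \<partial>N b)
      = indicator {0<..} r * r powr (p - 1) * bump_gradient r b x"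
      unfolding bump_gradient_def using gradient[OF b, of r x] by (cases "r > 0") (simp_all add: right_diff_distrib)
  qed
  finally have "ennreal \<bar>c * (?kP - ?kN)\<bar> \<le> (\<integral>\<^sup>+r. ennreal (norm (indicator {0<..} r * r powr (p - 1) * bump_gradient r b x)) \<partial>lborel)"
    using integral_norm_bound_ennreal[of lborel "\<lambda>r. indicator {0<..} r * r powr (p - 1) * bump_gradient r b x"]
    by (cases "integrable lborel (\<lambda>r. indicator {0<..} r * r powr (p - 1) * bump_gradient r b x)") (auto simp: not_integrable_integral_eq)
  also have "\<dots> = (\<integral>\<^sup>+r. indicator {0<..} r * ennreal (r powr (p - 1) * \<bar>bump_gradient r b x\<bar>) \<partial>lborel)"
    by (intro nn_integral_cong) (auto simp: abs_mult split: split_indicator)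
  finally have "ennreal (1 / c) * ennreal \<bar>c * (?kP - ?kN)\<bar> \<le> ennreal (1 / c) * (\<integral>\<^sup>+r. indicator {0<..} r * ennreal (r powr (p - 1) * \<bar>bump_gradient r b x\<bar>) \<partial>lborel)"
    by (rule mult_left_mono) simp
  moreover have "ennreal (1 / c) * ennreal \<bar>c * (?kP - ?kN)\<bar> = ennreal \<bar>?kP - ?kN\<bar>"
    using c by (subst ennreal_mult[symmetric]) (auto simp: abs_mult)
  ultimately show "ennreal \<bar>(\<integral>y. norm (x - y) powr (\<alpha> - DIM('a)) \<partial>P b) - (\<integral>y. norm (x - y) powr (\<alpha> - DIM('a)) \<partial>N b)\<bar>
      \<le> ennreal (1 / c) * (\<integral>\<^sup>+r. indicator {0<..} r * ennreal (r powr (\<alpha> - DIM('a) - 1) * \<bar>bump_gradient r b x\<bar>) \<partial>lborel)"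
    by (simp add: p_def)
qed

end

section \<open>From gradient measures to the final estimate\<close>

lemma restrict_space_UNIV_eq: "restrict_space M UNIV = M"
  by (rule measure_eqI) (auto simp: sets_restrict_space emeasure_restrict_space)

text \<open>Gradients are defined with Lebesgue measurable functions, whereas the Tonelli arguments
  run over Borel measurable ones. A Borel function equal to \<open>w\<close> almost everywhere has
  the same integrals against test functions.\<close>

lemma bv_function_gradient_measure:
  fixes w :: "'a::euclidean_space \<Rightarrow> real"
  assumes w: "integrable lebesgue w" and m: "has_gradient_measure UNIV w m"
  obtains u where "bv_function u (\<lambda>b. positive_part borel (\<lambda>B. m B \<bullet> b)) (\<lambda>b. negative_part borel (\<lambda>B. m B \<bullet> b))
    (measure (total_variation borel m) UNIV)"
proof -
  have fvm: "finite_vector_measure borel m" using m by (simp add: has_gradient_measure_def restrict_space_UNIV_eq)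
  interpret T: finite_measure "total_variation borel m" by (rule finite_measure_total_variation[OF fvm])
  have "w \<in> borel_measurable lebesgue" using w by auto
  from completion_ex_borel_measurable_real[OF this]
  obtain u where u: "u \<in> borel_measurable lborel" and eq: "AE x in lborel. w x = u x" by blast
  have eq': "AE x in lebesgue. w x = u x" using eq by (rule AE_completion)
  have [measurable]: "u \<in> borel_measurable borel" using u by simp
  have "integrable lebesgue u"
    using w eq' by (subst integrable_cong_AE[symmetric, of w]) (auto intro: measurable_completion)
  then have int: "integrable lborel u" using u by (simp add: integrable_completion)
  have comp: "finite_vector_measure borel (\<lambda>B. m B \<bullet> b)" if "b \<in> Basis" for b
    using finite_vector_measure_inner(1)[OF fvm, of b] that by simp
  have "bv_function u (\<lambda>b. positive_part borel (\<lambda>B. m B \<bullet> b)) (\<lambda>b. negative_part borel (\<lambda>B. m B \<bullet> b))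
    (measure (total_variation borel m) UNIV)"
  proof (rule bv_function.intro)
    fix b :: 'a assume b: "b \<in> Basis"
    show "finite_measure (positive_part borel (\<lambda>B. m B \<bullet> b))" "finite_measure (negative_part borel (\<lambda>B. m B \<bullet> b))"
      by (intro finite_measure_positive_part finite_measure_negative_part comp b)+
    have "emeasure (positive_part borel (\<lambda>B. m B \<bullet> b)) UNIV + emeasure (negative_part borel (\<lambda>B. m B \<bullet> b)) UNIV
      = emeasure (total_variation borel (\<lambda>B. m B \<bullet> b)) UNIV"
      by (rule emeasure_positive_part_add_negative_part[OF comp[OF b]]) simp
    also have "\<dots> \<le> emeasure (total_variation borel m) UNIV"
      using finite_vector_measure_inner(2)[OF fvm, of b] b by simp
    also have "\<dots> = ennreal (measure (total_variation borel m) UNIV)" by (rule T.emeasure_eq_measure)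
    finally show "emeasure (positive_part borel (\<lambda>B. m B \<bullet> b)) UNIV + emeasure (negative_part borel (\<lambda>B. m B \<bullet> b)) UNIV
      \<le> ennreal (measure (total_variation borel m) UNIV)" .
    fix r :: real and x :: 'a assume r: "r > 0"
    interpret Tb: finite_measure "total_variation borel (\<lambda>B. m B \<bullet> b)"
      by (rule finite_measure_total_variation[OF comp[OF b]])
    have "integrable (total_variation borel (\<lambda>B. m B \<bullet> b)) (\<lambda>y. bump r (x - y))"
      by (rule Tb.integrable_const_bound[where B = 1]) (auto simp: bump_nonneg bump_le_one)
    then have "(\<integral>y. bump r (x - y) \<partial>positive_part borel (\<lambda>B. m B \<bullet> b)) - (\<integral>y. bump r (x - y) \<partial>negative_part borel (\<lambda>B. m B \<bullet> b))
      = signed_integral borel (\<lambda>B. m B \<bullet> b) (\<lambda>y. bump r (x - y))"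
      by (simp add: signed_integral_def)
    also have "\<dots> = - (\<integral>y. w y * frechet_derivative (\<lambda>y. bump r (x - y)) (at y) b \<partial>lebesgue)"
      using m test_function_bump[OF r, of x] b by (simp add: has_gradient_measure_def restrict_space_UNIV_eq)
    \<comment> \<open>The minus sign of the distributional derivative cancels the one from
      differentiating in \<open>y\<close>.\<close>
    also have "\<dots> = (\<integral>y. w y * bump_deriv r b (x - y) \<partial>lebesgue)"
      by (simp flip: frechet_derivative_at[OF bump_diff_has_derivative])
    also have "\<dots> = (\<integral>y. u y * bump_deriv r b (x - y) \<partial>lebesgue)"
    proof (rule integral_cong_AE)
      show "AE y in lebesgue. w y * bump_deriv r b (x - y) = u y * bump_deriv r b (x - y)"
        using eq' by eventually_elim simp
      have [measurable]: "w \<in> borel_measurable lebesgue" "u \<in> borel_measurable lebesgue"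
        "(\<lambda>y. bump_deriv r b (x - y)) \<in> borel_measurable lebesgue"
        using w by (auto intro: measurable_completion)
      show "(\<lambda>y. w y * bump_deriv r b (x - y)) \<in> borel_measurable lebesgue"
        "(\<lambda>y. u y * bump_deriv r b (x - y)) \<in> borel_measurable lebesgue" by measurable
    qed
    also have "\<dots> = (\<integral>y. u y * bump_deriv r b (x - y) \<partial>lborel)"
      by (rule integral_completion) measurable
    finally show "(\<integral>y. u y * bump_deriv r b (x - y) \<partial>lborel)
      = (\<integral>y. bump r (x - y) \<partial>positive_part borel (\<lambda>B. m B \<bullet> b)) - (\<integral>y. bump r (x - y) \<partial>negative_part borel (\<lambda>B. m B \<bullet> b))" by simp
  qed (use int in simp_all)
  then show thesis by (rule that)
qed

text \<open>The estimate on the whole space, for every measure that is a gradient of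
  \<open>w\<close> and with a constant chosen before \<open>w\<close>, the gradient and
  \<nu>.\<close>

lemma riesz_potential_gradient_bound:
  fixes \<alpha> K :: real
  assumes \<alpha>: "1 < \<alpha>" "\<alpha> < DIM('a)" and K: "K > 0"
  shows "\<exists>C\<ge>0. \<forall>(w :: 'a::euclidean_space \<Rightarrow> real) m (\<nu> :: 'a measure).
    integrable lebesgue w \<longrightarrow> has_gradient_measure UNIV w m \<longrightarrow> radon_measure \<nu> \<longrightarrow>
    (\<forall>x. \<forall>r>0. emeasure \<nu> (ball x r) \<le> ennreal (K * r powr (DIM('a) - \<alpha>))) \<longrightarrow>
    (\<integral>\<^sup>+x. ennreal (norm (riesz_potential \<alpha> m x)) \<partial>\<nu>) \<le> ennreal (C * measure (total_variation borel m) UNIV)"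
proof -
  obtain c where c: "riesz_bump_const (\<alpha> - DIM('a)) = ennreal c" "c > 0"
    using riesz_bump_const_finite[of "\<alpha> - DIM('a)"] riesz_bump_const_pos[of "\<alpha> - DIM('a)"] \<alpha>
    by (cases "riesz_bump_const (\<alpha> - DIM('a))") auto
  define q where "q = \<bar>1 / riesz_const DIM('a) \<alpha>\<bar>"
  \<comment> \<open>This is \<open>trace_const\<close> written out, since that constant is only
    available after \<open>bv_morrey\<close> has been interpreted for a particular \<open>w\<close>
    and \<nu>.\<close>
  define M where "M = K * (1 + unit_ball_vol DIM('a) * (DIM('a) + 1) powr (DIM('a) - \<alpha>) / (\<alpha> - 1))
    * 2 ^ (DIM('a) + 2) * real DIM('a) ^ (DIM('a) + 2) * unit_ball_vol DIM('a)"
  have M: "M \<ge> 0" unfolding M_def using \<alpha> K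
    by (intro mult_nonneg_nonneg add_nonneg_nonneg divide_nonneg_nonneg) auto
  show ?thesis
  proof (intro exI[of _ "DIM('a) * (q * (1 / c * (4 * M)))"] conjI allI impI)
    show "0 \<le> DIM('a) * (q * (1 / c * (4 * M)))" using c M by (simp add: q_def)
    fix w :: "'a \<Rightarrow> real" and m and \<nu> :: "'a measure"
    assume w: "integrable lebesgue w" and m: "has_gradient_measure UNIV w m" and \<nu>: "radon_measure \<nu>"
      and ball: "\<forall>x. \<forall>r>0. emeasure \<nu> (ball x r) \<le> ennreal (K * r powr (DIM('a) - \<alpha>))"
    define V where "V = measure (total_variation borel m) UNIV"
    obtain u where "bv_function u (\<lambda>b. positive_part borel (\<lambda>B. m B \<bullet> b)) (\<lambda>b. negative_part borel (\<lambda>B. m B \<bullet> b)) V"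
      unfolding V_def by (rule bv_function_gradient_measure[OF w m])
    then interpret bv_morrey u "\<lambda>b. positive_part borel (\<lambda>B. m B \<bullet> b)" "\<lambda>b. negative_part borel (\<lambda>B. m B \<bullet> b)" V \<nu> \<alpha> K
      using \<alpha> K \<nu> ball by (intro bv_morrey.intro morrey_measure.intro) (auto simp: radon_measure_def)
    have M_eq: "trace_const = M" by (simp add: trace_const_def morrey_const_def M_def)
    define S where "S b x = signed_integral borel (\<lambda>B. m B \<bullet> b) (\<lambda>y. norm (x - y) powr (\<alpha> - DIM('a)))" for b x
    define I where "I b x = (\<integral>\<^sup>+r. indicator {0<..} r * ennreal (r powr (\<alpha> - DIM('a) - 1) * \<bar>bump_gradient r b x\<bar>) \<partial>lborel)" for b x
    have [measurable]: "I b \<in> borel_measurable borel" for b unfolding I_def by measurable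
    have fvm: "finite_vector_measure borel m" using m by (simp add: has_gradient_measure_def restrict_space_UNIV_eq)
    have S: "AE x in \<nu>. ennreal \<bar>S b x\<bar> \<le> ennreal (1 / c) * I b x" if b: "b \<in> Basis" for b
      using AE_kernel_bound[OF b c]
    proof eventually_elim
      case (elim x)
      have "finite_vector_measure borel (\<lambda>B. m B \<bullet> b)"
        using finite_vector_measure_inner(1)[OF fvm, of b] b by simp
      from integrable_positive_negative_part[OF this]
      \<comment> \<open>If the kernel is not integrable for the total variation,
        \<open>signed_integral\<close> is 0. Otherwise it is integrable for both Jordan parts, which
        are the premises of the kernel bound.\<close>
      show ?case using elim unfolding S_def I_def signed_integral_def by auto
    qed
    then have "AE x in \<nu>. \<forall>b\<in>Basis. ennreal \<bar>S b x\<bar> \<le> ennreal (1 / c) * I b x"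
      by (intro AE_finite_allI) auto
    then have "AE x in \<nu>. ennreal (norm (riesz_potential \<alpha> m x)) \<le> (\<Sum>b\<in>Basis. ennreal q * (ennreal (1 / c) * I b x))"
    proof eventually_elim
      case (elim x)
      have "norm (riesz_potential \<alpha> m x) \<le> (\<Sum>b\<in>Basis. q * \<bar>S b x\<bar>)"
        unfolding riesz_potential_def S_def[symmetric] q_def
        by (rule sum_norm_le) (simp add: abs_mult)
      then have "ennreal (norm (riesz_potential \<alpha> m x)) \<le> (\<Sum>b\<in>Basis. ennreal q * ennreal \<bar>S b x\<bar>)"
        by (simp add: q_def sum_ennreal ennreal_leI flip: ennreal_mult)
      also have "\<dots> \<le> (\<Sum>b\<in>Basis. ennreal q * (ennreal (1 / c) * I b x))"
        using elim by (intro sum_mono mult_left_mono) auto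
      finally show ?case .
    qed
    then have "(\<integral>\<^sup>+x. ennreal (norm (riesz_potential \<alpha> m x)) \<partial>\<nu>) \<le> (\<integral>\<^sup>+x. (\<Sum>b\<in>Basis. ennreal q * (ennreal (1 / c) * I b x)) \<partial>\<nu>)"
      by (rule nn_integral_mono_AE)
    also have "\<dots> = (\<Sum>b\<in>Basis. \<integral>\<^sup>+x. ennreal q * (ennreal (1 / c) * I b x) \<partial>\<nu>)"
      by (rule nn_integral_sum) measurable
    also have "\<dots> = (\<Sum>b\<in>Basis. ennreal q * (ennreal (1 / c) * (\<integral>\<^sup>+x. I b x \<partial>\<nu>)))"
      by (simp add: nn_integral_cmult)
    also have "\<dots> \<le> (\<Sum>b\<in>(Basis :: 'a set). ennreal q * (ennreal (1 / c) * ennreal (4 * M * V)))"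
      unfolding I_def M_eq[symmetric]
      by (intro sum_mono mult_left_mono potential_bound) auto
    also have "\<dots> = ennreal (DIM('a) * (q * (1 / c * (4 * M))) * V)"
      using c M V by (simp add: q_def mult_ac ennreal_of_nat_eq_real_of_nat flip: ennreal_mult)
    finally show "(\<integral>\<^sup>+x. ennreal (norm (riesz_potential \<alpha> m x)) \<partial>\<nu>)
      \<le> ennreal (DIM('a) * (q * (1 / c * (4 * M))) * measure (total_variation borel m) UNIV)"
      unfolding V_def .
  qed
qed

text \<open>The whole-space estimate is applied to the extended function, whose total variation is
  at most its BV norm and hence at most a multiple of the BV norm of \<open>u\<close>.\<close>

theorem corollary1p9:
  fixes \<Omega> A :: "'a::euclidean_space set"
    and E :: "('a \<Rightarrow> real) \<Rightarrow> 'a \<Rightarrow> real"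
    and \<alpha> K :: real
  assumes "DIM('a) \<ge> 2"
    and "open \<Omega>" and "compact (frontier \<Omega>)" and "lipschitz_boundary \<Omega>"
    and "open A" and "closure \<Omega> \<subseteq> A"
    and "extension_operator \<Omega> A E"
    and "1 < \<alpha>" and "\<alpha> < DIM('a)"
    and "K > 0"
  shows "\<exists>C>0. \<forall>u\<in>BV \<Omega>. \<forall>\<nu>. radon_measure \<nu> \<longrightarrow>
           (\<forall>x. \<forall>r>0. emeasure \<nu> (ball x r) \<le> ennreal (K * r powr (DIM('a) - \<alpha>))) \<longrightarrow>
           (\<integral>\<^sup>+x. ennreal (norm (riesz_potential \<alpha> (gradient_measure UNIV (E u)) x)) \<partial>\<nu>)
             \<le> ennreal (C * (measure (variation \<Omega> u) \<Omega> + L1_norm \<Omega> u))"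
proof -
  obtain C0 where C0: "\<forall>u\<in>BV \<Omega>. E u \<in> BV UNIV \<and> BV_norm UNIV (E u) \<le> C0 * BV_norm \<Omega> u"
    using assms(7) unfolding extension_operator_def by metis
  obtain C where C: "C \<ge> 0" "\<forall>(w :: 'a \<Rightarrow> real) m (\<nu> :: 'a measure).
    integrable lebesgue w \<longrightarrow> has_gradient_measure UNIV w m \<longrightarrow> radon_measure \<nu> \<longrightarrow>
    (\<forall>x. \<forall>r>0. emeasure \<nu> (ball x r) \<le> ennreal (K * r powr (DIM('a) - \<alpha>))) \<longrightarrow>
    (\<integral>\<^sup>+x. ennreal (norm (riesz_potential \<alpha> m x)) \<partial>\<nu>) \<le> ennreal (C * measure (total_variation borel m) UNIV)"
    using riesz_potential_gradient_bound[OF assms(8-10)] by blast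
  \<comment> \<open>The bound \<open>C0\<close> may be negative and \<open>C\<close> may be 0; the
    absolute value and the two summands 1 make the constant positive.\<close>
  define D where "D = (C + 1) * (\<bar>C0\<bar> + 1)"
  show ?thesis
  proof (intro exI[of _ D] conjI ballI allI impI)
    show "D > 0" using C(1) by (simp add: D_def add_nonneg_pos)
    fix u and \<nu> :: "'a measure"
    assume u: "u \<in> BV \<Omega>" and \<nu>: "radon_measure \<nu>"
      and ball: "\<forall>x. \<forall>r>0. emeasure \<nu> (ball x r) \<le> ennreal (K * r powr (DIM('a) - \<alpha>))"
    define m where "m = gradient_measure UNIV (E u)"
    have Eu: "E u \<in> BV UNIV" using C0 u by blast
    then have int: "integrable lebesgue (E u)" and ex: "\<exists>m. has_gradient_measure UNIV (E u) m"
      by (auto simp: BV_def restrict_space_UNIV_eq)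
    \<comment> \<open>The measure selected by \<open>SOME\<close> is a gradient of
      \<open>E u\<close>, and the estimate holds for any such measure.\<close>
    from ex have m: "has_gradient_measure UNIV (E u) m"
      unfolding m_def gradient_measure_def by (rule someI_ex)
    have nn: "0 \<le> BV_norm \<Omega> u" by (simp add: BV_norm_def L1_norm_def)
    have "measure (total_variation borel m) UNIV \<le> BV_norm UNIV (E u)"
      by (simp add: BV_norm_def L1_norm_def m_def restrict_space_UNIV_eq)
    also have "\<dots> \<le> C0 * BV_norm \<Omega> u" using C0 u by blast
    also have "\<dots> \<le> (\<bar>C0\<bar> + 1) * BV_norm \<Omega> u" using nn by (intro mult_right_mono) auto
    finally have "C * measure (total_variation borel m) UNIV \<le> (C + 1) * ((\<bar>C0\<bar> + 1) * BV_norm \<Omega> u)"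
      using C(1) by (intro mult_mono) auto
    then have "ennreal (C * measure (total_variation borel m) UNIV) \<le> ennreal (D * (measure (variation \<Omega> u) \<Omega> + L1_norm \<Omega> u))"
      by (intro ennreal_leI) (simp add: D_def BV_norm_def algebra_simps)
    moreover have "(\<integral>\<^sup>+x. ennreal (norm (riesz_potential \<alpha> m x)) \<partial>\<nu>) \<le> ennreal (C * measure (total_variation borel m) UNIV)"
      using C(2) int m \<nu> ball by blast
    ultimately show "(\<integral>\<^sup>+x. ennreal (norm (riesz_potential \<alpha> (gradient_measure UNIV (E u)) x)) \<partial>\<nu>)
             \<le> ennreal (D * (measure (variation \<Omega> u) \<Omega> + L1_norm \<Omega> u))"
      unfolding m_def by (rule order_trans[rotated])
  qed
qed

end
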